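(* Let $P=(P_1,\dots,P_n)$ be a $(\delta_1,\dots,\delta_n)$-proper polynomial map from $\mathbf{C}^n$ to $\mathbf{C}^n$, where $\delta_j>0$ for all $j$, and let $D_j=\deg P_j$. Let $Q$ be a polynomial in the ideal $I(P_1,\dots,P_n)$ generated by $P_1,\dots,P_n$ in $\mathbf{C}[X_1,\dots,X_n]$. Then there exist complex numbers $\tilde\gamma_{\mu,\nu}$ such that $$Q(Y)=\sum_{\substack{\mu\in\mathbf{N}^n\setminus\{0\},\ \nu\in\mathbf{N}^n\\|\nu|\le D_1+\cdots+D_n-n\\\langle\mu+\underline1,\delta\rangle+|\nu|\le D_1+\cdots+D_n+\deg Q}}\tilde\gamma_{\mu,\nu}\,Y^\nu P(Y)^\mu .$$
   Context: Given rational numbers $0<\delta_j\le\deg P_j$, the map $P=(P_1,\dots,P_n)$ is called $(\delta_1,\dots,\delta_n)$-proper if there exist $c>0$, $R>0$ such that $\sum_{j=1}^n|P_j(\zeta)|(1+\|\zeta\|^2)^{-\delta_j/2}\ge c$ for all $\zeta\in\mathbf{C}^n$ with $\|\zeta\|\ge R$ (Euclidean norm). Notation: $Y^\nu=Y_1^{\nu_1}\cdots Y_n^{\nu_n}$, $P(Y)^\mu=P_1(Y)^{\mu_1}\cdots P_n(Y)^{\mu_n}$, $|\nu|=\nu_1+\cdots+\nu_n$, $\underline1=(1,\dots,1)$, $\langle\mu+\underline1,\delta\rangle=\sum_j(\mu_j+1)\delta_j$. *)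

theory Defs
  imports "HOL-Analysis.Analysis" "HOL-Library.Poly_Mapping"
begin

text \<open>
  \<open>\<complex>[X\<^sub>1, \<dots>, X\<^sub>n]\<close> is the monoid algebra of \<open>\<nat>\<^sup>n\<close>: the variables are indexed by a finite
  type \<open>'n\<close> with \<open>n = CARD('n)\<close>, and multiplication is the convolution product
  of \<^theory>\<open>HOL-Library.Poly_Mapping\<close>.
\<close>

type_synonym 'n multi_index = "'n \<Rightarrow>\<^sub>0 nat"

type_synonym 'n cpoly = "'n multi_index \<Rightarrow>\<^sub>0 complex"

definition mi_length :: "'n::finite multi_index \<Rightarrow> nat" where
  "mi_length \<nu> = (\<Sum>i\<in>UNIV. Poly_Mapping.lookup \<nu> i)"

definition cpoly_const :: "complex \<Rightarrow> 'n::finite cpoly" where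
  "cpoly_const c = Poly_Mapping.single 0 c"

definition cpoly_var :: "'n::finite \<Rightarrow> 'n cpoly" where
  "cpoly_var i = Poly_Mapping.single (Poly_Mapping.single i 1) 1"

text \<open>The total degree; the zero polynomial gets degree \<open>0\<close>.\<close>

definition cpoly_deg :: "'n::finite cpoly \<Rightarrow> nat" where
  "cpoly_deg p = Max (insert 0 (mi_length ` Poly_Mapping.keys p))"

definition cpoly_eval :: "'n::finite cpoly \<Rightarrow> complex ^ 'n \<Rightarrow> complex" where
  "cpoly_eval p z = (\<Sum>\<nu>\<in>Poly_Mapping.keys p. Poly_Mapping.lookup p \<nu> * (\<Prod>i\<in>UNIV. (z $ i) ^ Poly_Mapping.lookup \<nu> i))"

definition multi_power :: "('n::finite \<Rightarrow> 'n cpoly) \<Rightarrow> 'n multi_index \<Rightarrow> 'n cpoly" where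
  "multi_power F \<mu> = (\<Prod>j\<in>UNIV. F j ^ Poly_Mapping.lookup \<mu> j)"

text \<open>The ideal generated by a set: its span in the ring regarded as a module over itself.\<close>

definition ideal_gen :: "'a::comm_ring_1 set \<Rightarrow> 'a set" where
  "ideal_gen B = module.span (*) B"

definition delta_proper :: "('n::finite \<Rightarrow> rat) \<Rightarrow> ('n \<Rightarrow> 'n cpoly) \<Rightarrow> bool" where
  "delta_proper \<delta> P \<longleftrightarrow>
     (\<forall>j. 0 < \<delta> j \<and> \<delta> j \<le> of_nat (cpoly_deg (P j))) \<and>
     (\<exists>c>0. \<exists>R>0. \<forall>\<zeta>. norm \<zeta> \<ge> R \<longrightarrow>
        (\<Sum>j\<in>UNIV. norm (cpoly_eval (P j) \<zeta>) *
            (1 + (norm \<zeta>)\<^sup>2) powr (- real_of_rat (\<delta> j) / 2)) \<ge> c)"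

definition admissible_pairs ::
  "('n::finite \<Rightarrow> rat) \<Rightarrow> ('n \<Rightarrow> 'n cpoly) \<Rightarrow> 'n cpoly \<Rightarrow> ('n multi_index \<times> 'n multi_index) set" where
  "admissible_pairs \<delta> P Q = {(\<mu>, \<nu>). \<mu> \<noteq> 0 \<and>
     int (mi_length \<nu>) \<le> (\<Sum>j\<in>UNIV. int (cpoly_deg (P j))) - int CARD('n) \<and>
     (\<Sum>j\<in>UNIV. (of_nat (Poly_Mapping.lookup \<mu> j) + 1) * \<delta> j) + of_nat (mi_length \<nu>)
       \<le> (\<Sum>j\<in>UNIV. of_nat (cpoly_deg (P j))) + of_nat (cpoly_deg Q)}"

lemma module_self: "module ((*) :: 'a::comm_ring_1 \<Rightarrow> 'a \<Rightarrow> 'a)"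
  by unfold_locales (auto simp: algebra_simps)

lemma mem_ideal_gen_range_iff:
  fixes F :: "'n::finite \<Rightarrow> 'a::comm_ring_1"
  shows "q \<in> ideal_gen (range F) \<longleftrightarrow> (\<exists>A. q = (\<Sum>j\<in>UNIV. A j * F j))"
proof -
  interpret m: module "(*) :: 'a \<Rightarrow> 'a \<Rightarrow> 'a" by (rule module_self)
  show ?thesis
  proof
    assume "q \<in> ideal_gen (range F)"
    then obtain u where u: "q = (\<Sum>v\<in>range F. u v * v)"
      unfolding ideal_gen_def by (auto simp: m.span_finite)
    define g where "g = inv_into UNIV F"
    have g: "F (g v) = v" if "v \<in> range F" for v
      using that by (simp add: g_def f_inv_into_f)
    have "inj_on g (range F)" by (metis g inj_onI)
    then have "q = (\<Sum>j\<in>g ` range F. u (F j) * F j)"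
      by (simp add: u sum.reindex g)
    also have "\<dots> = (\<Sum>j\<in>UNIV. (if j \<in> g ` range F then u (F j) else 0) * F j)"
      by (rule sum.mono_neutral_cong_left) auto
    finally show "\<exists>A. q = (\<Sum>j\<in>UNIV. A j * F j)"
      by (intro exI[of _ "\<lambda>j. if j \<in> g ` range F then u (F j) else 0"])
  next
    assume "\<exists>A. q = (\<Sum>j\<in>UNIV. A j * F j)"
    then show "q \<in> ideal_gen (range F)"
      unfolding ideal_gen_def by (elim exE, hypsubst) (intro m.span_sum m.span_scale m.span_base rangeI)
  qed
qed

lemma finite_bounded_multi_index:
  "finite {\<mu> :: 'n::finite multi_index. \<forall>i. Poly_Mapping.lookup \<mu> i \<le> N i}"
proof -
  have "finite (PiE UNIV (\<lambda>i::'n. {..N i}))"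
    by (rule finite_PiE) auto
  then have "finite (Poly_Mapping.lookup ` {\<mu> :: 'n multi_index. \<forall>i. Poly_Mapping.lookup \<mu> i \<le> N i})"
    by (rule finite_subset[rotated]) (auto simp: PiE_UNIV_domain)
  then show ?thesis
    by (rule finite_imageD) (auto intro: inj_onI poly_mapping_eqI)
qed

text \<open>For positive weights the sum over \<^const>\<open>admissible_pairs\<close> is a genuine finite sum.\<close>

lemma finite_admissible_pairs:
  fixes \<delta> :: "'n::finite \<Rightarrow> rat"
  assumes "\<And>j. 0 < \<delta> j"
  shows "finite (admissible_pairs \<delta> P Q)"
proof -
  define M :: rat where
    "M = (\<Sum>j\<in>UNIV. of_nat (cpoly_deg (P j))) + of_nat (cpoly_deg Q)"
  define A where "A = {\<mu> :: 'n multi_index. \<forall>i. Poly_Mapping.lookup \<mu> i \<le> nat \<lceil>M / \<delta> i\<rceil>}"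
  define B where "B = {\<nu> :: 'n multi_index. \<forall>i. Poly_Mapping.lookup \<nu> i \<le> nat \<lceil>M\<rceil>}"
  have "admissible_pairs \<delta> P Q \<subseteq> A \<times> B"
  proof (clarsimp simp: admissible_pairs_def A_def B_def, intro conjI allI)
    fix \<mu> \<nu> :: "'n multi_index" and i
    assume *: "(\<Sum>j\<in>UNIV. (of_nat (Poly_Mapping.lookup \<mu> j) + 1) * \<delta> j) + of_nat (mi_length \<nu>)
       \<le> (\<Sum>j\<in>UNIV. of_nat (cpoly_deg (P j))) + of_nat (cpoly_deg Q)"
    have pos: "0 \<le> (of_nat (Poly_Mapping.lookup \<mu> j) + 1) * \<delta> j" for j
      using assms[of j] by simp
    have "(of_nat (Poly_Mapping.lookup \<mu> i) + 1) * \<delta> i \<le> (\<Sum>j\<in>UNIV. (of_nat (Poly_Mapping.lookup \<mu> j) + 1) * \<delta> j)"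
      by (rule member_le_sum) (use pos in auto)
    also have "\<dots> \<le> M" using * by (simp add: M_def)
    finally have "of_nat (Poly_Mapping.lookup \<mu> i) * \<delta> i \<le> M"
      using assms[of i] by (simp add: algebra_simps)
    then have "of_nat (Poly_Mapping.lookup \<mu> i) \<le> M / \<delta> i"
      using assms[of i] by (simp add: pos_le_divide_eq)
    then show "Poly_Mapping.lookup \<mu> i \<le> nat \<lceil>M / \<delta> i\<rceil>" by linarith
    have "Poly_Mapping.lookup \<nu> i \<le> mi_length \<nu>"
      unfolding mi_length_def by (rule member_le_sum) auto
    moreover have "0 \<le> (\<Sum>j\<in>UNIV. (of_nat (Poly_Mapping.lookup \<mu> j) + 1) * \<delta> j)"
      by (rule sum_nonneg) (use pos in auto)
    then have "of_nat (mi_length \<nu>) \<le> M" using * by (simp add: M_def)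
    ultimately show "Poly_Mapping.lookup \<nu> i \<le> nat \<lceil>M\<rceil>" by linarith
  qed
  moreover have "finite (A \<times> B)"
    unfolding A_def B_def by (intro finite_cartesian_product finite_bounded_multi_index)
  ultimately show ?thesis by (rule finite_subset)
qed

end

theory Submission
  imports Defs "HOL-Complex_Analysis.Complex_Analysis"
begin

text \<open>
  For generic \<open>w\<close> let \<open>res f w = \<Sum>\<^bsub>P(z) = w\<^esub> f(z) / jac P z\<close> be the global residue. If \<open>\<Delta>(x, y)\<close> is the
  determinant of divided differences of \<open>P\<close>, then \<open>\<Delta>(z, y)\<close> vanishes for \<open>P(z) = P(y)\<close>, \<open>z \<noteq> y\<close>, and
  \<open>\<Delta>(y, y) = jac P y\<close>; hence \<open>Q(y) = res (Q \<Delta>(\<cdot>, y)) (P(y))\<close>. Expanding \<open>\<Delta>(x, y) = \<Sum>\<^sub>\<nu> q\<^sub>\<nu>(x) y\<^sup>\<nu>\<close>,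
  it remains to see that \<open>res (Q q\<^sub>\<nu>)\<close> is a polynomial in \<open>w\<close> (transformation law for residues), that
  it has no constant term for \<open>Q\<close> in the ideal (because \<open>res (P\<^sub>j f) w = w\<^sub>j res f w\<close>), and that its
  \<open>\<delta>\<close>-weighted degree is at most \<open>deg (Q q\<^sub>\<nu>) + n - \<Sum>\<^sub>j \<delta>\<^sub>j\<close>. For the latter, properness bounds the
  branches of the inverse of \<open>P\<close> by \<open>O(s)\<close> on a polydisc with radii of order \<open>s powr \<delta>\<^sub>j\<close> that avoids the
  branch locus, and Cauchy's estimate gives \<open>1 / jac P = O(s powr (n - \<Sum>\<^sub>j \<delta>\<^sub>j))\<close> there.
\<close>

text \<open>The fibres are under control only off a hypersurface \<open>D = 0\<close>, so identities
  are proved there and extended by density of its complement. The obstacle is that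
  \<open>res f\<close> could blow up at \<open>D = 0\<close>, because \<open>jac P\<close> may
  vanish on fibres over it; growth alone therefore does not show that it is a polynomial. Symmetric
  functions such as the coefficients of \<Prod> (T - f z) over a fibre do stay bounded there, hence
  are polynomials by removable singularities and Liouville. The transformation law writes
  \<open>res f\<close> through one-variable power sums with such coefficients, in which the
  denominators cancel. The degree count: row i of \<open>bez P x y\<close> has total degree at most
  deg P_i - 1, so q_\<nu> has degree at most \<Sum> deg P_i - n - |\<nu>|. Adding deg Q and the n
  from the Jacobian estimate, the two n cancel and the stated bound remains. Properness enters in
  three ways: it keeps the Jacobian from vanishing identically, it bounds the fibres polynomially,
  and it supplies the weights in the Jacobian estimate.\<close>

no_notation fps_nth (infixl "$" 75)

abbreviation "lookup \<equiv> Poly_Mapping.lookup"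
abbreviation "keys \<equiv> Poly_Mapping.keys"
abbreviation "single \<equiv> Poly_Mapping.single"

section \<open>Polynomials and polynomial functions\<close>

definition mon :: "'n::finite multi_index \<Rightarrow> complex ^ 'n \<Rightarrow> complex" where
  "mon \<nu> z = (\<Prod>i\<in>UNIV. (z $ i) ^ lookup \<nu> i)"

lemma mon_0 [simp]: "mon 0 z = 1"
  by (simp add: mon_def)

lemma mon_add: "mon (\<mu> + \<nu>) z = mon \<mu> z * mon \<nu> z"
  by (simp add: mon_def lookup_add power_add prod.distrib)

lemma mon_single: "mon (single i k) z = z $ i ^ k"
proof -
  have "mon (single i k) z = (\<Prod>j\<in>UNIV. if j = i then z $ i ^ k else 1)"
    unfolding mon_def by (rule prod.cong) (auto simp: lookup_single when_def)
  then show ?thesis by simp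
qed

lemma mi_length_0 [simp]: "mi_length 0 = 0"
  by (simp add: mi_length_def)

lemma mi_length_add: "mi_length (\<mu> + \<nu>) = mi_length \<mu> + mi_length \<nu>"
  by (simp add: mi_length_def lookup_add sum.distrib)

lemma mi_length_single [simp]: "mi_length (single i k) = k"
proof -
  have "mi_length (single i k) = (\<Sum>j\<in>UNIV. if j = i then k else 0)"
    unfolding mi_length_def by (rule sum.cong) (auto simp: lookup_single when_def)
  then show ?thesis by simp
qed

lemma lookup_le_mi_length: "lookup \<nu> i \<le> mi_length \<nu>"
  unfolding mi_length_def by (rule member_le_sum) auto

lemma finite_mi_length_le: "finite {\<nu> :: 'n::finite multi_index. mi_length \<nu> \<le> d}"
  by (rule finite_subset[OF _ finite_bounded_multi_index[of "\<lambda>_. d"]])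
     (auto intro: order_trans[OF lookup_le_mi_length])

lemma cpoly_eval_superset:
  assumes "finite S" "keys p \<subseteq> S"
  shows "cpoly_eval p z = (\<Sum>\<nu>\<in>S. lookup p \<nu> * mon \<nu> z)"
  unfolding cpoly_eval_def mon_def[symmetric] using assms
  by (intro sum.mono_neutral_left) (auto simp: in_keys_iff)

lemma cpoly_eval_mon: "cpoly_eval p z = (\<Sum>\<nu>\<in>keys p. lookup p \<nu> * mon \<nu> z)"
  by (rule cpoly_eval_superset) auto

lemma cpoly_eval_zero [simp]: "cpoly_eval 0 z = 0"
  by (simp add: cpoly_eval_mon)

lemma cpoly_eval_add: "cpoly_eval (p + q) z = cpoly_eval p z + cpoly_eval q z"
proof -
  let ?S = "keys p \<union> keys q"
  have "keys (p + q) \<subseteq> ?S" by (rule keys_add)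
  then show ?thesis
    by (simp add: cpoly_eval_superset[of ?S] lookup_add algebra_simps sum.distrib)
qed

lemma cpoly_eval_sum: "cpoly_eval (\<Sum>i\<in>I. f i) z = (\<Sum>i\<in>I. cpoly_eval (f i) z)"
  by (induction I rule: infinite_finite_induct) (auto simp: cpoly_eval_add)

lemma cpoly_eval_single: "cpoly_eval (single \<nu> c) z = c * mon \<nu> z"
  by (subst cpoly_eval_superset[of "{\<nu>}"]) auto

lemma cpoly_eq_sum_single: "p = (\<Sum>\<nu>\<in>keys p. single \<nu> (lookup p \<nu>))"
  for p :: "'n::finite cpoly"
proof (rule poly_mapping_eqI)
  fix k
  have "(\<Sum>\<nu>\<in>keys p. lookup (single \<nu> (lookup p \<nu>)) k)
      = (\<Sum>\<nu>\<in>keys p. if \<nu> = k then lookup p k else 0)"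
    by (rule sum.cong) (auto simp: lookup_single when_def)
  then show "lookup p k =
      lookup (\<Sum>\<nu>\<in>keys p. single \<nu> (lookup p \<nu>)) k"
    by (simp add: lookup_sum in_keys_iff)
qed

lemma cpoly_eval_mult: "cpoly_eval (p * q) z = cpoly_eval p z * cpoly_eval q z"
proof -
  have "p * q = (\<Sum>\<mu>\<in>keys p. \<Sum>\<nu>\<in>keys q.
      single (\<mu> + \<nu>) (lookup p \<mu> * lookup q \<nu>))"
    by (subst cpoly_eq_sum_single[of p], subst cpoly_eq_sum_single[of q])
       (simp add: sum_product mult_single)
  then show ?thesis
    by (simp add: cpoly_eval_sum cpoly_eval_single cpoly_eval_mon[of p] cpoly_eval_mon[of q]
        sum_product mon_add algebra_simps)
qed

lemma cpoly_eval_one [simp]: "cpoly_eval 1 z = 1"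
  using cpoly_eval_single[of 0 1 z] by simp

lemma cpoly_eval_const [simp]: "cpoly_eval (cpoly_const c) z = c"
  by (simp add: cpoly_const_def cpoly_eval_single)

lemma cpoly_eval_var [simp]: "cpoly_eval (cpoly_var i) z = z $ i"
  by (simp add: cpoly_var_def cpoly_eval_single mon_single)

lemma cpoly_eval_prod: "cpoly_eval (\<Prod>i\<in>I. f i) z = (\<Prod>i\<in>I. cpoly_eval (f i) z)"
  by (induction I rule: infinite_finite_induct) (auto simp: cpoly_eval_mult)

lemma cpoly_eval_power: "cpoly_eval (p ^ k) z = cpoly_eval p z ^ k"
  by (induction k) (auto simp: cpoly_eval_mult)

definition pmap :: "('n::finite \<Rightarrow> 'n cpoly) \<Rightarrow> complex ^ 'n \<Rightarrow> complex ^ 'n" where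
  "pmap P z = (\<chi> j. cpoly_eval (P j) z)"

lemma pmap_nth [simp]: "pmap P z $ j = cpoly_eval (P j) z"
  by (simp add: pmap_def)

lemma cpoly_eval_multi_power: "cpoly_eval (multi_power F \<mu>) z = mon \<mu> (pmap F z)"
  by (simp add: multi_power_def cpoly_eval_prod cpoly_eval_power mon_def)

lemma pmap_var [simp]: "pmap cpoly_var z = z"
  by (simp add: vec_eq_iff)

text \<open>Induction on the variables: with all but one of them fixed, the sum is a univariate
  polynomial with infinitely many zeros, so its coefficients vanish separately. The hypothesis that
  exponents in \<open>K\<close> are determined on \<open>S\<close> survives when \<open>K\<close> is
  cut down to one exponent of the removed variable.\<close>

lemma separated_monomials_zero:
  fixes c :: "('n \<Rightarrow> nat) \<Rightarrow> complex"
  assumes "finite S"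
  shows "finite K \<Longrightarrow> (\<And>\<nu> \<nu>'. \<nu> \<in> K \<Longrightarrow> \<nu>' \<in> K \<Longrightarrow> (\<forall>i\<in>S. \<nu> i = \<nu>' i) \<Longrightarrow> \<nu> = \<nu>') \<Longrightarrow>
     (\<And>z. (\<Sum>\<nu>\<in>K. c \<nu> * (\<Prod>i\<in>S. z i ^ \<nu> i)) = 0) \<Longrightarrow> \<nu> \<in> K \<Longrightarrow> c \<nu> = 0"
  using assms
proof (induction S arbitrary: K \<nu> rule: finite_induct)
  case empty
  have "K = {\<nu>}" using empty.prems by auto
  then show ?case using empty.prems(3)[of "\<lambda>_. 0"] by simp
next
  case (insert i S)
  define K' where "K' = {\<nu>'\<in>K. \<nu>' i = \<nu> i}"
  show ?case
  proof (rule insert.IH[of K'])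
    show "finite K'" using insert.prems(1) by (simp add: K'_def)
    show "\<nu> \<in> K'" using insert.prems(4) by (simp add: K'_def)
    show "\<mu> = \<mu>'" if "\<mu> \<in> K'" "\<mu>' \<in> K'" "\<forall>j\<in>S. \<mu> j = \<mu>' j" for \<mu> \<mu>'
      using that by (intro insert.prems(2)) (auto simp: K'_def)
    fix z :: "'n \<Rightarrow> complex"
    define q where "q = (\<Sum>\<mu>\<in>K. Polynomial.monom (c \<mu> * (\<Prod>j\<in>S. z j ^ \<mu> j)) (\<mu> i))"
    have "poly q t = 0" for t
    proof -
      have "(\<Prod>j\<in>insert i S. (z(i := t)) j ^ \<mu> j) = t ^ \<mu> i * (\<Prod>j\<in>S. z j ^ \<mu> j)" for \<mu>
      proof -
        have "(\<Prod>j\<in>S. (z(i := t)) j ^ \<mu> j) = (\<Prod>j\<in>S. z j ^ \<mu> j)"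
          by (rule prod.cong) (use insert.hyps in auto)
        then show ?thesis using insert.hyps by simp
      qed
      then have "poly q t = (\<Sum>\<mu>\<in>K. c \<mu> * (\<Prod>j\<in>insert i S. (z(i := t)) j ^ \<mu> j))"
        by (simp add: q_def poly_sum poly_monom mult_ac)
      then show ?thesis using insert.prems(3) by simp
    qed
    then have "q = 0" using poly_all_0_iff_0 by blast
    then have "coeff q (\<nu> i) = 0" by simp
    then have "(\<Sum>\<mu>\<in>K. if \<mu> i = \<nu> i then c \<mu> * (\<Prod>j\<in>S. z j ^ \<mu> j) else 0) = 0"
      by (simp add: q_def coeff_sum)
    then show "(\<Sum>\<mu>\<in>K'. c \<mu> * (\<Prod>j\<in>S. z j ^ \<mu> j)) = 0"
      using insert.prems(1) by (simp add: K'_def sum.inter_filter)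
  qed
qed

lemma cpoly_eq_zeroI:
  assumes "\<And>z. cpoly_eval p z = 0"
  shows "p = 0"
proof (rule poly_mapping_eqI)
  fix \<nu>
  show "lookup p \<nu> = lookup 0 \<nu>"
  proof (cases "\<nu> \<in> keys p")
    case True
    define c where "c f = lookup p (Abs_poly_mapping f)" for f
    have "c (lookup \<nu>) = 0"
    proof (rule separated_monomials_zero[of UNIV "lookup ` keys p"])
      fix z :: "'a \<Rightarrow> complex"
      have "inj_on lookup (keys p)"
        by (auto intro: inj_onI poly_mapping_eqI)
      then show "(\<Sum>\<nu>\<in>lookup ` keys p. c \<nu> * (\<Prod>i\<in>UNIV. z i ^ \<nu> i)) = 0"
        using assms[of "\<chi> i. z i"]
        by (simp add: sum.reindex c_def cpoly_eval_mon mon_def lookup_inverse)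
    qed (use True in auto)
    then show ?thesis by (simp add: c_def lookup_inverse)
  qed (simp add: in_keys_iff)
qed

lemma cpoly_eval_uminus: "cpoly_eval (- p) z = - cpoly_eval p z"
proof -
  have "cpoly_eval (- p) z + cpoly_eval p z = 0"
    by (simp add: cpoly_eval_add[symmetric])
  then show ?thesis by (simp add: eq_neg_iff_add_eq_0)
qed

lemma cpoly_eval_diff: "cpoly_eval (p - q) z = cpoly_eval p z - cpoly_eval q z"
  using cpoly_eval_add[of p "- q"] by (simp add: cpoly_eval_uminus)

lemma cpoly_eqI:
  assumes "\<And>z. cpoly_eval p z = cpoly_eval q z"
  shows "p = q"
  using cpoly_eq_zeroI[of "p - q"] assms by (simp add: cpoly_eval_diff)

section \<open>Polynomial functions and their restrictions to complex lines\<close>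

definition polyfun :: "(complex ^ 'n::finite \<Rightarrow> complex) \<Rightarrow> bool" where
  "polyfun f \<longleftrightarrow> (\<exists>p. f = cpoly_eval p)"

named_theorems polyfun_intros

lemma polyfun_cpoly_eval [polyfun_intros, simp]: "polyfun (cpoly_eval p)"
  by (auto simp: polyfun_def)

lemma polyfun_const [polyfun_intros, simp]: "polyfun (\<lambda>z. c)"
  unfolding polyfun_def by (rule exI[of _ "cpoly_const c"]) (simp add: fun_eq_iff)

lemma polyfun_nth [polyfun_intros, simp]: "polyfun (\<lambda>z. z $ i)"
  unfolding polyfun_def by (rule exI[of _ "cpoly_var i"]) (simp add: fun_eq_iff)

lemma polyfun_add [polyfun_intros]: "polyfun f \<Longrightarrow> polyfun g \<Longrightarrow> polyfun (\<lambda>z. f z + g z)"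
  by (force simp: polyfun_def fun_eq_iff intro: cpoly_eval_add[symmetric])

lemma polyfun_mult [polyfun_intros]: "polyfun f \<Longrightarrow> polyfun g \<Longrightarrow> polyfun (\<lambda>z. f z * g z)"
  by (force simp: polyfun_def fun_eq_iff intro: cpoly_eval_mult[symmetric])

lemma polyfun_uminus [polyfun_intros]: "polyfun f \<Longrightarrow> polyfun (\<lambda>z. - f z)"
  by (force simp: polyfun_def fun_eq_iff intro: cpoly_eval_uminus[symmetric])

lemma polyfun_diff [polyfun_intros]: "polyfun f \<Longrightarrow> polyfun g \<Longrightarrow> polyfun (\<lambda>z. f z - g z)"
  by (force simp: polyfun_def fun_eq_iff intro: cpoly_eval_diff[symmetric])

lemma polyfun_sum [polyfun_intros]: "(\<And>i. i \<in> I \<Longrightarrow> polyfun (f i)) \<Longrightarrow> polyfun (\<lambda>z. \<Sum>i\<in>I. f i z)"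
  by (induction I rule: infinite_finite_induct) (auto intro!: polyfun_intros)

lemma polyfun_prod [polyfun_intros]: "(\<And>i. i \<in> I \<Longrightarrow> polyfun (f i)) \<Longrightarrow> polyfun (\<lambda>z. \<Prod>i\<in>I. f i z)"
  by (induction I rule: infinite_finite_induct) (auto intro!: polyfun_intros)

lemma polyfun_power [polyfun_intros]: "polyfun f \<Longrightarrow> polyfun (\<lambda>z. f z ^ k)"
  by (induction k) (auto intro!: polyfun_intros)

lemma polyfun_det [polyfun_intros]:
  "(\<And>i j. polyfun (\<lambda>z. A z $ i $ j)) \<Longrightarrow> polyfun (\<lambda>z. det (A z :: complex ^ 'm ^ 'm))"
  unfolding det_def by (intro polyfun_intros)

lemma polyfun_compose:
  assumes "polyfun f" "\<And>i. polyfun (\<lambda>z. g z $ i)"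
  shows "polyfun (\<lambda>z. f (g z))"
proof -
  obtain p where "f = cpoly_eval p" using assms(1) by (auto simp: polyfun_def)
  then have "(\<lambda>z. f (g z)) =
      (\<lambda>z. \<Sum>\<nu>\<in>keys p. lookup p \<nu> * (\<Prod>i\<in>UNIV. (g z $ i) ^ lookup \<nu> i))"
    by (simp add: fun_eq_iff cpoly_eval_mon mon_def)
  then show ?thesis using assms(2) by (auto intro!: polyfun_intros)
qed

lemma polyfun_pmap: "polyfun f \<Longrightarrow> polyfun (\<lambda>z. f (pmap P z))"
  by (rule polyfun_compose) simp_all

lemma polyfun_continuous_on: "polyfun f \<Longrightarrow> continuous_on S f"
  unfolding polyfun_def cpoly_eval_def by (auto intro!: continuous_intros)

lemma continuous_on_pmap: "continuous_on S (pmap P)"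
  unfolding pmap_def by (intro continuous_on_vec_lambda polyfun_continuous_on) simp

lemma polyfun_line_poly:
  assumes "polyfun f"
  obtains q where "\<And>t. f (a + t *s b) = poly q t"
proof -
  obtain p where p: "f = cpoly_eval p" using assms by (auto simp: polyfun_def)
  show thesis
    by (rule that[of "\<Sum>\<nu>\<in>keys p. smult (lookup p \<nu>)
          (\<Prod>i\<in>UNIV. [:a $ i, b $ i:] ^ lookup \<nu> i)"])
       (simp add: p cpoly_eval_mon mon_def poly_sum poly_prod algebra_simps)
qed

lemma polyfun_line_finite_zeros:
  assumes "polyfun f" "f (a + t0 *s b) \<noteq> 0"
  shows "finite {t. f (a + t *s b) = 0}"
proof -
  obtain q where q: "\<And>t. f (a + t *s b) = poly q t" 
    using polyfun_line_poly[OF assms(1), of a b] by blast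
  then have "q \<noteq> 0" using assms(2) by auto
  then show ?thesis by (simp add: q poly_roots_finite)
qed

text \<open>On the complex line through \<open>a\<close> and \<open>b\<close> each function has only
  finitely many zeros. This is the irreducibility of affine space.\<close>

lemma polyfun_nonzero_both:
  assumes "polyfun f" "polyfun g" "f a \<noteq> 0" "g b \<noteq> 0"
  shows "\<exists>z. f z \<noteq> 0 \<and> g z \<noteq> 0"
proof -
  have "finite {t. f (a + t *s (b - a)) = 0}"
    by (rule polyfun_line_finite_zeros[of _ _ 0]) (use assms in auto)
  moreover have "finite {t. g (a + t *s (b - a)) = 0}"
    by (rule polyfun_line_finite_zeros[of _ _ 1]) (use assms in auto)
  ultimately have "finite ({t. f (a + t *s (b - a)) = 0} \<union> {t. g (a + t *s (b - a)) = 0})" by simp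
  then obtain t where "t \<notin> {t. f (a + t *s (b - a)) = 0} \<union> {t. g (a + t *s (b - a)) = 0}"
    using ex_new_if_finite infinite_UNIV_char_0 by blast
  then show ?thesis by auto
qed

lemma polyfun_zero_on_open:
  assumes "polyfun f" "open S" "a \<in> S" "\<And>z. z \<in> S \<Longrightarrow> f z = 0"
  shows "f z = 0"
proof (rule ccontr)
  assume "f z \<noteq> 0"
  then have fin: "finite {t. f (a + t *s (z - a)) = 0}"
    by (intro polyfun_line_finite_zeros[of _ _ 1]) (use assms in auto)
  have "open ((\<lambda>t. a + t *s (z - a)) -` S)"
    by (rule open_vimage[OF assms(2)]) (auto intro!: continuous_intros simp: vector_scalar_mult_def)
  moreover have "0 \<in> (\<lambda>t. a + t *s (z - a)) -` S" using assms(3) by simp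
  ultimately have "infinite ((\<lambda>t. a + t *s (z - a)) -` S)"
    by (metis empty_iff finite_imp_not_open)
  moreover have "(\<lambda>t. a + t *s (z - a)) -` S \<subseteq> {t. f (a + t *s (z - a)) = 0}"
    using assms(4) by auto
  ultimately show False using fin finite_subset by blast
qed

text \<open>Validity on a nonempty Zariski open set. Any two such sets meet, so finitely many
  generic properties can be combined, and a generic identity between polynomials is an
  identity.\<close>

definition generic :: "(complex ^ 'n::finite \<Rightarrow> bool) \<Rightarrow> bool" where
  "generic Q \<longleftrightarrow> (\<exists>D. polyfun D \<and> (\<exists>z. D z \<noteq> 0) \<and> (\<forall>z. D z \<noteq> 0 \<longrightarrow> Q z))"

lemma genericI: "polyfun D \<Longrightarrow> D z \<noteq> 0 \<Longrightarrow> (\<And>z. D z \<noteq> 0 \<Longrightarrow> Q z) \<Longrightarrow> generic Q"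
  unfolding generic_def by blast

lemma generic_conj:
  assumes "generic Q" "generic R"
  shows "generic (\<lambda>z. Q z \<and> R z)"
proof -
  obtain D E a b where D: "polyfun D" "D a \<noteq> 0" "\<And>z. D z \<noteq> 0 \<Longrightarrow> Q z"
    and E: "polyfun E" "E b \<noteq> 0" "\<And>z. E z \<noteq> 0 \<Longrightarrow> R z"
    using assms unfolding generic_def by metis
  obtain z where z: "D z \<noteq> 0" "E z \<noteq> 0" using polyfun_nonzero_both[OF D(1) E(1) D(2) E(2)] by blast
  show ?thesis
    by (rule genericI[of "\<lambda>z. D z * E z" z]) (use D E z in \<open>auto intro: polyfun_intros\<close>)
qed

lemma generic_mono: "generic Q \<Longrightarrow> (\<And>z. Q z \<Longrightarrow> R z) \<Longrightarrow> generic R"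
  unfolding generic_def by blast

lemma generic_True [simp]: "generic (\<lambda>z. True)"
  by (rule genericI[of "\<lambda>_. 1"]) auto

lemma generic_Ball:
  assumes "finite I" "\<And>i. i \<in> I \<Longrightarrow> generic (Q i)"
  shows "generic (\<lambda>z. \<forall>i\<in>I. Q i z)"
  using assms by (induction I rule: finite_induct) (auto intro: generic_conj)

lemma generic_ex: "generic Q \<Longrightarrow> \<exists>z. Q z"
  unfolding generic_def by blast

lemma generic_eq_imp_eq:
  assumes "polyfun f" "polyfun g" "generic (\<lambda>z. f z = g z)"
  shows "f = g"
proof (rule ccontr)
  assume "f \<noteq> g"
  then obtain z where "f z - g z \<noteq> 0" by force
  then have "generic (\<lambda>z. f z \<noteq> g z)"
    by (intro genericI[of "\<lambda>z. f z - g z"]) (use assms in \<open>auto intro: polyfun_intros\<close>)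
  from generic_ex[OF generic_conj[OF this assms(3)]] show False by blast
qed

section \<open>Polynomials in two vectors and divided differences\<close>

text \<open>The bound \<open>d\<close> is on the total degree in both vectors together. The
  inductive form avoids a normal form, so closure under products and determinants is a plain
  induction; coefficients are collected only in \<open>bipoly_eq_sum_mon\<close>.\<close>

inductive bipoly :: "nat \<Rightarrow> (complex ^ 'n::finite \<Rightarrow> complex ^ 'n \<Rightarrow> complex) \<Rightarrow> bool" for d where
  bipoly_mon: "mi_length \<alpha> + mi_length \<beta> \<le> d \<Longrightarrow> bipoly d (\<lambda>x y. c * mon \<alpha> x * mon \<beta> y)"
| bipoly_add: "bipoly d f \<Longrightarrow> bipoly d g \<Longrightarrow> bipoly d (\<lambda>x y. f x y + g x y)"

lemma bipoly_const: "bipoly d (\<lambda>x y. c)"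
  using bipoly_mon[of 0 0 d c] by simp

lemma bipoly_mono: "bipoly d f \<Longrightarrow> d \<le> e \<Longrightarrow> bipoly e f"
  by (induction rule: bipoly.induct) (auto intro: bipoly.intros)

lemma bipoly_fst: "1 \<le> d \<Longrightarrow> bipoly d (\<lambda>x y. x $ i)"
  using bipoly_mon[of "single i 1" 0 d 1] by (simp add: mon_single)

lemma bipoly_snd: "1 \<le> d \<Longrightarrow> bipoly d (\<lambda>x y. y $ i)"
  using bipoly_mon[of 0 "single i 1" d 1] by (simp add: mon_single)

lemma bipoly_mult:
  assumes "bipoly d f" "bipoly e g"
  shows "bipoly (d + e) (\<lambda>x y. f x y * g x y)"
  using assms
proof (induction rule: bipoly.induct)
  case (bipoly_mon \<alpha> \<beta> c)
  show ?case using bipoly_mon(2)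
  proof (induction rule: bipoly.induct)
    case (bipoly_mon \<alpha>' \<beta>' c')
    have "bipoly (d + e) (\<lambda>x y. (c * c') * mon (\<alpha> + \<alpha>') x * mon (\<beta> + \<beta>') y)"
      using bipoly_mon \<open>mi_length \<alpha> + mi_length \<beta> \<le> d\<close>
      by (intro bipoly.bipoly_mon) (simp add: mi_length_add)
    then show ?case by (simp add: mon_add mult_ac)
  next
    case (bipoly_add f g)
    show ?case using bipoly.bipoly_add[OF bipoly_add.IH] by (simp add: algebra_simps)
  qed
next
  case (bipoly_add f g')
  show ?case using bipoly.bipoly_add[OF bipoly_add.IH[OF bipoly_add.prems]] by (simp add: algebra_simps)
qed

lemma bipoly_scale: "bipoly d f \<Longrightarrow> bipoly d (\<lambda>x y. c * f x y)"
  using bipoly_mult[OF bipoly_const[of 0 c]] by simp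

lemma bipoly_sum: "(\<And>i. i \<in> I \<Longrightarrow> bipoly d (f i)) \<Longrightarrow> bipoly d (\<lambda>x y. \<Sum>i\<in>I. f i x y)"
  by (induction I rule: infinite_finite_induct) (auto intro: bipoly_const bipoly_add)

lemma bipoly_prod: "(\<And>i. i \<in> I \<Longrightarrow> bipoly (d i) (f i)) \<Longrightarrow> bipoly (\<Sum>i\<in>I. d i) (\<lambda>x y. \<Prod>i\<in>I. f i x y)"
  by (induction I rule: infinite_finite_induct) (auto intro: bipoly_const bipoly_mult)

lemma bipoly_det:
  fixes A :: "complex ^ 'n::finite \<Rightarrow> complex ^ 'n \<Rightarrow> complex ^ 'm ^ 'm"
  assumes "\<And>i j. bipoly (d i) (\<lambda>x y. A x y $ i $ j)"
  shows "bipoly (\<Sum>i\<in>UNIV. d i) (\<lambda>x y. det (A x y))"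
  unfolding det_def by (intro bipoly_sum bipoly_scale bipoly_prod assms)

text \<open>Collecting the powers of \<open>y\<close> leaves polynomials in \<open>x\<close>. The
  joint degree bound is the trade-off between the degree of q_\<nu> and |\<nu>| on which the final
  estimate rests.\<close>

lemma bipoly_eq_sum_mon:
  assumes "bipoly d f"
  obtains q where "\<And>\<nu> \<alpha>. \<alpha> \<in> keys (q \<nu>) \<Longrightarrow> mi_length \<alpha> + mi_length \<nu> \<le> d"
    and "\<And>x y. f x y = (\<Sum>\<nu> | mi_length \<nu> \<le> d. cpoly_eval (q \<nu>) x * mon \<nu> y)"
proof -
  from assms have "\<exists>q. (\<forall>\<nu>. \<forall>\<alpha>\<in>keys (q \<nu>). mi_length \<alpha> + mi_length \<nu> \<le> d) \<and>
      (\<forall>x y. f x y = (\<Sum>\<nu> | mi_length \<nu> \<le> d. cpoly_eval (q \<nu>) x * mon \<nu> y))"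
  proof (induction rule: bipoly.induct)
    case (bipoly_mon \<alpha> \<beta> c)
    define q where "q \<nu> = (if \<nu> = \<beta> then single \<alpha> c else 0)" for \<nu> :: "'a multi_index"
    have "c * mon \<alpha> x * mon \<beta> y = (\<Sum>\<nu> | mi_length \<nu> \<le> d. cpoly_eval (q \<nu>) x * mon \<nu> y)" for x y
    proof -
      have "(\<Sum>\<nu> | mi_length \<nu> \<le> d. cpoly_eval (q \<nu>) x * mon \<nu> y)
          = (\<Sum>\<nu> | mi_length \<nu> \<le> d. if \<nu> = \<beta> then c * mon \<alpha> x * mon \<beta> y else 0)"
        by (rule sum.cong) (auto simp: q_def cpoly_eval_single)
      then show ?thesis using bipoly_mon by (simp add: finite_mi_length_le)
    qed
    then show ?case using bipoly_mon by (intro exI[of _ q]) (auto simp: q_def split: if_splits)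
  next
    case (bipoly_add f g)
    then obtain q r where q: "\<forall>\<nu>. \<forall>\<alpha>\<in>keys (q \<nu>). mi_length \<alpha> + mi_length \<nu> \<le> d"
        "\<forall>x y. f x y = (\<Sum>\<nu> | mi_length \<nu> \<le> d. cpoly_eval (q \<nu>) x * mon \<nu> y)"
      and r: "\<forall>\<nu>. \<forall>\<alpha>\<in>keys (r \<nu>). mi_length \<alpha> + mi_length \<nu> \<le> d"
        "\<forall>x y. g x y = (\<Sum>\<nu> | mi_length \<nu> \<le> d. cpoly_eval (r \<nu>) x * mon \<nu> y)"
      by (elim exE conjE)
    show ?case
    proof (intro exI[of _ "\<lambda>\<nu>. q \<nu> + r \<nu>"] conjI allI ballI)
      show "mi_length \<alpha> + mi_length \<nu> \<le> d" if "\<alpha> \<in> keys (q \<nu> + r \<nu>)" for \<nu> \<alpha>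
        using subsetD[OF keys_add that] q(1) r(1) by auto
      show "f x y + g x y = (\<Sum>\<nu> | mi_length \<nu> \<le> d. cpoly_eval (q \<nu> + r \<nu>) x * mon \<nu> y)" for x y
        by (simp add: q(2) r(2) cpoly_eval_add algebra_simps sum.distrib)
    qed
  qed
  then show thesis using that by blast
qed

lemma polyfun_mon [polyfun_intros]: "polyfun (mon \<nu>)"
proof -
  have "mon \<nu> = cpoly_eval (single \<nu> 1)"
    by (simp add: fun_eq_iff cpoly_eval_single)
  then show ?thesis by simp
qed

lemma polyfun_bipoly_compose:
  assumes "bipoly d f" "\<And>i. polyfun (\<lambda>z. g z $ i)" "\<And>i. polyfun (\<lambda>z. h z $ i)"
  shows "polyfun (\<lambda>z. f (g z) (h z))"
  using assms(1)
proof (induction rule: bipoly.induct)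
  case (bipoly_mon \<alpha> \<beta> c)
  show ?case by (intro polyfun_mult polyfun_const polyfun_compose[OF polyfun_mon] assms(2,3))
qed (rule polyfun_add)

text \<open>The version without a degree, for the kernel \<open>B\<close> of the transformation law,
  where only polynomiality in both arguments matters.\<close>

definition bipolyfun :: "(complex ^ 'n::finite \<Rightarrow> complex ^ 'n \<Rightarrow> complex) \<Rightarrow> bool" where
  "bipolyfun f \<longleftrightarrow> (\<exists>d. bipoly d f)"

lemma bipolyfun_const: "bipolyfun (\<lambda>x y. c)"
  unfolding bipolyfun_def by (blast intro: bipoly_const)

lemma bipolyfun_fst: "bipolyfun (\<lambda>x y. x $ i)"
  unfolding bipolyfun_def by (blast intro: bipoly_fst)

lemma bipolyfun_snd: "bipolyfun (\<lambda>x y. y $ i)"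
  unfolding bipolyfun_def by (blast intro: bipoly_snd)

lemma bipolyfun_mult: "bipolyfun f \<Longrightarrow> bipolyfun g \<Longrightarrow> bipolyfun (\<lambda>x y. f x y * g x y)"
  unfolding bipolyfun_def by (blast intro: bipoly_mult)

lemma bipolyfun_add: "bipolyfun f \<Longrightarrow> bipolyfun g \<Longrightarrow> bipolyfun (\<lambda>x y. f x y + g x y)"
  unfolding bipolyfun_def by (blast intro: bipoly_add bipoly_mono[OF _ le_add1] bipoly_mono[OF _ le_add2])

lemma bipolyfun_sum: "(\<And>i. i \<in> I \<Longrightarrow> bipolyfun (f i)) \<Longrightarrow> bipolyfun (\<lambda>x y. \<Sum>i\<in>I. f i x y)"
  by (induction I rule: infinite_finite_induct) (auto intro: bipolyfun_const bipolyfun_add)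

lemma bipolyfun_prod: "(\<And>i. i \<in> I \<Longrightarrow> bipolyfun (f i)) \<Longrightarrow> bipolyfun (\<lambda>x y. \<Prod>i\<in>I. f i x y)"
  by (induction I rule: infinite_finite_induct) (auto intro: bipolyfun_const bipolyfun_mult)

lemma bipolyfun_power: "bipolyfun f \<Longrightarrow> bipolyfun (\<lambda>x y. f x y ^ k)"
  by (induction k) (auto intro: bipolyfun_const bipolyfun_mult)

lemma bipolyfun_det:
  fixes A :: "complex ^ 'n::finite \<Rightarrow> complex ^ 'n \<Rightarrow> complex ^ 'm ^ 'm"
  assumes "\<And>i j. bipolyfun (\<lambda>x y. A x y $ i $ j)"
  shows "bipolyfun (\<lambda>x y. det (A x y))"
  unfolding det_def by (intro bipolyfun_sum bipolyfun_mult bipolyfun_const bipolyfun_prod assms)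

lemma bipolyfun_compose:
  assumes "polyfun p" "\<And>i. bipolyfun (\<lambda>x y. g x y $ i)"
  shows "bipolyfun (\<lambda>x y. p (g x y))"
proof -
  obtain q where q: "p = cpoly_eval q" using assms(1) by (auto simp: polyfun_def)
  show ?thesis
    unfolding q cpoly_eval_def
    by (intro bipolyfun_sum bipolyfun_mult bipolyfun_const bipolyfun_prod bipolyfun_power assms(2))
qed

lemma bipolyfun_compose2:
  assumes "bipoly d f" "\<And>i. bipolyfun (\<lambda>x y. g x y $ i)" "\<And>i. bipolyfun (\<lambda>x y. h x y $ i)"
  shows "bipolyfun (\<lambda>x y. f (g x y) (h x y))"
  using assms(1)
proof (induction rule: bipoly.induct)
  case (bipoly_mon \<alpha> \<beta> c)
  show ?case by (intro bipolyfun_mult bipolyfun_const bipolyfun_compose[OF polyfun_mon] assms(2,3))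
qed (rule bipolyfun_add)

lemma continuous_on_bipoly:
  assumes "bipoly d f"
  shows "continuous_on S (\<lambda>z. f (fst z) (snd z))"
  using assms by (induction rule: bipoly.induct) (auto simp: mon_def intro!: continuous_intros)

text \<open>Split off one variable: x_k x^\<mu> - y_k y^\<mu> = x_k (x^\<mu> - y^\<mu>) + y^\<mu>
  (x_k - y_k). The clause for length 0 repairs the truncated subtraction
  \<open>mi_length \<nu> - 1\<close>: when \<mu> = 0, multiplication by x_k would raise the degree
  from 0 to 1 unless \<open>M\<close> vanishes.\<close>

lemma mon_divided_difference:
  fixes \<nu> :: "'n::finite multi_index"
  shows "\<exists>M. (\<forall>j. bipoly (mi_length \<nu> - 1) (M j)) \<and>
    (mi_length \<nu> = 0 \<longrightarrow> (\<forall>j x y. M j x y = 0)) \<and>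
    (\<forall>x y. mon \<nu> x - mon \<nu> y = (\<Sum>j\<in>UNIV. M j x y * (x $ j - y $ j)))"
proof (induction "mi_length \<nu>" arbitrary: \<nu>)
  case 0
  then have "lookup \<nu> i = 0" for i
    using lookup_le_mi_length[of \<nu> i] by simp
  then have "\<nu> = 0" by (intro poly_mapping_eqI) simp
  then show ?case by (intro exI[of _ "\<lambda>_ _ _. 0"]) (auto intro: bipoly_const)
next
  case (Suc l)
  then obtain k where k: "lookup \<nu> k \<noteq> 0"
    unfolding mi_length_def by (metis nat.distinct(1) sum.neutral)
  define \<mu> where "\<mu> = \<nu> - single k 1"
  have \<nu>: "\<nu> = \<mu> + single k 1"
    using k by (intro poly_mapping_eqI)
      (auto simp: \<mu>_def lookup_add lookup_minus lookup_single when_def)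
  have l: "l = mi_length \<mu>" using Suc(2) by (simp add: \<nu> mi_length_add)
  from Suc(1)[OF l] obtain M where M: "\<forall>j. bipoly (mi_length \<mu> - 1) (M j)"
      "mi_length \<mu> = 0 \<longrightarrow> (\<forall>j x y. M j x y = 0)"
      "\<forall>x y. mon \<mu> x - mon \<mu> y = (\<Sum>j\<in>UNIV. M j x y * (x $ j - y $ j))"
    by (elim exE conjE)
  define N where "N j x y = x $ k * M j x y + (if j = k then mon \<mu> y else 0)" for j x y
  have "bipoly (mi_length \<nu> - 1) (N j)" for j
  proof -
    have "bipoly (mi_length \<mu>) (\<lambda>x y. x $ k * M j x y)"
    proof (cases "mi_length \<mu> = 0")
      case True
      then show ?thesis using M(2) by (simp add: bipoly_const)
    next
      case False
      have "bipoly (1 + (mi_length \<mu> - 1)) (\<lambda>x y. x $ k * M j x y)"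
        by (intro bipoly_mult bipoly_fst M(1)[rule_format]) simp
      then show ?thesis using False by simp
    qed
    moreover have "bipoly (mi_length \<mu>) (\<lambda>x y. if j = k then mon \<mu> y else 0)"
      using bipoly_mon[of 0 \<mu> "mi_length \<mu>" 1] bipoly_const[of "mi_length \<mu>" 0]
      by (cases "j = k") simp_all
    ultimately have "bipoly (mi_length \<mu>) (\<lambda>x y. x $ k * M j x y + (if j = k then mon \<mu> y else 0))"
      by (rule bipoly_add)
    then show ?thesis by (simp add: N_def[abs_def] \<nu> mi_length_add)
  qed
  moreover have "mon \<nu> x - mon \<nu> y = (\<Sum>j\<in>UNIV. N j x y * (x $ j - y $ j))" for x y
  proof -
    have "(\<Sum>j\<in>UNIV. N j x y * (x $ j - y $ j)) =
        (\<Sum>j\<in>UNIV. x $ k * (M j x y * (x $ j - y $ j)) + (if j = k then mon \<mu> y * (x $ k - y $ k) else 0))"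
      by (rule sum.cong) (auto simp: N_def algebra_simps)
    also have "\<dots> = x $ k * (mon \<mu> x - mon \<mu> y) + mon \<mu> y * (x $ k - y $ k)"
      by (simp add: sum.distrib M(3) sum_distrib_left)
    also have "\<dots> = mon \<nu> x - mon \<nu> y"
      by (simp add: \<nu> mon_add mon_single algebra_simps)
    finally show ?thesis by simp
  qed
  ultimately show ?case using Suc(2) by (intro exI[of _ N]) auto
qed

lemma mi_length_le_cpoly_deg: "\<nu> \<in> keys p \<Longrightarrow> mi_length \<nu> \<le> cpoly_deg p"
  unfolding cpoly_deg_def by (intro Max_ge) auto

lemma ex_divided_difference:
  fixes p :: "'n::finite cpoly"
  shows "\<exists>M. (\<forall>j. bipoly (cpoly_deg p - 1) (M j)) \<and>
    (\<forall>x y. cpoly_eval p x - cpoly_eval p y = (\<Sum>j\<in>UNIV. M j x y * (x $ j - y $ j)))"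
proof -
  obtain M :: "'n multi_index \<Rightarrow> 'n \<Rightarrow> complex ^ 'n \<Rightarrow> complex ^ 'n \<Rightarrow> complex"
    where M: "\<And>\<nu> j. bipoly (mi_length \<nu> - 1) (M \<nu> j)"
      "\<And>\<nu> x y. mon \<nu> x - mon \<nu> y = (\<Sum>j\<in>UNIV. M \<nu> j x y * (x $ j - y $ j))"
  proof -
    have "\<forall>\<nu> :: 'n multi_index. \<exists>M. (\<forall>j. bipoly (mi_length \<nu> - 1) (M j)) \<and>
        (\<forall>x y. mon \<nu> x - mon \<nu> y = (\<Sum>j\<in>UNIV. M j x y * (x $ j - y $ j)))"
      using mon_divided_difference by blast
    from choice[OF this] show thesis using that by blast
  qed
  define N where "N j x y = (\<Sum>\<nu>\<in>keys p. lookup p \<nu> * M \<nu> j x y)" for j x y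
  have "bipoly (cpoly_deg p - 1) (N j)" for j
    unfolding N_def[abs_def]
    by (intro bipoly_sum bipoly_scale bipoly_mono[OF M(1)] diff_le_mono mi_length_le_cpoly_deg)
  moreover have "cpoly_eval p x - cpoly_eval p y = (\<Sum>j\<in>UNIV. N j x y * (x $ j - y $ j))" for x y
  proof -
    have "cpoly_eval p x - cpoly_eval p y =
        (\<Sum>\<nu>\<in>keys p. lookup p \<nu> * (mon \<nu> x - mon \<nu> y))"
      by (simp add: cpoly_eval_mon sum_subtractf algebra_simps)
    also have "\<dots> = (\<Sum>\<nu>\<in>keys p. \<Sum>j\<in>UNIV. lookup p \<nu> * M \<nu> j x y * (x $ j - y $ j))"
      by (simp add: M(2) sum_distrib_left mult_ac)
    also have "\<dots> = (\<Sum>j\<in>UNIV. N j x y * (x $ j - y $ j))"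
      by (subst sum.swap) (simp add: N_def sum_distrib_right)
    finally show ?thesis .
  qed
  ultimately show ?thesis by blast
qed

text \<open>Divided differences in several variables are not unique, so some choice with the right
  degree is fixed. On the diagonal the choice is immaterial: there they are the partial
  derivatives.\<close>

definition divided_difference :: "'n::finite cpoly \<Rightarrow> 'n \<Rightarrow> complex ^ 'n \<Rightarrow> complex ^ 'n \<Rightarrow> complex" where
  "divided_difference p = (SOME M. (\<forall>j. bipoly (cpoly_deg p - 1) (M j)) \<and>
    (\<forall>x y. cpoly_eval p x - cpoly_eval p y = (\<Sum>j\<in>UNIV. M j x y * (x $ j - y $ j))))"

lemma bipoly_divided_difference: "bipoly (cpoly_deg p - 1) (divided_difference p j)"
  and divided_difference: "cpoly_eval p x - cpoly_eval p y =
    (\<Sum>j\<in>UNIV. divided_difference p j x y * (x $ j - y $ j))"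
  using someI_ex[OF ex_divided_difference[of p]] unfolding divided_difference_def by blast+

text \<open>The matrix whose determinant is the Bezoutian; on the diagonal it is the Jacobian matrix.\<close>

definition bez :: "('n::finite \<Rightarrow> 'n cpoly) \<Rightarrow> complex ^ 'n \<Rightarrow> complex ^ 'n \<Rightarrow> complex ^ 'n ^ 'n" where
  "bez P x y = (\<chi> i j. divided_difference (P i) j x y)"

definition jac :: "('n::finite \<Rightarrow> 'n cpoly) \<Rightarrow> complex ^ 'n \<Rightarrow> complex" where
  "jac P x = det (bez P x x)"

text \<open>If \<open>x\<close> and \<open>y\<close> are distinct points of one fibre,
  \<open>x - y\<close> is a kernel vector of \<open>bez P x y\<close>. This gives both the local
  injectivity of \<open>P\<close> and the vanishing of the Bezoutian between different points of a
  fibre.\<close>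

lemma pmap_diff: "pmap P x - pmap P y = bez P x y *v (x - y)"
  by (simp add: vec_eq_iff bez_def matrix_vector_mult_def divided_difference)

lemma polyfun_jac: "polyfun (jac P)"
proof -
  have "polyfun (\<lambda>x. bez P x x $ i $ j)" for i j
    unfolding bez_def by (simp add: polyfun_bipoly_compose[OF bipoly_divided_difference])
  then show ?thesis
    unfolding jac_def by (rule polyfun_det)
qed

section \<open>Derivatives and local inverses of polynomial maps\<close>

lemma polyfun_differentiable: "polyfun f \<Longrightarrow> f differentiable (at x)"
proof -
  assume "polyfun f"
  then obtain p where p: "f = cpoly_eval p" by (auto simp: polyfun_def)
  have nth: "(\<lambda>z::complex^'a. z $ i) differentiable (at x)" for i
    by (rule bounded_linear_imp_differentiable) (rule bounded_linear_vec_nth)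
  have pow: "(\<lambda>z::complex^'a. (z $ i) ^ k) differentiable (at x)" for i k
    by (intro differentiable_power nth)
  have "(\<lambda>z::complex^'a. \<Prod>i\<in>I. (z $ i) ^ k i) differentiable (at x)" if "finite I" for I k
    using that by (induction I rule: finite_induct) (auto intro!: differentiable_mult pow)
  then have "(\<lambda>z. \<Sum>\<nu>\<in>keys p. lookup p \<nu> * (\<Prod>i\<in>UNIV. (z $ i) ^ lookup \<nu> i))
       differentiable (at x)"
    by (intro differentiable_sum differentiable_mult differentiable_const) auto
  then show ?thesis unfolding p cpoly_eval_def .
qed

text \<open>In p(y) - p(x) = \<Sum> M_j(y, x) (y_j - x_j) each summand has a factor vanishing at y =
  x, so the product rule leaves only M_j(x, x).\<close>

lemma cpoly_eval_has_derivative: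
  "(cpoly_eval p has_derivative (\<lambda>h. \<Sum>j\<in>UNIV. divided_difference p j x x * h $ j)) (at x)"
proof -
  have "((\<lambda>y. divided_difference p j y x * (y $ j - x $ j)) has_derivative
      (\<lambda>h. divided_difference p j x x * h $ j)) (at x)" for j
  proof -
    have "polyfun (\<lambda>y. divided_difference p j y x)"
      by (rule polyfun_bipoly_compose[OF bipoly_divided_difference]) auto
    then have "(\<lambda>y. divided_difference p j y x) differentiable (at x)"
      by (rule polyfun_differentiable)
    then obtain D where D: "((\<lambda>y. divided_difference p j y x) has_derivative D) (at x)"
      by (auto simp: differentiable_def)
    have "((\<lambda>y. y $ j - x $ j) has_derivative (\<lambda>h. h $ j)) (at x)"
      by (auto intro!: derivative_eq_intros bounded_linear_imp_has_derivative bounded_linear_vec_nth)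
    from has_derivative_mult[OF D this] show ?thesis by simp
  qed
  then have "((\<lambda>y. \<Sum>j\<in>UNIV. divided_difference p j y x * (y $ j - x $ j)) has_derivative
      (\<lambda>h. \<Sum>j\<in>UNIV. divided_difference p j x x * h $ j)) (at x)"
    by (intro has_derivative_sum)
  then have "((\<lambda>y. cpoly_eval p y - cpoly_eval p x) has_derivative
      (\<lambda>h. \<Sum>j\<in>UNIV. divided_difference p j x x * h $ j)) (at x)"
    by (simp add: divided_difference)
  from has_derivative_add[OF this has_derivative_const[of "cpoly_eval p x"]] show ?thesis by simp
qed

lemma has_derivative_vecI:
  fixes f :: "'a::real_normed_vector \<Rightarrow> complex ^ 'n::finite"
  assumes "\<And>i. ((\<lambda>x. f x $ i) has_derivative (\<lambda>h. f' h $ i)) (at a)"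
  shows "(f has_derivative f') (at a)"
proof -
  have "((\<lambda>x. f x \<bullet> b) has_derivative (\<lambda>h. f' h \<bullet> b)) (at a)" if "b \<in> Basis" for b
  proof -
    from that obtain i u where "b = axis i u" by (auto simp: Basis_vec_def)
    then show ?thesis
      using has_derivative_inner_left[OF assms, of i u] by (simp add: inner_axis)
  qed
  then show ?thesis by (subst has_derivative_componentwise_within) auto
qed

lemma pmap_has_derivative: "(pmap P has_derivative (\<lambda>h. bez P x x *v h)) (at x)"
  by (rule has_derivative_vecI)
     (simp add: matrix_vector_mult_def bez_def cpoly_eval_has_derivative)

text \<open>By continuity \<open>bez P x y\<close> is invertible for x, y near a, so
  \<open>pmap_diff\<close> makes \<open>P\<close> injective there; invariance of domain then gives
  open image and continuous inverse.\<close>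

lemma pmap_local_homeomorphism:
  assumes "jac P a \<noteq> 0" "open W" "a \<in> W"
  obtains U g where "open U" "a \<in> U" "U \<subseteq> W" "open (pmap P ` U)" "homeomorphism U (pmap P ` U) (pmap P) g"
proof -
  let ?S = "(\<lambda>z. det (bez P (fst z) (snd z))) -` (- {0})"
  have "open ?S"
  proof (rule open_vimage)
    have "bipoly (\<Sum>i\<in>UNIV. cpoly_deg (P i) - 1) (\<lambda>x y. det (bez P x y))"
      by (rule bipoly_det) (use bipoly_divided_difference in \<open>simp add: bez_def\<close>)
    then show "continuous_on UNIV (\<lambda>z. det (bez P (fst z) (snd z)))"
      by (rule continuous_on_bipoly)
  qed auto
  moreover have "(a, a) \<in> ?S" using assms(1) by (simp add: jac_def)
  ultimately obtain A B where AB: "open A" "open B" "(a, a) \<in> A \<times> B" "A \<times> B \<subseteq> ?S"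
    by (rule open_prod_elim)
  define U where "U = A \<inter> B \<inter> W"
  have U: "open U" "a \<in> U" "U \<subseteq> W" using AB assms by (auto simp: U_def)
  have "inj_on (pmap P) U"
  proof (rule inj_onI)
    fix x y assume xy: "x \<in> U" "y \<in> U" "pmap P x = pmap P y"
    have "(x, y) \<in> ?S" using xy(1,2) AB(4) by (auto simp: U_def)
    then have "invertible (bez P x y)" by (simp add: invertible_det_nz)
    moreover have "bez P x y *v (x - y) = 0" using pmap_diff[of P x y] xy(3) by simp
    ultimately have "x - y = 0"
      by (metis invertible_def matrix_vector_mul_assoc matrix_vector_mul_lid matrix_vector_mult_0_right)
    then show "x = y" by simp
  qed
  note inj = this
  have cont: "continuous_on U (pmap P)" by (rule continuous_on_pmap)
  obtain g where "homeomorphism U (pmap P ` U) (pmap P) g"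
    using invariance_of_domain_homeomorphism[OF U(1) cont _ inj] by auto
  then show thesis
    using U that invariance_of_domain[OF cont U(1) inj] by blast
qed

text \<open>\<open>P\<close> maps a neighbourhood of \<open>a\<close> onto an open set, and a
  nonzero polynomial cannot vanish identically on it; so its pullback along \<open>P\<close> is
  nonzero too.\<close>

lemma generic_pmap:
  assumes "jac P a \<noteq> 0" "generic Q"
  shows "generic (\<lambda>x. Q (pmap P x))"
proof -
  obtain D b where D: "polyfun D" "D b \<noteq> 0" "\<And>z. D z \<noteq> 0 \<Longrightarrow> Q z"
    using assms(2) unfolding generic_def by metis
  obtain U g where U: "open U" "a \<in> U" "open (pmap P ` U)"
    using pmap_local_homeomorphism[OF assms(1), of UNIV] by auto
  have "\<exists>x. D (pmap P x) \<noteq> 0"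
    using polyfun_zero_on_open[OF D(1) U(3), of "pmap P a" b] U(2) D(2) by auto
  then show ?thesis
    using genericI[OF polyfun_pmap[OF D(1)]] D(3) by metis
qed

section \<open>The finite covering defined by a dominant polynomial map\<close>

lemma card_box: "card {\<mu> :: 'n::finite multi_index. \<forall>i. lookup \<mu> i \<le> d} = (d + 1) ^ CARD('n)"
proof -
  have "bij_betw lookup {\<mu> :: 'n multi_index. \<forall>i. lookup \<mu> i \<le> d} (PiE UNIV (\<lambda>_. {..d}))"
  proof (rule bij_betw_imageI)
    show "inj_on lookup {\<mu> :: 'n multi_index. \<forall>i. lookup \<mu> i \<le> d}"
      by (auto intro: inj_onI poly_mapping_eqI)
    have "f \<in> lookup ` {\<mu>. \<forall>i. lookup \<mu> i \<le> d}"
      if "f \<in> PiE UNIV (\<lambda>_. {..d})" for f :: "'n \<Rightarrow> nat"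
      using that by (intro image_eqI[of _ _ "Abs_poly_mapping f"]) (auto simp: PiE_UNIV_domain)
    then show "lookup ` {\<mu> :: 'n multi_index. \<forall>i. lookup \<mu> i \<le> d} = PiE UNIV (\<lambda>_. {..d})"
      by (auto simp: PiE_UNIV_domain)
  qed
  then show ?thesis by (simp add: bij_betw_same_card card_PiE)
qed

text \<open>Bounding each exponent instead of the total degree makes the number of admissible
  monomials an exact power, which keeps the dimension count elementary.\<close>

definition in_box :: "nat \<Rightarrow> 'n::finite cpoly \<Rightarrow> bool" where
  "in_box N p \<longleftrightarrow> (\<forall>\<nu>\<in>keys p. \<forall>i. lookup \<nu> i \<le> N)"

lemma in_box_mono: "in_box N p \<Longrightarrow> N \<le> M \<Longrightarrow> in_box M p"
  unfolding in_box_def by (meson order_trans)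

lemma in_box_deg: "in_box (cpoly_deg p) p"
  unfolding in_box_def by (meson lookup_le_mi_length mi_length_le_cpoly_deg order_trans)

lemma in_box_one: "in_box 0 1"
  by (simp add: in_box_def)

lemma in_box_mult:
  assumes "in_box N p" "in_box M q"
  shows "in_box (N + M) (p * q)"
  unfolding in_box_def
proof (intro ballI allI)
  fix \<nu> i assume "\<nu> \<in> keys (p * q)"
  from subsetD[OF keys_mult this] obtain \<alpha> \<beta>
    where "\<nu> = \<alpha> + \<beta>" "\<alpha> \<in> keys p" "\<beta> \<in> keys q" by blast
  then show "lookup \<nu> i \<le> N + M"
    using assms by (auto simp: in_box_def lookup_add intro: add_mono)
qed

lemma in_box_power: "in_box N p \<Longrightarrow> in_box (k * N) (p ^ k)"
  by (induction k) (auto simp: in_box_one intro: in_box_mult)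

lemma in_box_prod: "(\<And>i. i \<in> I \<Longrightarrow> in_box (N i) (f i)) \<Longrightarrow> in_box (\<Sum>i\<in>I. N i) (\<Prod>i\<in>I. f i)"
  by (induction I rule: infinite_finite_induct) (auto simp: in_box_one intro: in_box_mult)

lemma vector_space_cpoly: "vector_space (\<lambda>a (p :: 'n::finite cpoly). cpoly_const a * p)"
  by unfold_locales (auto simp: cpoly_const_def algebra_simps single_add mult_single simp flip: mult.assoc)

text \<open>Dimension count: the products \<open>f\<^sup>k P\<^sup>\<mu>\<close> with bounded exponents outnumber the monomials that occur in them.\<close>

lemma algebraic_relation:
  fixes f :: "'n::finite cpoly" and P :: "'n \<Rightarrow> 'n cpoly"
  obtains d c where "\<exists>k\<le>d. c k \<noteq> 0"
    "\<And>x. (\<Sum>k\<le>d. cpoly_eval f x ^ k * cpoly_eval (c k) (pmap P x)) = 0"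
proof -
  interpret vs: vector_space "\<lambda>a (p :: 'n cpoly). cpoly_const a * p" by (rule vector_space_cpoly)
  let ?n = "CARD('n)"
  let ?box = "\<lambda>N. {\<mu> :: 'n multi_index. \<forall>i. lookup \<mu> i \<le> N}"
  define E where "E = cpoly_deg f + (\<Sum>j\<in>UNIV. cpoly_deg (P j))"
  have f: "in_box E f" by (rule in_box_mono[OF in_box_deg]) (simp add: E_def)
  have P: "in_box E (P j)" for j
  proof (rule in_box_mono[OF in_box_deg])
    have "cpoly_deg (P j) \<le> (\<Sum>j\<in>UNIV. cpoly_deg (P j))" by (rule member_le_sum) auto
    then show "cpoly_deg (P j) \<le> E" by (simp add: E_def)
  qed
  \<comment> \<open>\<open>K\<close> is chosen so that N + 1 \<le> K (d + 1). With d = K^n the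
    available monomials number at most K^n (d + 1)^n = d (d + 1)^n, fewer than the (d + 1)^(n + 1)
    products indexed by \<open>I\<close>.\<close>
  define K where "K = (?n + 1) * E + 1"
  define d where "d = K ^ ?n"
  define N where "N = (?n + 1) * d * E"
  define I where "I = {..d} \<times> ?box d"
  define v where "v = (\<lambda>(k, \<mu>). f ^ k * multi_power P \<mu>)"
  have finI: "finite I"
    unfolding I_def by (intro finite_cartesian_product finite_bounded_multi_index) simp
  have v_box: "in_box N (v a)" if "a \<in> I" for a
  proof -
    obtain k \<mu> where a: "a = (k, \<mu>)" by force
    have k: "k \<le> d" and \<mu>: "\<And>i. lookup \<mu> i \<le> d" using that by (auto simp: I_def a)
    have "in_box (k * E + (\<Sum>j\<in>UNIV. lookup \<mu> j * E)) (v a)"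
      unfolding v_def a multi_power_def by (auto intro!: in_box_mult in_box_power in_box_prod f P)
    moreover have "(\<Sum>j\<in>UNIV. lookup \<mu> j * E) \<le> (\<Sum>j\<in>(UNIV :: 'n set). d * E)"
      by (intro sum_mono mult_right_mono \<mu>) simp
    then have "k * E + (\<Sum>j\<in>UNIV. lookup \<mu> j * E) \<le> N"
    proof -
      have "N = d * E + (\<Sum>j\<in>(UNIV :: 'n set). d * E)" by (simp add: N_def algebra_simps)
      moreover have "k * E \<le> d * E" using k by simp
      ultimately show ?thesis
        using \<open>(\<Sum>j\<in>UNIV. lookup \<mu> j * E) \<le> (\<Sum>j\<in>(UNIV :: 'n set). d * E)\<close> by linarith
    qed
    ultimately show ?thesis by (rule in_box_mono)
  qed
  define B where "B = (\<lambda>\<nu>. single \<nu> (1::complex)) ` ?box N"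
  have finB: "finite B" unfolding B_def by (intro finite_imageI finite_bounded_multi_index)
  have span: "p \<in> vs.span B" if "in_box N p" for p
  proof -
    have "p = (\<Sum>\<nu>\<in>keys p. cpoly_const (lookup p \<nu>) * single \<nu> 1)"
      by (subst cpoly_eq_sum_single) (simp add: cpoly_const_def mult_single)
    also have "\<dots> \<in> vs.span B"
      using that by (intro vs.span_sum vs.span_scale vs.span_base) (auto simp: B_def in_box_def)
    finally show ?thesis .
  qed
  have "card B \<le> (N + 1) ^ ?n"
    unfolding B_def card_box[symmetric] by (rule card_image_le[OF finite_bounded_multi_index])
  also have "\<dots> \<le> (K * (d + 1)) ^ ?n"
    by (rule power_mono) (auto simp: N_def K_def algebra_simps)
  also have "\<dots> = d * (d + 1) ^ ?n" by (simp only: power_mult_distrib d_def)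
  also have "\<dots> < (d + 1) * (d + 1) ^ ?n" by simp
  also have "\<dots> = card I" by (simp only: I_def card_cartesian_product card_box card_atMost) simp
  finally have less: "card B < card I" .
  have "\<exists>u. (\<exists>a\<in>I. u a \<noteq> 0) \<and> (\<Sum>a\<in>I. cpoly_const (u a) * v a) = 0"
  \<comment> \<open>Linear dependence speaks of sets of vectors. If two index pairs give the same
    product, their difference is already a relation.\<close>
  proof (cases "inj_on v I")
    case True
    have "vs.dependent (v ` I)"
    proof (rule ccontr)
      assume "\<not> vs.dependent (v ` I)"
      then have "card (v ` I) \<le> card B"
        using vs.independent_span_bound[OF finB] span v_box by blast
      then show False using less by (simp add: card_image[OF True])
    qed
    then obtain u where "\<exists>b\<in>v ` I. u b \<noteq> 0" "(\<Sum>b\<in>v ` I. cpoly_const (u b) * b) = 0"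
      using vs.dependent_finite[of "v ` I"] finI by blast
    then show ?thesis
      by (intro exI[of _ "u \<circ> v"]) (auto simp: sum.reindex[OF True])
  next
    case False
    then obtain a b where ab: "a \<in> I" "b \<in> I" "a \<noteq> b" "v a = v b" by (auto simp: inj_on_def)
    define u where "u x = (if x = a then 1 else if x = b then - 1 else 0 :: complex)" for x
    have "(\<Sum>x\<in>I. cpoly_const (u x) * v x) = (\<Sum>x\<in>{a, b}. cpoly_const (u x) * v x)"
      using ab finI by (intro sum.mono_neutral_right) (auto simp: u_def cpoly_const_def)
    also have "\<dots> = 0" using ab by (simp add: u_def cpoly_const_def single_uminus)
    finally show ?thesis using ab by (intro exI[of _ u]) (auto simp: u_def)
  qed
  then obtain u k0 \<mu>0 where u: "k0 \<le> d" "\<mu>0 \<in> ?box d" "u (k0, \<mu>0) \<noteq> 0" "(\<Sum>a\<in>I. cpoly_const (u a) * v a) = 0"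
    by (auto simp: I_def)
  \<comment> \<open>The relation is sorted by powers of \<open>f\<close>; the coefficient of f^k is
    a polynomial in the components of \<open>P\<close>.\<close>
  define c where "c k = (\<Sum>\<mu>\<in>?box d. single \<mu> (u (k, \<mu>)))" for k
  have "lookup (c k0) \<mu>0 = (\<Sum>\<mu>\<in>?box d. if \<mu> = \<mu>0 then u (k0, \<mu>0) else 0)"
    unfolding c_def lookup_sum by (rule sum.cong) (auto simp: lookup_single when_def)
  also have "\<dots> = u (k0, \<mu>0)" using u(2) by (simp add: finite_bounded_multi_index)
  finally have "c k0 \<noteq> 0" using u(3) by auto
  moreover have "(\<Sum>k\<le>d. cpoly_eval f x ^ k * cpoly_eval (c k) (pmap P x)) = 0" for x
  proof -
    have "(\<Sum>k\<le>d. cpoly_eval f x ^ k * cpoly_eval (c k) (pmap P x))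
        = (\<Sum>k\<le>d. \<Sum>\<mu>\<in>?box d. u (k, \<mu>) * (cpoly_eval f x ^ k * mon \<mu> (pmap P x)))"
      by (simp add: c_def cpoly_eval_sum cpoly_eval_single sum_distrib_left mult_ac)
    also have "\<dots> = cpoly_eval (\<Sum>a\<in>I. cpoly_const (u a) * v a) x"
      by (simp add: I_def sum.cartesian_product cpoly_eval_sum cpoly_eval_mult v_def
          cpoly_eval_power cpoly_eval_multi_power case_prod_beta)
    finally show ?thesis by (simp add: u(4))
  qed
  ultimately show thesis using that u(1) by blast
qed

lemma cpoly_nonzeroE:
  assumes "p \<noteq> 0"
  obtains z where "cpoly_eval p z \<noteq> 0"
  using cpoly_eq_zeroI[of p] assms by blast

text \<open>Over the complement of the hypersurface \<open>D = 0\<close> the map \<open>P\<close> is a finite covering.\<close>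

locale fiber_cover =
  fixes P :: "'n::finite \<Rightarrow> 'n cpoly" and D :: "complex ^ 'n \<Rightarrow> complex"
  assumes polyfun_D: "polyfun D"
    and dominant: "\<exists>a. D (pmap P a) \<noteq> 0"
    and jac_nz: "D (pmap P z) \<noteq> 0 \<Longrightarrow> jac P z \<noteq> 0"
    and bdd: "D w \<noteq> 0 \<Longrightarrow> \<exists>B. \<forall>\<^sub>F v in nhds w. \<forall>z. pmap P z = v \<longrightarrow> norm z \<le> B"

text \<open>In an algebraic relation \<Sum> jac^k c_k(P) = 0 cancel the lowest power jac^k0 that
  occurs. Where jac vanishes, the remaining relation reads c_k0(P) = 0, so c_k0 vanishes on all
  critical values.\<close>

lemma jac_discriminant:
  assumes "jac P a \<noteq> 0"
  obtains D z where "polyfun D" "D z \<noteq> 0" "\<And>z. D (pmap P z) \<noteq> 0 \<Longrightarrow> jac P z \<noteq> 0"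
proof -
  obtain j where j: "jac P = cpoly_eval j" using polyfun_jac by (auto simp: polyfun_def)
  obtain d c where c: "\<exists>k\<le>d. c k \<noteq> 0"
    "\<And>x. (\<Sum>k\<le>d. cpoly_eval j x ^ k * cpoly_eval (c k) (pmap P x)) = 0"
    using algebraic_relation by blast
  define k0 where "k0 = (LEAST k. k \<le> d \<and> c k \<noteq> 0)"
  have k0: "k0 \<le> d" "c k0 \<noteq> 0"
    using LeastI_ex[of "\<lambda>k. k \<le> d \<and> c k \<noteq> 0"] c(1) unfolding k0_def by auto
  have less: "c k = 0" if "k < k0" for k
    using not_less_Least[of k "\<lambda>k. k \<le> d \<and> c k \<noteq> 0"] that k0(1) unfolding k0_def[symmetric] by auto
  define S where "S x = (\<Sum>k\<in>{k0..d}. jac P x ^ (k - k0) * cpoly_eval (c k) (pmap P x))" for x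
  have "jac P x ^ k0 * S x = 0" for x
  proof -
    have "0 = (\<Sum>k\<in>{k0..d}. jac P x ^ k * cpoly_eval (c k) (pmap P x))"
      unfolding c(2)[of x, symmetric] j by (rule sum.mono_neutral_right) (use less in \<open>auto simp: not_le\<close>)
    also have "\<dots> = jac P x ^ k0 * S x"
      unfolding S_def sum_distrib_left by (rule sum.cong) (simp_all add: mult.assoc[symmetric] power_add[symmetric])
    finally show ?thesis by simp
  qed
  \<comment> \<open>The cancellation is legitimate only where \<open>jac P\<close> is nonzero; since
    \<open>S\<close> is a polynomial function, it then vanishes everywhere.\<close>
  then have "generic (\<lambda>x. S x = 0)"
    by (intro genericI[OF polyfun_jac assms]) (metis mult_eq_0_iff power_eq_0_iff)
  moreover have "polyfun S"
    unfolding S_def[abs_def] by (intro polyfun_sum polyfun_mult polyfun_power polyfun_jac polyfun_pmap) simp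
  ultimately have "S = (\<lambda>_. 0)" by (intro generic_eq_imp_eq) auto
  then have S0: "S z = 0" for z by simp
  have "cpoly_eval (c k0) (pmap P z) = 0" if "jac P z = 0" for z
  proof -
    have "S z = (\<Sum>k\<in>{k0}. jac P z ^ (k - k0) * cpoly_eval (c k) (pmap P z))"
      unfolding S_def using k0(1) that by (intro sum.mono_neutral_right) auto
    then show ?thesis using S0 by simp
  qed
  moreover obtain z where "cpoly_eval (c k0) z \<noteq> 0" using cpoly_nonzeroE[OF k0(2)] .
  ultimately show thesis using that[of "cpoly_eval (c k0)"] by auto
qed

text \<open>The coordinate z_i is a root of a univariate polynomial whose coefficients are
  polynomials in P(z). Away from the zeros of the leading coefficient, Cauchy's root bound is
  continuous in the coefficients, hence locally uniform.\<close>

lemma coordinate_locally_bounded: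
  fixes P :: "'n::finite \<Rightarrow> 'n cpoly"
  shows "\<exists>F. polyfun F \<and> (\<exists>z. F z \<noteq> 0) \<and>
    (\<forall>w. F w \<noteq> 0 \<longrightarrow> (\<exists>B. \<forall>\<^sub>F v in nhds w. \<forall>z. pmap P z = v \<longrightarrow> norm (z $ i) \<le> B))"
proof -
  obtain d c where c: "\<exists>k\<le>d. c k \<noteq> 0"
    "\<And>x. (\<Sum>k\<le>d. cpoly_eval (cpoly_var i) x ^ k * cpoly_eval (c k) (pmap P x)) = 0"
    using algebraic_relation by blast
  define N where "N = (GREATEST k. k \<le> d \<and> c k \<noteq> 0)"
  have N: "N \<le> d \<and> c N \<noteq> 0"
    unfolding N_def using c(1) by (intro GreatestI_ex_nat[of "\<lambda>k. k \<le> d \<and> c k \<noteq> 0" d]) auto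
  have greater: "c k = 0" if "N < k" "k \<le> d" for k
    using Greatest_le_nat[of "\<lambda>k. k \<le> d \<and> c k \<noteq> 0" k d] that unfolding N_def[symmetric] by force
  define b where "b v = (\<Sum>k<N. norm (cpoly_eval (c k) v))" for v
  have rel: "(\<Sum>k<N. z $ i ^ k * cpoly_eval (c k) (pmap P z)) + z $ i ^ N * cpoly_eval (c N) (pmap P z) = 0" for z
  proof -
    have "0 = (\<Sum>k\<le>N. z $ i ^ k * cpoly_eval (c k) (pmap P z))"
      unfolding c(2)[of z, symmetric] cpoly_eval_var
      by (rule sum.mono_neutral_right) (use greater N in \<open>auto simp: not_le\<close>)
    then show ?thesis by (simp flip: lessThan_Suc_atMost)
  qed
  have bound: "norm (z $ i) \<le> max 1 (b v / norm (cpoly_eval (c N) v))"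
    if v: "pmap P z = v" and nz: "cpoly_eval (c N) v \<noteq> 0" for z v
  proof (cases "norm (z $ i) \<le> 1")
    case False
    let ?t = "norm (z $ i)"
    have t: "1 \<le> ?t" using False by simp
    have "z $ i ^ N * cpoly_eval (c N) v = - (\<Sum>k<N. z $ i ^ k * cpoly_eval (c k) v)"
      using rel[of z] unfolding v by (simp add: eq_neg_iff_add_eq_0 add.commute)
    then have "?t ^ N * norm (cpoly_eval (c N) v) = norm (\<Sum>k<N. z $ i ^ k * cpoly_eval (c k) v)"
      by (metis norm_minus_cancel norm_mult norm_power)
    also have "\<dots> \<le> (\<Sum>k<N. ?t ^ (N - 1) * norm (cpoly_eval (c k) v))"
      by (intro sum_norm_le) (auto simp: norm_mult norm_power intro!: mult_right_mono power_increasing t)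
    also have "\<dots> = ?t ^ (N - 1) * b v" by (simp add: b_def sum_distrib_left)
    finally have le: "?t ^ N * norm (cpoly_eval (c N) v) \<le> ?t ^ (N - 1) * b v" .
    have "?t * norm (cpoly_eval (c N) v) \<le> b v"
    proof (cases N)
      \<comment> \<open>For \<open>N = 0\<close> the relation would say c_0(v) = 0, contradicting
        \<open>nz\<close>: such a \<open>v\<close> has no preimage at all.\<close>
      case 0
      then show ?thesis using le nz by (simp add: b_def)
    next
      case (Suc m)
      then have "?t ^ m * (?t * norm (cpoly_eval (c N) v)) \<le> ?t ^ m * b v" using le by (simp add: mult_ac)
      moreover have "0 < ?t ^ m" using t by (intro zero_less_power) linarith
      ultimately show ?thesis by (simp only: mult_le_cancel_left_pos)
    qed
    then have "?t \<le> b v / norm (cpoly_eval (c N) v)" using nz by (simp add: field_simps)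
    then show ?thesis by simp
  qed simp
  have "\<exists>B. \<forall>\<^sub>F v in nhds w. \<forall>z. pmap P z = v \<longrightarrow> norm (z $ i) \<le> B" if w: "cpoly_eval (c N) w \<noteq> 0" for w
  proof -
    let ?\<phi> = "\<lambda>v. b v / norm (cpoly_eval (c N) v)"
    have iso: "isCont (cpoly_eval p) w" for p :: "'n cpoly"
      using polyfun_continuous_on[OF polyfun_cpoly_eval, of UNIV p] by (simp add: continuous_on_eq_continuous_at)
    have "isCont ?\<phi> w" unfolding b_def using w by (intro continuous_intros iso) simp
    then have "(?\<phi> \<longlongrightarrow> ?\<phi> w) (nhds w)"
      by (simp add: tendsto_nhds_iff continuous_at)
    then have "\<forall>\<^sub>F v in nhds w. ?\<phi> v < ?\<phi> w + 1" by (rule order_tendstoD) simp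
    moreover have "(cpoly_eval (c N) \<longlongrightarrow> cpoly_eval (c N) w) (nhds w)"
      using iso[of "c N"] by (simp add: tendsto_nhds_iff continuous_at)
    then have "\<forall>\<^sub>F v in nhds w. cpoly_eval (c N) v \<noteq> 0"
      using w by (rule tendsto_imp_eventually_ne)
    ultimately have "\<forall>\<^sub>F v in nhds w. \<forall>z. pmap P z = v \<longrightarrow> norm (z $ i) \<le> max 1 (?\<phi> w + 1)"
    proof eventually_elim
      case (elim v)
      show ?case
      proof (intro allI impI)
        fix z assume "pmap P z = v"
        from bound[OF this elim(2)] elim(1) show "norm (z $ i) \<le> max 1 (?\<phi> w + 1)" by linarith
      qed
    qed
    then show ?thesis by blast
  qed
  moreover obtain z where "cpoly_eval (c N) z \<noteq> 0" using cpoly_nonzeroE[of "c N"] N by blast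
  ultimately show ?thesis by (intro exI[of _ "cpoly_eval (c N)"]) auto
qed

text \<open>Two kinds of hypersurfaces are collected in \<open>D\<close>: one containing the
  critical values, and for each coordinate one near which preimages may escape to infinity.\<close>

lemma ex_fiber_cover:
  fixes P :: "'n::finite \<Rightarrow> 'n cpoly"
  assumes "jac P a \<noteq> 0"
  obtains D where "fiber_cover P D"
proof -
  obtain E e where E: "polyfun E" "E e \<noteq> 0" "\<And>z. E (pmap P z) \<noteq> 0 \<Longrightarrow> jac P z \<noteq> 0"
    using jac_discriminant[OF assms] by blast
  have "\<forall>i. \<exists>F. polyfun F \<and> (\<exists>z. F z \<noteq> 0) \<and>
    (\<forall>w. F w \<noteq> 0 \<longrightarrow> (\<exists>B. \<forall>\<^sub>F v in nhds w. \<forall>z. pmap P z = v \<longrightarrow> norm (z $ i) \<le> B))"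
    by (intro allI coordinate_locally_bounded)
  from choice[OF this] obtain F where F: "\<And>i. polyfun (F i)" "\<And>i. \<exists>z. F i z \<noteq> 0"
    "\<And>i w. F i w \<noteq> 0 \<Longrightarrow> \<exists>B. \<forall>\<^sub>F v in nhds w. \<forall>z. pmap P z = v \<longrightarrow> norm (z $ i) \<le> B"
    by auto
  define D where "D w = E w * (\<Prod>i\<in>UNIV. F i w)" for w
  have "generic (\<lambda>z. \<forall>i\<in>UNIV. F i z \<noteq> 0)"
    by (rule generic_Ball) (auto simp: generic_def F intro!: exI[of _ "F _"])
  moreover have "generic (\<lambda>z. E z \<noteq> 0)" using E by (intro genericI[of E]) auto
  ultimately have gen: "generic (\<lambda>z. E z \<noteq> 0 \<and> (\<forall>i\<in>UNIV. F i z \<noteq> 0))" by (rule generic_conj[rotated])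
  show thesis
  proof (rule that, unfold_locales)
    show "polyfun D" unfolding D_def[abs_def] by (intro polyfun_mult polyfun_prod E F)
    show "\<exists>a. D (pmap P a) \<noteq> 0"
      using generic_ex[OF generic_pmap[OF assms gen]] by (auto simp: D_def)
    show "jac P z \<noteq> 0" if "D (pmap P z) \<noteq> 0" for z using that E(3) by (auto simp: D_def)
    show "\<exists>B. \<forall>\<^sub>F v in nhds w. \<forall>z. pmap P z = v \<longrightarrow> norm z \<le> B" if "D w \<noteq> 0" for w
    proof -
      have "F i w \<noteq> 0" for i using that by (simp add: D_def)
      then have "\<forall>i. \<exists>B. \<forall>\<^sub>F v in nhds w. \<forall>z. pmap P z = v \<longrightarrow> norm (z $ i) \<le> B"
        using F(3) by blast
      from choice[OF this] obtain B
        where "\<forall>i. \<forall>\<^sub>F v in nhds w. \<forall>z. pmap P z = v \<longrightarrow> norm (z $ i) \<le> B i" by blast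
      then have "\<forall>\<^sub>F v in nhds w. \<forall>i. \<forall>z. pmap P z = v \<longrightarrow> norm (z $ i) \<le> B i"
        by (intro eventually_all_finite) blast
      then have "\<forall>\<^sub>F v in nhds w. \<forall>z. pmap P z = v \<longrightarrow> norm z \<le> (\<Sum>i\<in>UNIV. B i)"
      proof eventually_elim
        case (elim v)
        show ?case
        proof (intro allI impI)
          fix z assume "pmap P z = v"
          then have "(\<Sum>i\<in>UNIV. norm (z $ i)) \<le> (\<Sum>i\<in>UNIV. B i)" using elim by (intro sum_mono) auto
          moreover have "norm z \<le> (\<Sum>i\<in>UNIV. norm (z $ i))"
            unfolding norm_vec_def by (rule L2_set_le_sum) simp
          ultimately show "norm z \<le> (\<Sum>i\<in>UNIV. B i)" by linarith
        qed
      qed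
      then show ?thesis by blast
    qed
  qed
qed

section \<open>Connectedness off a hypersurface and the topology of the covering\<close>

lemma connected_line_nonzero:
  assumes "polyfun D"
  shows "connected {t. D (a + t *s b) \<noteq> 0}"
proof (cases "\<exists>t. D (a + t *s b) \<noteq> 0")
  case True
  then have "finite {t. D (a + t *s b) = 0}" using polyfun_line_finite_zeros[OF assms] by blast
  then have "connected (UNIV - {t. D (a + t *s b) = 0})"
    by (intro connected_open_diff_countable countable_finite) auto
  moreover have "UNIV - {t. D (a + t *s b) = 0} = {t. D (a + t *s b) \<noteq> 0}" by auto
  ultimately show ?thesis by simp
qed simp

lemma continuous_on_line: "continuous_on S (\<lambda>t. a + t *s (b :: complex ^ 'n::finite))"
  unfolding vector_scalar_mult_def by (intro continuous_intros)

text \<open>Two points are joined inside their complex line, from which only finitely many points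
  are removed; a complex hypersurface has real codimension two and does not separate.\<close>

lemma connected_nonzero:
  assumes "polyfun D"
  shows "connected {w. D w \<noteq> 0}"
  unfolding connected_iff_connected_component
proof (intro ballI)
  fix a b assume ab: "a \<in> {w. D w \<noteq> 0}" "b \<in> {w. D w \<noteq> 0}"
  let ?T = "(\<lambda>t. a + t *s (b - a)) ` {t. D (a + t *s (b - a)) \<noteq> 0}"
  have "connected ?T"
    by (intro connected_continuous_image continuous_on_line connected_line_nonzero assms)
  moreover have "a \<in> ?T" using ab by (intro image_eqI[of _ _ 0]) auto
  moreover have "b \<in> ?T" using ab by (intro image_eqI[of _ _ 1]) auto
  moreover have "?T \<subseteq> {w. D w \<noteq> 0}" by auto
  ultimately show "connected_component {w. D w \<noteq> 0} a b"
    unfolding connected_component_def by blast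
qed

lemma open_nonzero: "polyfun D \<Longrightarrow> open {w. D w \<noteq> 0}"
proof -
  assume "polyfun D"
  then have "open (D -` (- {0}))" by (intro open_vimage polyfun_continuous_on) auto
  moreover have "D -` (- {0}) = {w. D w \<noteq> 0}" by auto
  ultimately show ?thesis by simp
qed

definition fib :: "('n::finite \<Rightarrow> 'n cpoly) \<Rightarrow> complex ^ 'n \<Rightarrow> (complex ^ 'n) set" where
  "fib P w = {z. pmap P z = w}"

lemma matrix_inv_mult:
  fixes A :: "'a::field ^ 'n ^ 'n"
  assumes "det A \<noteq> 0"
  shows "A ** matrix_inv A = mat 1" "matrix_inv A ** A = mat 1"
proof -
  have "\<exists>B. A ** B = mat 1 \<and> B ** A = mat 1"
    using assms by (simp add: invertible_det_nz[symmetric] invertible_def)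
  from someI_ex[OF this] show "A ** matrix_inv A = mat 1" "matrix_inv A ** A = mat 1"
    unfolding matrix_inv_def by blast+
qed

lemma section_has_derivative:
  assumes "open T" "continuous_on T g" "\<And>v. v \<in> T \<Longrightarrow> pmap P (g v) = v" "v \<in> T" "jac P (g v) \<noteq> 0"
  shows "(g has_derivative (\<lambda>h. matrix_inv (bez P (g v) (g v)) *v h)) (at v)"
proof (rule has_derivative_inverse_basic[OF pmap_has_derivative])
  show "(\<lambda>h. matrix_inv (bez P (g v) (g v)) *v h) \<circ> (\<lambda>h. bez P (g v) (g v) *v h) = id"
    using assms(5) by (simp add: fun_eq_iff matrix_vector_mul_assoc matrix_inv_mult jac_def)
  show "bounded_linear (\<lambda>h. matrix_inv (bez P (g v) (g v)) *v h)"
    by (rule linear_conv_bounded_linear[THEN iffD1])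
       (auto intro!: linearI simp: matrix_vector_right_distrib vec_eq_iff matrix_vector_mult_def
         scaleR_sum_right distrib_left sum.distrib)
qed (use assms continuous_on_eq_continuous_at in auto)

context fiber_cover
begin

text \<open>The fibre is compact by \<open>bdd\<close> and discrete because \<open>P\<close> is
  injective near each of its points.\<close>

lemma finite_fib:
  assumes "D w \<noteq> 0"
  shows "finite (fib P w)"
proof -
  have cl: "closed (fib P w)"
  proof -
    have "fib P w = pmap P -` {w}" by (auto simp: fib_def)
    then show ?thesis by (simp add: closed_vimage continuous_on_pmap)
  qed
  obtain B where "\<forall>\<^sub>F v in nhds w. \<forall>z. pmap P z = v \<longrightarrow> norm z \<le> B" using bdd[OF assms] by blast
  from eventually_nhds_x_imp_x[OF this] have "bounded (fib P w)"
    by (auto simp: bounded_iff fib_def)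
  with cl have "compact (fib P w)" by (simp add: compact_eq_bounded_closed)
  moreover have "\<not> z islimpt fib P w" if "z \<in> fib P w" for z
  proof
    assume "z islimpt fib P w"
    have "jac P z \<noteq> 0" using that assms jac_nz by (auto simp: fib_def)
    then obtain U g where U: "open U" "z \<in> U" "homeomorphism U (pmap P ` U) (pmap P) g"
      using pmap_local_homeomorphism[OF _ open_UNIV UNIV_I] by metis
    then obtain y where "y \<in> fib P w" "y \<in> U" "y \<noteq> z"
      using \<open>z islimpt fib P w\<close> unfolding islimpt_def by blast
    moreover have "g (pmap P y) = y" "g (pmap P z) = z"
      using homeomorphism_apply1[OF U(3)] U(2) \<open>y \<in> U\<close> by simp_all
    moreover have "pmap P y = pmap P z" using that \<open>y \<in> fib P w\<close> by (simp add: fib_def)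
    ultimately show False by simp
  qed
  ultimately show ?thesis using finite_not_islimpt_in_compact[of "fib P w" "fib P w"] by auto
qed

text \<open>Disjoint neighbourhoods of the fibre points provide one section each. The local bound on
  preimages excludes further points of nearby fibres, in particular points coming in from
  infinity.\<close>

lemma local_sections:
  assumes "D w \<noteq> 0"
  obtains e g where "e > 0"
    "\<forall>v\<in>ball w e. D v \<noteq> 0 \<and> bij_betw (\<lambda>a. g a v) (fib P w) (fib P v)"
    "\<forall>a\<in>fib P w. continuous_on (ball w e) (g a) \<and> g a w = a"
proof -
  let ?F = "fib P w"
  have fin: "finite ?F" by (rule finite_fib[OF assms])
  then have "\<forall>a. \<exists>d>0. \<forall>x\<in>?F. x \<noteq> a \<longrightarrow> d \<le> dist a x" using finite_set_avoid by blast
  then obtain d where d: "\<And>a. d a > 0" "\<And>a x. x \<in> ?F \<Longrightarrow> x \<noteq> a \<Longrightarrow> d a \<le> dist a x" by metis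
  have "\<exists>U g. open U \<and> a \<in> U \<and> U \<subseteq> ball a (d a / 2) \<and> open (pmap P ` U) \<and>
      homeomorphism U (pmap P ` U) (pmap P) g" if "a \<in> ?F" for a
  proof -
    have "jac P a \<noteq> 0" using that assms jac_nz by (auto simp: fib_def)
    from pmap_local_homeomorphism[OF this open_ball[of a "d a / 2"]] d(1)[of a] show ?thesis
      by (metis centre_in_ball half_gt_zero)
  qed
  then obtain U g where U: "\<And>a. a \<in> ?F \<Longrightarrow> open (U a)" "\<And>a. a \<in> ?F \<Longrightarrow> a \<in> U a"
    "\<And>a. a \<in> ?F \<Longrightarrow> U a \<subseteq> ball a (d a / 2)" "\<And>a. a \<in> ?F \<Longrightarrow> open (pmap P ` U a)"
    "\<And>a. a \<in> ?F \<Longrightarrow> homeomorphism (U a) (pmap P ` U a) (pmap P) (g a)"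
    by metis
  have disj: "a = b" if "a \<in> ?F" "b \<in> ?F" "x \<in> U a" "x \<in> U b" for a b x
  proof (rule ccontr)
    assume "a \<noteq> b"
    then have "d a \<le> dist a b" "d b \<le> dist a b" using d(2) that by (metis, metis dist_commute)
    moreover have "dist a x < d a / 2" "dist b x < d b / 2" using U(3) that by (auto simp: subset_iff)
    moreover have "dist a b \<le> dist a x + dist b x" by (rule dist_triangle2)
    ultimately show False by linarith
  qed
  obtain B where B: "\<forall>\<^sub>F v in nhds w. \<forall>z. pmap P z = v \<longrightarrow> norm z \<le> B" using bdd[OF assms] by blast
  \<comment> \<open>A further preimage of a nearby \<open>v\<close> would lie in the compact set
    \<open>K\<close>. Its image is closed and misses \<open>w\<close>, hence misses a neighbourhood
    of \<open>w\<close>.\<close>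
  define K where "K = cball 0 B - (\<Union>a\<in>?F. U a)"
  have "compact K" unfolding K_def using U(1) by (intro compact_diff) auto
  then have "closed (pmap P ` K)"
    by (intro compact_imp_closed compact_continuous_image continuous_on_pmap)
  then have "open (- pmap P ` K)" by blast
  moreover have "w \<notin> pmap P ` K" using U(2) by (auto simp: K_def fib_def)
  ultimately have "\<forall>\<^sub>F v in nhds w. v \<in> - pmap P ` K" by (intro eventually_nhds_in_open) auto
  moreover have "\<forall>\<^sub>F v in nhds w. \<forall>a\<in>?F. v \<in> pmap P ` U a"
  proof (intro eventually_ball_finite fin ballI eventually_nhds_in_open U(4))
    show "w \<in> pmap P ` U a" if "a \<in> ?F" for a using U(2) that by (auto simp: fib_def)
  qed
  moreover have "\<forall>\<^sub>F v in nhds w. v \<in> {v. D v \<noteq> 0}"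
    by (intro eventually_nhds_in_open open_nonzero polyfun_D) (simp add: assms)
  ultimately have "\<forall>\<^sub>F v in nhds w. v \<notin> pmap P ` K \<and> (\<forall>a\<in>?F. v \<in> pmap P ` U a) \<and> D v \<noteq> 0 \<and>
      (\<forall>z. pmap P z = v \<longrightarrow> norm z \<le> B)"
    using B by eventually_elim auto
  then obtain e where e: "e > 0" "\<And>v. v \<in> ball w e \<Longrightarrow> v \<notin> pmap P ` K \<and> (\<forall>a\<in>?F. v \<in> pmap P ` U a) \<and>
      D v \<noteq> 0 \<and> (\<forall>z. pmap P z = v \<longrightarrow> norm z \<le> B)"
    unfolding eventually_nhds_metric by (auto simp: dist_commute)
  have g_in: "g a v \<in> U a" "pmap P (g a v) = v" if "a \<in> ?F" "v \<in> ball w e" for a v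
    using U(5)[OF that(1)] e(2)[OF that(2)] that(1) unfolding homeomorphism_def by blast+
  show thesis
  proof (rule that[OF e(1)]; intro ballI conjI)
    show "D v \<noteq> 0" if "v \<in> ball w e" for v using e(2)[OF that] by blast
    show "continuous_on (ball w e) (g a)" if "a \<in> ?F" for a
    proof (rule continuous_on_subset)
      show "continuous_on (pmap P ` U a) (g a)" using homeomorphism_cont2[OF U(5)[OF that]] .
      show "ball w e \<subseteq> pmap P ` U a" using e(2) that by blast
    qed
    show "g a w = a" if "a \<in> ?F" for a
      using homeomorphism_apply1[OF U(5) U(2)] that by (simp add: fib_def)
    show "bij_betw (\<lambda>a. g a v) ?F (fib P v)" if v: "v \<in> ball w e" for v
      unfolding bij_betw_def
    proof
      show "inj_on (\<lambda>a. g a v) ?F" 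
      proof (rule inj_onI)
        fix a b assume ab: "a \<in> ?F" "b \<in> ?F" "g a v = g b v"
        show "a = b"
          by (rule disj[OF ab(1,2) g_in(1)[OF ab(1) v]]) (use g_in(1)[OF ab(2) v] ab(3) in simp)
      qed
      have "z \<in> (\<lambda>a. g a v) ` ?F" if "pmap P z = v" for z
      proof -
        have "z \<notin> K" "norm z \<le> B" using e(2)[OF v] that by auto
        then obtain a where a: "a \<in> ?F" "z \<in> U a" by (auto simp: K_def)
        then have "g a v = z" using homeomorphism_apply1[OF U(5)] that by auto
        then show ?thesis using a by blast
      qed
      then show "(\<lambda>a. g a v) ` ?F = fib P v" using g_in(2)[OF _ v] by (auto simp: fib_def)
    qed
  qed
qed

lemma card_fib_eq:
  assumes "D v \<noteq> 0" "D w \<noteq> 0"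
  shows "card (fib P v) = card (fib P w)"
proof -
  have "(\<lambda>w. card (fib P w)) constant_on {w. D w \<noteq> 0}"
  proof (rule locally_constant_imp_constant[OF connected_nonzero[OF polyfun_D]])
    fix a assume "a \<in> {w. D w \<noteq> 0}"
    then have "D a \<noteq> 0" by simp
    then obtain e g where e: "e > 0"
      "\<forall>v\<in>ball a e. D v \<noteq> 0 \<and> bij_betw (\<lambda>b. g b v) (fib P a) (fib P v)"
      using local_sections[of a] by metis
    have card: "card (fib P x) = card (fib P a)" if "x \<in> ball a e" for x
      using bij_betw_same_card[OF conjunct2[OF bspec[OF e(2) that]]] by simp
    have "ball a e \<subseteq> {w. D w \<noteq> 0}" using e(2) by blast
    note sub = this
    show "\<exists>T. openin (top_of_set {w. D w \<noteq> 0}) T \<and> a \<in> T \<and> (\<forall>x\<in>T. card (fib P x) = card (fib P a))"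
    proof (intro exI conjI ballI)
      show "openin (top_of_set {w. D w \<noteq> 0}) (ball a e)" by (rule open_subset[OF sub open_ball])
      show "a \<in> ball a e" using e(1) by simp
    qed (rule card)
  qed
  then show ?thesis using assms unfolding constant_on_def by (metis mem_Collect_eq)
qed

text \<open>Surjectivity off \<open>D = 0\<close> comes for free: the cardinality of fibres is
  constant there, and \<open>dominant\<close> provides one nonempty fibre.\<close>

lemma fib_nonempty:
  assumes "D w \<noteq> 0"
  shows "fib P w \<noteq> {}"
proof -
  obtain a where a: "D (pmap P a) \<noteq> 0" using dominant by blast
  have "a \<in> fib P (pmap P a)" by (simp add: fib_def)
  then have "card (fib P (pmap P a)) > 0" using finite_fib[OF a] by (auto simp: card_gt_0_iff)
  then show ?thesis using card_fib_eq[OF a assms] by auto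
qed

lemma covering: "covering_space (pmap P -` {w. D w \<noteq> 0}) (pmap P) {w. D w \<noteq> 0}"
  (is "covering_space ?C _ ?S")
proof
  show "continuous_on ?C (pmap P)" by (rule continuous_on_pmap)
  show "pmap P ` ?C = ?S" using fib_nonempty by (fastforce simp: fib_def)
  fix w assume "w \<in> ?S"
  then have "D w \<noteq> 0" by simp
  then obtain e g where e': "e > 0"
    "\<forall>v\<in>ball w e. D v \<noteq> 0 \<and> bij_betw (\<lambda>a. g a v) (fib P w) (fib P v)"
    "\<forall>a\<in>fib P w. continuous_on (ball w e) (g a) \<and> g a w = a"
    by (rule local_sections)
  then have e: "e > 0" "\<And>v. v \<in> ball w e \<Longrightarrow> D v \<noteq> 0"
    "\<And>v. v \<in> ball w e \<Longrightarrow> bij_betw (\<lambda>a. g a v) (fib P w) (fib P v)"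
    "\<And>a. a \<in> fib P w \<Longrightarrow> continuous_on (ball w e) (g a)"
    by auto
  have Pg: "pmap P (g a v) = v" if "a \<in> fib P w" "v \<in> ball w e" for a v
    using bij_betwE[OF e(3)[OF that(2)]] that(1) by (auto simp: fib_def)
  have inj: "a = b" if "a \<in> fib P w" "b \<in> fib P w" "v \<in> ball w e" "g a v = g b v" for a b v
    using bij_betw_imp_inj_on[OF e(3)[OF that(3)]] that by (auto dest: inj_onD)
  let ?V = "(\<lambda>a. g a ` ball w e) ` fib P w"
  show "\<exists>T. w \<in> T \<and> openin (top_of_set ?S) T \<and>
      (\<exists>v. \<Union> v = ?C \<inter> pmap P -` T \<and> (\<forall>u\<in>v. openin (top_of_set ?C) u) \<and>
        pairwise disjnt v \<and> (\<forall>u\<in>v. \<exists>q. homeomorphism u T (pmap P) q))"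
  proof (intro exI[of _ "ball w e"] exI[of _ ?V] conjI ballI)
    show "w \<in> ball w e" using e by simp
    show "openin (top_of_set ?S) (ball w e)" using e by (auto intro: open_subset)
    show "\<Union> ?V = ?C \<inter> pmap P -` ball w e"
    proof (intro equalityI subsetI)
      fix z assume "z \<in> ?C \<inter> pmap P -` ball w e"
      then have z: "pmap P z \<in> ball w e" by simp
      have "z \<in> (\<lambda>a. g a (pmap P z)) ` fib P w"
        using bij_betw_imp_surj_on[OF e(3)[OF z]] by (simp add: fib_def)
      then show "z \<in> \<Union> ?V" using z by blast
    qed (use Pg e in auto)
    show "openin (top_of_set ?C) u" if "u \<in> ?V" for u
    proof -
      from that obtain a where a: "a \<in> fib P w" "u = g a ` ball w e" by blast
      have "inj_on (g a) (ball w e)" using Pg[OF a(1)] by (metis inj_onI)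
      then have "open u" unfolding a by (intro invariance_of_domain e a) auto
      moreover have "u \<subseteq> ?C" using a Pg e by auto
      ultimately show ?thesis by (intro open_subset)
    qed
    show "pairwise disjnt ?V"
    proof (rule pairwiseI)
      fix u u' assume "u \<in> ?V" "u' \<in> ?V" "u \<noteq> u'"
      then obtain a b where ab: "a \<in> fib P w" "b \<in> fib P w" "u = g a ` ball w e" "u' = g b ` ball w e" "a \<noteq> b"
        by blast
      show "disjnt u u'"
        unfolding disjnt_iff ab
      proof (intro allI notI, elim conjE imageE)
        fix x v v' assume "x = g a v" "v \<in> ball w e" "x = g b v'" "v' \<in> ball w e"
        then show False using Pg ab inj by metis
      qed
    qed
    show "\<exists>q. homeomorphism u (ball w e) (pmap P) q" if "u \<in> ?V" for u
    proof -
      from that obtain a where a: "a \<in> fib P w" "u = g a ` ball w e" by blast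
      then have "homeomorphism u (ball w e) (pmap P) (g a)"
        by (intro homeomorphismI continuous_on_pmap e) (auto simp: Pg)
      then show ?thesis by blast
    qed
  qed
qed

text \<open>Lifting the identity through the covering gives a branch of the inverse on any convex
  set off the branch locus, however large. \<open>inverse_jac_bound\<close> applies this to growing
  polydiscs, where local sections would not suffice.\<close>

lemma lift_convex:
  assumes "convex U" "open U" "\<And>v. v \<in> U \<Longrightarrow> D v \<noteq> 0" "w \<in> U" "pmap P a = w"
  obtains g where "continuous_on U g" "g w = a" "\<And>v. v \<in> U \<Longrightarrow> pmap P (g v) = v"
proof (rule covering_space_lift_strong[OF covering, of a w U "\<lambda>v. v"])
  show "simply_connected U" by (rule convex_imp_simply_connected[OF assms(1)])
  show "locally path_connected U" by (rule open_imp_locally_path_connected[OF assms(2)])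
qed (use assms that in auto)

end

section \<open>Differentiation along complex lines in the target\<close>

text \<open>The derivative of \<open>p\<close> at \<open>z\<close> along the image of \<open>b\<close> under the inverse of the differential of \<open>P\<close>.\<close>

definition pullback_deriv :: "('n::finite \<Rightarrow> 'n cpoly) \<Rightarrow> complex ^ 'n \<Rightarrow> 'n cpoly \<Rightarrow> complex ^ 'n \<Rightarrow> complex" where
  "pullback_deriv P b p z = (\<Sum>l\<in>UNIV. divided_difference p l z z * (matrix_inv (bez P z z) *v b) $ l)"

lemma section_line_derivative:
  assumes "open T" "continuous_on T g" "\<And>v. v \<in> T \<Longrightarrow> pmap P (g v) = v" "a + t *s b \<in> T"
    and "jac P (g (a + t *s b)) \<noteq> 0"
  shows "((\<lambda>t. cpoly_eval p (g (a + t *s b))) has_field_derivative pullback_deriv P b p (g (a + t *s b))) (at t)"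
proof -
  define z where "z = g (a + t *s b)"
  have line: "((\<lambda>t. a + t *s b) has_derivative (\<lambda>h. h *s b)) (at t)"
    by (rule has_derivative_vecI) (auto intro!: derivative_eq_intros)
  have "(g has_derivative (\<lambda>h. matrix_inv (bez P z z) *v h)) (at (a + t *s b))"
    unfolding z_def by (rule section_has_derivative[OF assms(1-5)])
  from has_derivative_compose[OF line this]
  have "((\<lambda>t. g (a + t *s b)) has_derivative (\<lambda>h. matrix_inv (bez P z z) *v (h *s b))) (at t)" .
  from has_derivative_compose[OF this, of "cpoly_eval p", folded z_def, OF cpoly_eval_has_derivative]
  have "((\<lambda>t. cpoly_eval p (g (a + t *s b))) has_derivative
     (\<lambda>h. \<Sum>l\<in>UNIV. divided_difference p l z z * (matrix_inv (bez P z z) *v (h *s b)) $ l)) (at t)" .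
  then show ?thesis
    unfolding has_field_derivative_def pullback_deriv_def z_def[symmetric]
    by (rule has_derivative_eq_rhs)
       (simp add: fun_eq_iff matrix_vector_mult_def sum_distrib_left mult_ac)
qed

text \<open>Expand \<open>r\<close> in the rows of \<open>A\<close>: the coefficient of row
  \<open>j\<close> is the sum in question, and by Cramer's rule it is the quotient of the two
  determinants. With gradients as rows: if replacing \<Phi>_j by a polynomial p kills the Jacobian
  at a point, then p has zero derivative there in the direction of the j-th coordinate
  \<Phi>_j.\<close>

lemma det_replace_row:
  fixes A :: "complex ^ 'n ^ 'n"
  assumes "det A \<noteq> 0" "det (\<chi> i. if i = j then r else A $ i) = 0"
  shows "(\<Sum>l\<in>UNIV. r $ l * (matrix_inv A *v axis j 1) $ l) = 0"
proof -
  define c where "c = r v* matrix_inv A"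
  have "c v* A = r"
    using matrix_inv_mult(2)[OF assms(1)] by (simp add: c_def vector_matrix_mul_assoc)
  then have r: "(\<Sum>i\<in>UNIV. c $ i *s row i A) = r"
    by (simp add: vec_eq_iff vector_matrix_mult_def row_def mult.commute)
  have "c $ j * det A = det (\<chi> i. if i = j then r else row i A)"
    unfolding r[symmetric] by (rule cramer_lemma_transpose[symmetric])
  also have "\<dots> = 0" 
  proof -
    have "row i A = A $ i" for i by (simp add: row_def)
    then show ?thesis using assms(2) by (simp cong: if_cong)
  qed
  finally have "c $ j = 0" using assms(1) by simp
  then have "(\<Sum>l\<in>UNIV. r $ l * matrix_inv A $ l $ j) = 0"
    by (simp add: c_def vector_matrix_mult_def mult.commute)
  moreover have "(matrix_inv A *v axis j 1) $ l = matrix_inv A $ l $ j" for l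
    by (simp add: matrix_vector_mult_def axis_def if_distrib[of "(*) _"] cong: if_cong)
  ultimately show ?thesis by simp
qed

text \<open>Divided differences are merely chosen, so their diagonal values are identified through
  uniqueness of the derivative.\<close>

lemma bez_var: "bez cpoly_var x x = mat 1"
proof -
  have "(pmap cpoly_var has_derivative (\<lambda>h. h)) (at x)"
  proof -
    have "pmap cpoly_var = (\<lambda>z :: complex ^ 'a. z)" by (simp add: fun_eq_iff)
    then show ?thesis by simp
  qed
  then have "(\<lambda>h. bez cpoly_var x x *v h) = (\<lambda>h. h)"
    using has_derivative_unique[OF pmap_has_derivative] by blast
  then show ?thesis by (metis matrix_vector_mul_lid matrix_eq)
qed

context fiber_cover
begin

text \<open>A local trivialisation of the covering over a complex line: \<psi> z follows the point z
  of the central fibre. Lines suffice since holomorphy is only ever needed in one complex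
  variable.\<close>

definition line_chart :: "complex ^ 'n \<Rightarrow> complex ^ 'n \<Rightarrow> complex \<Rightarrow> real \<Rightarrow>
    (complex ^ 'n \<Rightarrow> complex \<Rightarrow> complex ^ 'n) \<Rightarrow> bool" where
  "line_chart a b t0 r \<psi> \<longleftrightarrow> r > 0 \<and>
    (\<forall>t\<in>ball t0 r. D (a + t *s b) \<noteq> 0 \<and>
      bij_betw (\<lambda>z. \<psi> z t) (fib P (a + t0 *s b)) (fib P (a + t *s b))) \<and>
    (\<forall>z\<in>fib P (a + t0 *s b). \<psi> z t0 = z \<and> (\<forall>t\<in>ball t0 r. jac P (\<psi> z t) \<noteq> 0 \<and>
      (\<forall>p. ((\<lambda>t. cpoly_eval p (\<psi> z t)) has_field_derivative pullback_deriv P b p (\<psi> z t)) (at t))))"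

lemma ex_line_chart:
  assumes "D (a + t0 *s b) \<noteq> 0"
  obtains r \<psi> where "line_chart a b t0 r \<psi>"
proof -
  obtain e g where e: "e > 0"
    "\<forall>v\<in>ball (a + t0 *s b) e. D v \<noteq> 0 \<and> bij_betw (\<lambda>z. g z v) (fib P (a + t0 *s b)) (fib P v)"
    "\<forall>z\<in>fib P (a + t0 *s b). continuous_on (ball (a + t0 *s b) e) (g z) \<and> g z (a + t0 *s b) = z"
    using assms by (rule local_sections)
  let ?B = "ball (a + t0 *s b) e"
  have "open ((\<lambda>t. a + t *s b) -` ?B)" by (intro open_vimage continuous_on_line) simp
  moreover have "t0 \<in> (\<lambda>t. a + t *s b) -` ?B" using e(1) by simp
  ultimately obtain r where r: "r > 0" "ball t0 r \<subseteq> (\<lambda>t. a + t *s b) -` ?B"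
    by (meson open_contains_ball)
  have der: "jac P (g z (a + t *s b)) \<noteq> 0 \<and> (\<forall>p. ((\<lambda>t. cpoly_eval p (g z (a + t *s b)))
      has_field_derivative pullback_deriv P b p (g z (a + t *s b))) (at t))"
    if z: "z \<in> fib P (a + t0 *s b)" and "t \<in> ball t0 r" for z t
  proof -
    have t: "a + t *s b \<in> ?B" using r(2) that by auto
    have Pg: "pmap P (g z v) = v" if "v \<in> ?B" for v
      using bij_betwE[OF conjunct2[OF bspec[OF e(2) that]]] z by (auto simp: fib_def)
    have nz: "jac P (g z (a + t *s b)) \<noteq> 0"
      by (rule jac_nz) (use Pg[OF t] e(2) t in simp)
    have "continuous_on ?B (g z)" using e(3) z by blast
    from section_line_derivative[OF open_ball this Pg t nz] nz show ?thesis by blast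
  qed
  have "line_chart a b t0 r (\<lambda>z t. g z (a + t *s b))"
    unfolding line_chart_def
  proof (intro conjI)
    show "\<forall>t\<in>ball t0 r. D (a + t *s b) \<noteq> 0 \<and>
        bij_betw (\<lambda>z. g z (a + t *s b)) (fib P (a + t0 *s b)) (fib P (a + t *s b))"
      using e(2) r(2) by blast
  qed (use r(1) e(3) der in blast)+
  then show thesis by (rule that)
qed

text \<open>Single branches need not be globally defined on the punctured line, but a sum over the
  whole fibre is. It is constant on each chart, and the punctured line is connected.\<close>

lemma norm_sum_constant_on_line:
  fixes Q :: "'n \<Rightarrow> 'n cpoly"
  assumes zero: "\<And>z k. jac P z \<noteq> 0 \<Longrightarrow> pullback_deriv P b (Q k) z = 0"
  shows "(\<lambda>t. \<Sum>z\<in>fib P (a + t *s b). norm (pmap Q z)) constant_on {t. D (a + t *s b) \<noteq> 0}"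
    (is "?N constant_on ?T")
proof (rule locally_constant_imp_constant[OF connected_line_nonzero[OF polyfun_D]])
  fix t0 assume "t0 \<in> ?T"
  then have "D (a + t0 *s b) \<noteq> 0" by simp
  then obtain r \<psi> where chart: "line_chart a b t0 r \<psi>" by (rule ex_line_chart)
  then have r: "r > 0" by (simp add: line_chart_def)
  have eq: "?N t = ?N t0" if t: "t \<in> ball t0 r" for t
  proof -
    have const: "cpoly_eval (Q k) (\<psi> z t) = cpoly_eval (Q k) z" if z: "z \<in> fib P (a + t0 *s b)" for z k
    proof -
      have "((\<lambda>t. cpoly_eval (Q k) (\<psi> z t)) has_field_derivative 0) (at s within ball t0 r)"
        if s: "s \<in> ball t0 r" for s
      proof -
        have "jac P (\<psi> z s) \<noteq> 0"
          "((\<lambda>t. cpoly_eval (Q k) (\<psi> z t)) has_field_derivative pullback_deriv P b (Q k) (\<psi> z s)) (at s)"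
          using chart z s unfolding line_chart_def by blast+
        then show ?thesis using zero by (simp add: has_field_derivative_at_within)
      qed
      from has_field_derivative_zero_constant[OF convex_ball this]
      obtain c where c: "\<And>s. s \<in> ball t0 r \<Longrightarrow> cpoly_eval (Q k) (\<psi> z s) = c" by blast
      have "\<psi> z t0 = z" using chart z unfolding line_chart_def by blast
      then show ?thesis using c[OF t] c[of t0] r by simp
    qed
    have "?N t = (\<Sum>z\<in>fib P (a + t0 *s b). norm (pmap Q (\<psi> z t)))"
      by (rule sum.reindex_bij_betw[symmetric]) (use chart t in \<open>unfold line_chart_def, blast\<close>)
    also have "\<dots> = ?N t0" by (rule sum.cong) (auto simp: pmap_def const)
    finally show ?thesis .
  qed
  have "ball t0 r \<subseteq> ?T" using chart unfolding line_chart_def by blast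
  then show "\<exists>U. openin (top_of_set ?T) U \<and> t0 \<in> U \<and> (\<forall>t\<in>U. ?N t = ?N t0)"
    using r by (intro exI[of _ "ball t0 r"] conjI ballI open_subset eq) auto
qed

end

section \<open>Proper maps are dominant\<close>

definition proper_map :: "('n::finite \<Rightarrow> 'n cpoly) \<Rightarrow> bool" where
  "proper_map P \<longleftrightarrow> (\<forall>B. \<exists>C. \<forall>z. norm (pmap P z) \<le> B \<longrightarrow> norm z \<le> C)"

text \<open>Take as many of the \<open>P\<^sub>k\<close> as possible and complete them by variables to a map \<open>\<Phi>\<close> with nonzero
  Jacobian. If a variable \<open>X\<^sub>i\<close> had to be used, then moving \<open>X\<^sub>i\<close> to infinity along the fibres of the
  other components of \<open>\<Phi>\<close> leaves \<open>P\<close> bounded.\<close>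

lemma proper_map_jac:
  fixes P :: "'n::finite \<Rightarrow> 'n cpoly"
  assumes "proper_map P"
  shows "\<exists>a. jac P a \<noteq> 0"
proof -
  define ok where "ok \<Phi> \<longleftrightarrow> (\<forall>j. \<Phi> j \<in> range cpoly_var \<union> range P) \<and> (\<exists>a. jac \<Phi> a \<noteq> 0)" for \<Phi> :: "'n \<Rightarrow> 'n cpoly"
  have "ok cpoly_var" by (auto simp: ok_def jac_def bez_var)
  moreover have "card (range P \<inter> range \<Phi>) < CARD('n) + 1" for \<Phi> :: "'n \<Rightarrow> 'n cpoly"
  proof -
    have "card (range P \<inter> range \<Phi>) \<le> card (range P)" by (intro card_mono) auto
    also have "\<dots> \<le> CARD('n)" by (rule card_image_le) simp
    finally show ?thesis by simp
  qed
  ultimately obtain \<Phi> where \<Phi>: "ok \<Phi>" "\<And>\<Psi>. ok \<Psi> \<Longrightarrow> card (range P \<inter> range \<Psi>) \<le> card (range P \<inter> range \<Phi>)"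
    using ex_has_greatest_nat[of ok cpoly_var "\<lambda>\<Phi>. card (range P \<inter> range \<Phi>)"] by blast
  obtain a where a: "jac \<Phi> a \<noteq> 0" using \<Phi>(1) by (auto simp: ok_def)
  show ?thesis
  proof (cases "range \<Phi> \<subseteq> range P")
    case True
    \<comment> \<open>Equal components would give the Jacobian matrix two equal rows. By injectivity
      \<Phi> uses all of the P_k, so it is \<open>P\<close> up to a permutation of rows.\<close>
    have "inj \<Phi>"
    proof (rule injI, rule ccontr)
      fix i j assume "\<Phi> i = \<Phi> j" "i \<noteq> j"
      then have "jac \<Phi> a = 0"
        unfolding jac_def by (intro det_identical_rows[of i j]) (auto simp: row_def bez_def)
      then show False using a by simp
    qed
    then have "card (range \<Phi>) = CARD('n)" by (rule card_image)
    moreover have "card (range \<Phi>) \<le> card (range P)" using True by (intro card_mono) auto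
    moreover have "card (range P) \<le> CARD('n)" by (rule card_image_le) simp
    ultimately have card: "card (range P) = CARD('n)" "range P = range \<Phi>"
      using True card_subset_eq[of "range P" "range \<Phi>"] by auto
    then have injP: "inj P" by (intro eq_card_imp_inj_on) auto
    define \<pi> where "\<pi> = inv P \<circ> \<Phi>"
    have P\<pi>: "P (\<pi> i) = \<Phi> i" for i
      using card(2) by (auto simp: \<pi>_def intro!: f_inv_into_f)
    have "inj \<pi>"
    proof (rule injI)
      fix i j assume "\<pi> i = \<pi> j"
      then have "\<Phi> i = \<Phi> j" by (metis P\<pi>)
      then show "i = j" using \<open>inj \<Phi>\<close> by (simp add: inj_eq)
    qed
    then have "\<pi> permutes UNIV" by (intro bij_imp_permutes) (auto simp: bij_def finite_UNIV_inj_surj)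
    then have "det (\<chi> i. bez P a a $ \<pi> i) = of_int (sign \<pi>) * det (bez P a a)" by (rule det_permute_rows)
    moreover have "(\<chi> i. bez P a a $ \<pi> i) = bez \<Phi> a a" by (simp add: vec_eq_iff bez_def P\<pi>)
    ultimately have "jac P a \<noteq> 0" using a by (auto simp: jac_def)
    then show ?thesis by blast
  next
    case False
    then obtain j where j: "\<Phi> j \<notin> range P" by blast
    then obtain i where i: "\<Phi> j = cpoly_var i" using \<Phi>(1) by (auto simp: ok_def)
    obtain D where "fiber_cover \<Phi> D" using ex_fiber_cover[OF a] by blast
    then interpret \<Phi>: fiber_cover \<Phi> D .
    \<comment> \<open>In the local coordinates \<Phi>, no P_k depends on the j-th one: either P_k is
      another component of \<Phi>, or by maximality replacing \<Phi>_j by P_k gives an identically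
      vanishing Jacobian.\<close>
    have zero: "pullback_deriv \<Phi> (axis j 1) (P k) z = 0"
      if z: "jac \<Phi> z \<noteq> 0" for z k
    proof -
      define r where "r = (\<chi> l. divided_difference (P k) l z z)"
      have "det (\<chi> i. if i = j then r else bez \<Phi> z z $ i) = 0"
      proof (cases "P k \<in> range \<Phi>")
        case True
        then obtain l where l: "P k = \<Phi> l" by blast
        then have "l \<noteq> j" using j by (metis rangeI)
        then show ?thesis
          by (intro det_identical_rows[of l j]) (auto simp: row_def bez_def r_def l vec_eq_iff)
      next
        case False
        define \<Psi> where "\<Psi> = \<Phi>(j := P k)"
        have "range P \<inter> range \<Phi> \<subset> range P \<inter> range \<Psi>"
        proof
          show "range P \<inter> range \<Phi> \<subseteq> range P \<inter> range \<Psi>"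
          proof
            fix p assume p: "p \<in> range P \<inter> range \<Phi>"
            then obtain l where "p = \<Phi> l" by blast
            then have "p = \<Psi> l" using p j by (auto simp: \<Psi>_def)
            then show "p \<in> range P \<inter> range \<Psi>" using p by blast
          qed
          have "\<Psi> j = P k" by (simp add: \<Psi>_def)
          then have "P k \<in> range P \<inter> range \<Psi>" by (metis IntI rangeI)
          then show "range P \<inter> range \<Phi> \<noteq> range P \<inter> range \<Psi>" using False by blast
        qed
        then have "card (range P \<inter> range \<Phi>) < card (range P \<inter> range \<Psi>)"
          by (intro psubset_card_mono) auto
        then have "\<not> ok \<Psi>" using \<Phi>(2) by force
        moreover have "\<forall>j. \<Psi> j \<in> range cpoly_var \<union> range P"
          using \<Phi>(1) by (auto simp: ok_def \<Psi>_def)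
        ultimately have "jac \<Psi> z = 0" by (auto simp: ok_def)
        moreover have "bez \<Psi> z z = (\<chi> i. if i = j then r else bez \<Phi> z z $ i)"
          by (auto simp: vec_eq_iff bez_def \<Psi>_def r_def)
        ultimately show ?thesis by (simp add: jac_def)
      qed
      from det_replace_row[OF _ this] z show ?thesis by (simp add: jac_def r_def pullback_deriv_def)
    qed
    obtain x where x: "D (pmap \<Phi> x) \<noteq> 0" using \<Phi>.dominant by blast
    define w where "w = pmap \<Phi> x"
    let ?T = "{t. D (w + t *s axis j 1) \<noteq> 0}"
    obtain N where N: "\<And>t. t \<in> ?T \<Longrightarrow> (\<Sum>z\<in>fib \<Phi> (w + t *s axis j 1). norm (pmap P z)) = N"
      using \<Phi>.norm_sum_constant_on_line[of "axis j 1" P w, OF zero] unfolding constant_on_def by blast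
    obtain C where C: "\<And>z. norm (pmap P z) \<le> N \<Longrightarrow> norm z \<le> C"
      using assms unfolding proper_map_def by blast
    \<comment> \<open>Since \<Phi>_j is the variable X_i, a point over
      \<open>w + t *s axis j 1\<close> has i-th coordinate w_j + t. Properness confines it to a
      disc, although all but finitely many t occur.\<close>
    have "w $ j + t \<in> cball 0 C" if t: "t \<in> ?T" for t
    proof -
      have Dt: "D (w + t *s axis j 1) \<noteq> 0" using t by simp
      obtain z where z: "z \<in> fib \<Phi> (w + t *s axis j 1)" using \<Phi>.fib_nonempty[OF Dt] by blast
      have "norm (pmap P z) \<le> (\<Sum>z\<in>fib \<Phi> (w + t *s axis j 1). norm (pmap P z))"
        by (rule member_le_sum[OF z]) (use \<Phi>.finite_fib[OF Dt] in auto)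
      then have "norm z \<le> C" using C N[OF t] by simp
      moreover have "z $ i = w $ j + t"
      proof -
        have "pmap \<Phi> z $ j = w $ j + t" using z by (simp add: fib_def axis_def)
        then show ?thesis by (simp add: i)
      qed
      moreover have "norm (z $ i) \<le> norm z" by (rule Finite_Cartesian_Product.norm_nth_le)
      ultimately show ?thesis by simp
    qed
    then have "UNIV \<subseteq> (\<lambda>t. w $ j + t) -` cball 0 C \<union> {t. D (w + t *s axis j 1) = 0}" by auto
    moreover have "finite {t. D (w + t *s axis j 1) = 0}"
      by (rule polyfun_line_finite_zeros[OF \<Phi>.polyfun_D, of _ 0]) (use x in \<open>simp add: w_def\<close>)
    moreover have "dist (- w $ j) t = norm (w $ j + t)" for t
      using norm_minus_cancel[of "w $ j + t"] by (simp add: dist_norm)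
    then have "(\<lambda>t. w $ j + t) -` cball 0 C = cball (- w $ j) C" by auto
    ultimately have "bounded (UNIV :: complex set)"
      by (metis bounded_Un bounded_cball bounded_subset finite_imp_bounded)
    then show ?thesis using not_bounded_UNIV by blast
  qed
qed

section \<open>Recognising polynomials by growth on lines\<close>

definition lagrange :: "complex set \<Rightarrow> complex \<Rightarrow> complex poly" where
  "lagrange R r = smult (1 / (\<Prod>s\<in>R - {r}. r - s)) (\<Prod>s\<in>R - {r}. [:- s, 1:])"

lemma lagrange_interpolation:
  assumes "finite R" "degree q < card R"
  shows "q = (\<Sum>r\<in>R. smult (poly q r) (lagrange R r))"
proof (rule poly_eqI_degree[of R])
  fix t assume t: "t \<in> R"
  have "poly (lagrange R r) t = (if r = t then 1 else 0)" if "r \<in> R" for r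
  proof (cases "r = t")
    case True
    have "(\<Prod>s\<in>R - {t}. t - s) \<noteq> 0" using assms(1) by auto
    then show ?thesis using True by (simp add: lagrange_def poly_prod)
  next
    case False
    then show ?thesis using t assms(1) by (auto simp: lagrange_def poly_prod)
  qed
  then have "poly (\<Sum>r\<in>R. smult (poly q r) (lagrange R r)) t = (\<Sum>r\<in>R. if r = t then poly q t else 0)"
    unfolding poly_sum by (intro sum.cong) auto
  then show "poly q t = poly (\<Sum>r\<in>R. smult (poly q r) (lagrange R r)) t"
    using t assms(1) by simp
next
  have "degree (\<Sum>r\<in>R. smult (poly q r) (lagrange R r)) \<le> card R - 1"
  proof (intro degree_sum_le assms(1))
    fix r assume r: "r \<in> R"
    have "degree (\<Prod>s\<in>R - {r}. [:- s, 1:]) \<le> sum (degree \<circ> (\<lambda>s. [:- s, 1:])) (R - {r})"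
      using assms(1) by (intro degree_prod_sum_le) simp
    then have "degree (lagrange R r) \<le> card R - 1"
      using r assms(1) unfolding lagrange_def by (auto intro: order_trans[OF degree_smult_le])
    then show "degree (smult (poly q r) (lagrange R r)) \<le> card R - 1"
      by (rule order_trans[OF degree_smult_le])
  qed
  then show "degree (\<Sum>r\<in>R. smult (poly q r) (lagrange R r)) < card R" using assms(2) by linarith
qed (use assms in simp)

lemma polyfun_poly: "polyfun f \<Longrightarrow> polyfun (\<lambda>z. poly q (f z))"
  unfolding poly_altdef by (intro polyfun_intros)

text \<open>The bound makes every exceptional point removable, and Liouville's theorem for
  polynomial growth bounds the degree. The summand \<open>b\<close> absorbs the base point of a
  line, so that the degree bound \<open>k\<close> is the same for all lines.\<close>

lemma entire_extension_poly:
  fixes f :: "complex \<Rightarrow> complex"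
  assumes Z: "finite Z" and hol: "f holomorphic_on (UNIV - Z)"
    and bound: "\<And>t. t \<notin> Z \<Longrightarrow> norm (f t) \<le> C * (b + norm t) ^ k" and "0 \<le> C" "0 \<le> b"
  obtains q where "degree q \<le> k" "\<And>t. t \<notin> Z \<Longrightarrow> f t = poly q t"
proof -
  have "f \<in> O[at z](\<lambda>_. 1)" if "z \<in> Z" for z
  proof (rule bigoI[of _ "C * (b + (norm z + 1)) ^ k"])
    have "open (- (Z - {z}))" using Z by (intro open_Compl finite_imp_closed) simp
    then have "\<forall>\<^sub>F t in nhds z. t \<in> - (Z - {z}) \<inter> ball z 1"
      by (intro eventually_nhds_in_open open_Int) auto
    then have "\<forall>\<^sub>F t in at z. t \<noteq> z \<and> t \<in> - (Z - {z}) \<inter> ball z 1"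
      unfolding eventually_at_filter by (rule eventually_mono) auto
    then show "\<forall>\<^sub>F t in at z. norm (f t) \<le> C * (b + (norm z + 1)) ^ k * norm (1 :: complex)"
    proof eventually_elim
      case (elim t)
      have "norm t \<le> norm z + 1"
        using elim norm_triangle_sub[of t z] by (auto simp: dist_norm norm_minus_commute)
      then have "C * (b + norm t) ^ k \<le> C * (b + (norm z + 1)) ^ k"
        using assms(4,5) by (intro mult_left_mono power_mono) auto
      then show ?case using bound[of t] elim by auto
    qed
  qed
  then obtain F where F: "F holomorphic_on UNIV" "\<And>t. t \<notin> Z \<Longrightarrow> F t = f t"
    using removable_singularities[OF Z _ hol] by auto
  obtain M where M: "\<And>z. z \<in> Z \<Longrightarrow> norm z < M"
    using finite_imp_bounded[OF Z] unfolding bounded_pos_less by blast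
  have "norm (F t) \<le> (C * 2 ^ k) * norm t ^ k" if "max b M \<le> norm t" for t
  proof -
    have "t \<notin> Z" using M[of t] that by auto
    then have "norm (F t) \<le> C * (b + norm t) ^ k" using F(2) bound by simp
    also have "\<dots> \<le> C * (2 * norm t) ^ k"
      using that assms(4,5) by (intro mult_left_mono power_mono) auto
    finally show ?thesis by (simp add: power_mult_distrib mult_ac)
  qed
  note L = Liouville_polynomial[OF F(1) this]
  define q where "q = (\<Sum>j\<le>k. Polynomial.monom ((deriv ^^ j) F 0 / fact j) j)"
  show thesis
  proof (rule that)
    show "degree q \<le> k"
      unfolding q_def by (intro degree_sum_le) (auto intro: order_trans[OF degree_monom_le])
    show "f t = poly q t" if "t \<notin> Z" for t
      using L[where \<xi> = t and A = "max b M"] F(2)[OF that] by (simp add: q_def poly_sum poly_monom)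
  qed
qed

definition vupd :: "'n set \<Rightarrow> complex ^ 'n \<Rightarrow> complex ^ 'n::finite \<Rightarrow> complex ^ 'n" where
  "vupd S a w = (\<chi> i. if i \<in> S then a $ i else w $ i)"

lemma polyfun_vupd: "polyfun f \<Longrightarrow> polyfun (\<lambda>w. f (vupd S a w))"
proof (erule polyfun_compose)
  show "polyfun (\<lambda>w. vupd S a w $ i)" for i by (cases "i \<in> S") (simp_all add: vupd_def)
qed

text \<open>A function that is polynomial of degree at most \<open>k\<close> in each variable
  separately is polynomial: interpolate in one variable at \<open>k + 1\<close> fixed nodes, where
  the slices have one free variable less. Since h is only known off \<open>D = 0\<close>, the result
  is generic.\<close>

lemma generic_interpolation:
  fixes h D :: "complex ^ 'n::finite \<Rightarrow> complex"
  assumes D: "polyfun D" "D z0 \<noteq> 0"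
    and line: "\<And>w i. D w \<noteq> 0 \<Longrightarrow> \<exists>q. degree q \<le> k \<and>
      (\<forall>t. D (w + t *s axis i 1) \<noteq> 0 \<longrightarrow> h (w + t *s axis i 1) = poly q t)"
  shows "\<exists>p. polyfun p \<and> generic (\<lambda>w. h w = p w)"
proof -
  \<comment> \<open>\<open>T\<close> is the set of free variables; the others are frozen at
    \<open>a\<close>, and \<open>w0\<close> witnesses that this slice is not contained in
    \<open>D = 0\<close>.\<close>
  have "finite T \<Longrightarrow> D (vupd (- T) a w0) \<noteq> 0 \<Longrightarrow> \<exists>p. polyfun p \<and> generic (\<lambda>w. h (vupd (- T) a w) = p w)" for T a w0
  proof (induction T arbitrary: a w0 rule: finite_induct)
    case empty
    show ?case by (intro exI[of _ "\<lambda>_. h a"]) (simp add: vupd_def)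
  next
    case (insert i T)
    define S where "S = - insert i T"
    have i: "i \<notin> S" and T: "- T = insert i S" using insert.hyps by (auto simp: S_def)
    define a' where "a' r = (\<chi> l. if l = i then r else a $ l)" for r
    have step: "vupd (insert i S) (a' r) w = vupd S a w + (r - w $ i) *s axis i 1" for r w
      using i by (auto simp: vec_eq_iff vupd_def a'_def axis_def)
    have "finite {t. D (vupd S a w0 + t *s axis i 1) = 0}"
      using insert.prems by (intro polyfun_line_finite_zeros[OF D(1), of _ 0]) (simp add: S_def)
    then have "finite ((\<lambda>t. t + w0 $ i) ` {t. D (vupd S a w0 + t *s axis i 1) = 0})" by (rule finite_imageI)
    moreover have "{r. D (vupd (insert i S) (a' r) w0) = 0} \<subseteq> (\<lambda>t. t + w0 $ i) ` {t. D (vupd S a w0 + t *s axis i 1) = 0}"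
      by (auto simp: step intro!: image_eqI[of _ _ "_ - w0 $ i"])
    ultimately have "finite {r. D (vupd (insert i S) (a' r) w0) = 0}" by (rule finite_subset[rotated])
    then have "infinite (- {r. D (vupd (insert i S) (a' r) w0) = 0})"
      using infinite_UNIV_char_0 by (metis Compl_eq_Diff_UNIV Diff_infinite_finite)
    \<comment> \<open>The nodes are chosen before \<open>w\<close>, so that no slice through a node
      lies in \<open>D = 0\<close> and the induction hypothesis applies to each of them.\<close>
    then obtain R where R: "finite R" "card R = k + 1" "\<And>r. r \<in> R \<Longrightarrow> D (vupd (insert i S) (a' r) w0) \<noteq> 0"
      using infinite_arbitrarily_large[of "- {r. D (vupd (insert i S) (a' r) w0) = 0}" "k + 1"] by blast
    have "\<forall>r\<in>R. \<exists>p. polyfun p \<and> generic (\<lambda>w. h (vupd (insert i S) (a' r) w) = p w)"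
      using insert.IH[unfolded T] R(3) by blast
    from bchoice[OF this] obtain p where p: "\<And>r. r \<in> R \<Longrightarrow> polyfun (p r)"
      "\<And>r. r \<in> R \<Longrightarrow> generic (\<lambda>w. h (vupd (insert i S) (a' r) w) = p r w)" by blast
    define g where "g w = (\<Sum>r\<in>R. p r w * poly (lagrange R r) (w $ i))" for w
    have "polyfun g" unfolding g_def[abs_def] by (intro polyfun_sum polyfun_mult p polyfun_poly polyfun_nth)
    moreover have "generic (\<lambda>w. D (vupd S a w) \<noteq> 0)"
      using insert.prems by (intro genericI[OF polyfun_vupd[OF D(1)]]) (auto simp: S_def)
    moreover have "generic (\<lambda>w. \<forall>r\<in>R. h (vupd (insert i S) (a' r) w) = p r w \<and> D (vupd (insert i S) (a' r) w) \<noteq> 0)"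
      using R(3) by (intro generic_Ball R generic_conj p genericI[OF polyfun_vupd[OF D(1)]]) auto
    ultimately have "generic (\<lambda>w. h (vupd S a w) = g w)"
    proof -
      assume gen: "generic (\<lambda>w. D (vupd S a w) \<noteq> 0)"
        "generic (\<lambda>w. \<forall>r\<in>R. h (vupd (insert i S) (a' r) w) = p r w \<and> D (vupd (insert i S) (a' r) w) \<noteq> 0)"
      show ?thesis
      proof (rule generic_mono[OF generic_conj[OF gen]], elim conjE)
        fix w assume w: "D (vupd S a w) \<noteq> 0"
          "\<forall>r\<in>R. h (vupd (insert i S) (a' r) w) = p r w \<and> D (vupd (insert i S) (a' r) w) \<noteq> 0"
        obtain q where q: "degree q \<le> k"
          "\<And>t. D (vupd S a w + t *s axis i 1) \<noteq> 0 \<Longrightarrow> h (vupd S a w + t *s axis i 1) = poly q t"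
          using line[OF w(1)] by blast
        \<comment> \<open>\<open>q\<close> is parametrised by the displacement from
          \<open>vupd S a w\<close>; the shift turns it into a polynomial in the i-th coordinate
          itself, in which the nodes are given.\<close>
        define q' where "q' = pcompose q [:- w $ i, 1:]"
        have "degree q' < card R" using q(1) R(2) by (simp add: q'_def degree_pcompose)
        then have "poly q' (w $ i) = poly (\<Sum>r\<in>R. smult (poly q' r) (lagrange R r)) (w $ i)"
          using lagrange_interpolation[OF R(1)] by metis
        also have "\<dots> = g w"
          unfolding g_def poly_sum
        proof (rule sum.cong)
          fix r assume r: "r \<in> R"
          have "p r w = poly q' r"
            using w(2) r q(2)[of "r - w $ i"] by (auto simp: step q'_def poly_pcompose)
          then show "poly (smult (poly q' r) (lagrange R r)) (w $ i) = p r w * poly (lagrange R r) (w $ i)" by simp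
        qed simp
        also have "poly q' (w $ i) = h (vupd S a w)" using q(2)[of 0] w(1) by (simp add: q'_def poly_pcompose)
        finally show "h (vupd S a w) = g w" .
      qed
    qed
    with \<open>polyfun g\<close> show ?case unfolding S_def by blast
  qed
  from this[of UNIV z0 z0] D(2) show ?thesis by (simp add: vupd_def)
qed

lemma norm_scaled_axis_le: "norm (t *s axis i (1 :: complex) :: complex ^ 'n::finite) \<le> norm t"
proof -
  have "norm (t *s axis i 1 :: complex ^ 'n) \<le> (\<Sum>l\<in>UNIV. norm ((t *s axis i 1 :: complex ^ 'n) $ l))"
    unfolding norm_vec_def by (rule L2_set_le_sum) simp
  also have "\<dots> = (\<Sum>l\<in>UNIV. if l = i then norm t else 0)"
    by (rule sum.cong) (auto simp: axis_def)
  finally show ?thesis by simp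
qed

lemma generic_polynomial:
  fixes h D :: "complex ^ 'n::finite \<Rightarrow> complex"
  assumes D: "polyfun D" "D z0 \<noteq> 0"
    and hol: "\<And>a b. (\<lambda>t. h (a + t *s b)) holomorphic_on {t. D (a + t *s b) \<noteq> 0}"
    and growth: "\<And>w. D w \<noteq> 0 \<Longrightarrow> norm (h w) \<le> C * (1 + norm w) ^ k"
  shows "\<exists>p. polyfun p \<and> (\<forall>w. D w \<noteq> 0 \<longrightarrow> h w = p w)"
proof -
  have "\<exists>p. polyfun p \<and> generic (\<lambda>w. h w = p w)"
  proof (rule generic_interpolation[OF D])
    fix w :: "complex ^ 'n" and i assume w: "D w \<noteq> 0"
    let ?Z = "{t. D (w + t *s axis i 1) = 0}"
    have fin: "finite ?Z" using w by (intro polyfun_line_finite_zeros[OF D(1), of _ 0]) simp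
    have "UNIV - ?Z = {t. D (w + t *s axis i 1) \<noteq> 0}" by auto
    then have hol': "(\<lambda>t. h (w + t *s axis i 1)) holomorphic_on (UNIV - ?Z)" using hol by simp
    have bound: "norm (h (w + t *s axis i 1)) \<le> max C 0 * ((1 + norm w) + norm t) ^ k" if "t \<notin> ?Z" for t
    proof -
      have n: "norm (w + t *s axis i 1) \<le> norm w + norm t"
        using norm_triangle_ineq[of w "t *s axis i 1"] norm_scaled_axis_le[of t i] by linarith
      have "norm (h (w + t *s axis i 1)) \<le> C * (1 + norm (w + t *s axis i 1)) ^ k"
        using growth that by blast
      also have "\<dots> \<le> max C 0 * (1 + norm (w + t *s axis i 1)) ^ k" by (intro mult_right_mono) auto
      also have "\<dots> \<le> max C 0 * ((1 + norm w) + norm t) ^ k"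
        using n by (intro mult_left_mono power_mono) auto
      finally show ?thesis .
    qed
    obtain q where "degree q \<le> k" "\<And>t. t \<notin> ?Z \<Longrightarrow> h (w + t *s axis i 1) = poly q t"
      by (rule entire_extension_poly[OF fin hol' bound]) auto
    then show "\<exists>q. degree q \<le> k \<and> (\<forall>t. D (w + t *s axis i 1) \<noteq> 0 \<longrightarrow> h (w + t *s axis i 1) = poly q t)"
      by blast
  qed
  then obtain p E u where p: "polyfun p" and E: "polyfun E" "E u \<noteq> 0" "\<And>w. E w \<noteq> 0 \<Longrightarrow> h w = p w"
    unfolding generic_def by blast
  \<comment> \<open>From generic equality to equality off \<open>D = 0\<close>: on the line from
    \<open>w\<close> towards a point with E nonzero, the set where h and p differ is open, and it is
    contained in the finite zero set of E.\<close>
  have "h w = p w" if w: "D w \<noteq> 0" for w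
  proof (rule ccontr)
    assume ne: "h w \<noteq> p w"
    define b where "b = u - w"
    let ?T = "{t. D (w + t *s b) \<noteq> 0}"
    have "open ?T"
      using open_vimage[OF open_nonzero[OF D(1)] continuous_on_line[of UNIV w b]] by (simp add: vimage_def)
    moreover have "continuous_on ?T (\<lambda>t. h (w + t *s b) - p (w + t *s b))"
      by (intro continuous_on_diff holomorphic_on_imp_continuous_on hol
            continuous_on_compose2[OF polyfun_continuous_on[OF p] continuous_on_line]) auto
    ultimately have "open (?T \<inter> (\<lambda>t. h (w + t *s b) - p (w + t *s b)) -` (- {0}))" (is "open ?U")
      by (intro continuous_open_preimage) auto
    moreover have "0 \<in> ?U" using w ne by simp
    ultimately have "infinite ?U" using finite_imp_not_open by blast
    moreover have "finite {t. E (w + t *s b) = 0}"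
      using E(2) by (intro polyfun_line_finite_zeros[OF E(1), of _ 1]) (simp add: b_def)
    moreover have "?U \<subseteq> {t. E (w + t *s b) = 0}" using E(3) by force
    ultimately show False using finite_subset by blast
  qed
  with p show ?thesis by blast
qed

section \<open>Polynomial growth and coefficients of products of linear factors\<close>

lemma cpoly_eval_growth:
  fixes p :: "'n::finite cpoly"
  obtains C where "0 \<le> C" "\<And>z. norm (cpoly_eval p z) \<le> C * (1 + norm z) ^ cpoly_deg p"
proof -
  define C where "C = (\<Sum>\<nu>\<in>keys p. norm (lookup p \<nu>))"
  have "norm (cpoly_eval p z) \<le> C * (1 + norm z) ^ cpoly_deg p" for z
  proof -
    have mon: "norm (mon \<nu> z) \<le> (1 + norm z) ^ cpoly_deg p" if "\<nu> \<in> keys p" for \<nu>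
    proof -
      have "norm (mon \<nu> z) = (\<Prod>i\<in>UNIV. norm (z $ i) ^ lookup \<nu> i)"
        by (simp add: mon_def norm_power flip: prod_norm)
      also have "\<dots> \<le> (\<Prod>i\<in>UNIV. (1 + norm z) ^ lookup \<nu> i)"
      proof (intro prod_mono conjI power_mono zero_le_power norm_ge_zero)
        show "norm (z $ i) \<le> 1 + norm z" for i
          using Finite_Cartesian_Product.norm_nth_le[of z i] by linarith
      qed
      also have "\<dots> = (1 + norm z) ^ mi_length \<nu>" by (simp add: mi_length_def power_sum)
      also have "\<dots> \<le> (1 + norm z) ^ cpoly_deg p"
        using mi_length_le_cpoly_deg[OF that] by (intro power_increasing) auto
      finally show ?thesis .
    qed
    have "norm (cpoly_eval p z) \<le> (\<Sum>\<nu>\<in>keys p. norm (lookup p \<nu>) * (1 + norm z) ^ cpoly_deg p)"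
      unfolding cpoly_eval_mon by (intro sum_norm_le) (auto simp: norm_mult intro!: mult_left_mono mon)
    then show ?thesis by (simp add: C_def sum_distrib_right)
  qed
  moreover have "0 \<le> C" unfolding C_def by (intro sum_nonneg) simp
  ultimately show thesis using that by blast
qed

lemma polyfun_growth:
  assumes "polyfun f"
  obtains C d where "0 \<le> C" "\<And>z. norm (f z) \<le> C * (1 + norm z) ^ d"
  using assms cpoly_eval_growth unfolding polyfun_def by metis

lemma holomorphic_coeff_prod:
  assumes "finite A" "\<And>z. z \<in> A \<Longrightarrow> \<phi> z holomorphic_on S"
  shows "(\<lambda>t. coeff (\<Prod>z\<in>A. [:- \<phi> z t, 1:]) k) holomorphic_on S"
  using assms
proof (induction A arbitrary: k rule: finite_induct)
  case (insert a A)
  have "(\<lambda>t. coeff (\<Prod>z\<in>insert a A. [:- \<phi> z t, 1:]) k) =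
      (\<lambda>t. - \<phi> a t * coeff (\<Prod>z\<in>A. [:- \<phi> z t, 1:]) k +
        (if k = 0 then 0 else coeff (\<Prod>z\<in>A. [:- \<phi> z t, 1:]) (k - 1)))"
    using insert.hyps by (cases k) (simp_all add: fun_eq_iff)
  moreover have "(\<lambda>t. - \<phi> a t * coeff (\<Prod>z\<in>A. [:- \<phi> z t, 1:]) k +
        (if k = 0 then 0 else coeff (\<Prod>z\<in>A. [:- \<phi> z t, 1:]) (k - 1))) holomorphic_on S"
    using insert by (cases k) (auto intro!: holomorphic_intros)
  ultimately show ?case by simp
qed simp

lemma norm_coeff_prod_le:
  fixes \<phi> :: "'a \<Rightarrow> complex"
  assumes "finite A" "\<And>z. z \<in> A \<Longrightarrow> norm (\<phi> z) \<le> M" "0 \<le> M"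
  shows "norm (coeff (\<Prod>z\<in>A. [:- \<phi> z, 1:]) k) \<le> (1 + M) ^ card A"
  using assms
proof (induction A arbitrary: k rule: finite_induct)
  case empty
  show ?case by (cases k) auto
next
  case (insert a A)
  let ?q = "\<Prod>z\<in>A. [:- \<phi> z, 1:]"
  have IH: "norm (coeff ?q k) \<le> (1 + M) ^ card A" for k using insert by auto
  have "norm (coeff (\<Prod>z\<in>insert a A. [:- \<phi> z, 1:]) k) \<le> norm (\<phi> a) * norm (coeff ?q k) + (1 + M) ^ card A"
  proof (cases k)
    case 0
    then show ?thesis using insert by (simp add: norm_mult)
  next
    case (Suc l)
    have "norm (coeff (\<Prod>z\<in>insert a A. [:- \<phi> z, 1:]) k) = norm (- (\<phi> a * coeff ?q k) + coeff ?q l)"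
      using insert.hyps Suc by simp
    also have "\<dots> \<le> norm (- (\<phi> a * coeff ?q k)) + norm (coeff ?q l)" by (rule norm_triangle_ineq)
    also have "\<dots> \<le> norm (\<phi> a) * norm (coeff ?q k) + (1 + M) ^ card A"
      using IH[of l] by (simp add: norm_mult)
    finally show ?thesis .
  qed
  also have "\<dots> \<le> M * (1 + M) ^ card A + (1 + M) ^ card A"
    using insert.prems IH by (intro add_mono mult_mono) auto
  also have "\<dots> = (1 + M) ^ card (insert a A)" using insert.hyps by (simp add: algebra_simps)
  finally show ?case .
qed

context fiber_cover
begin

lemma line_chart_holomorphic:
  assumes chart: "line_chart a b t0 r \<psi>" and z: "z \<in> fib P (a + t0 *s b)" and "polyfun f"
  shows "(\<lambda>t. f (\<psi> z t)) holomorphic_on ball t0 r"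
proof -
  obtain p where p: "f = cpoly_eval p" using assms(3) by (auto simp: polyfun_def)
  have "(\<lambda>t. f (\<psi> z t)) field_differentiable (at s)" if "s \<in> ball t0 r" for s
    using chart z that unfolding p field_differentiable_def line_chart_def by blast
  then show ?thesis
    by (simp add: holomorphic_on_def field_differentiable_at_within)
qed

lemma holomorphic_on_lineI:
  assumes "\<And>t0. D (a + t0 *s b) \<noteq> 0 \<Longrightarrow>
    \<exists>r>0. \<exists>F. F holomorphic_on ball t0 r \<and> (\<forall>t\<in>ball t0 r. h (a + t *s b) = F t)"
  shows "(\<lambda>t. h (a + t *s b)) holomorphic_on {t. D (a + t *s b) \<noteq> 0}"
  unfolding holomorphic_on_def
proof
  fix t0 assume "t0 \<in> {t. D (a + t *s b) \<noteq> 0}"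
  then obtain r F where r: "r > 0" "F holomorphic_on ball t0 r" "\<forall>t\<in>ball t0 r. h (a + t *s b) = F t"
    using assms by blast
  have "(\<lambda>t. h (a + t *s b)) holomorphic_on ball t0 r"
    using holomorphic_cong[of "ball t0 r" "ball t0 r" "\<lambda>t. h (a + t *s b)" F] r by blast
  then have "(\<lambda>t. h (a + t *s b)) field_differentiable at t0"
    using r(1) by (intro holomorphic_on_imp_differentiable_at[of _ "ball t0 r"]) auto
  then show "(\<lambda>t. h (a + t *s b)) field_differentiable at t0 within {t. D (a + t *s b) \<noteq> 0}"
    by (rule field_differentiable_at_within)
qed

end

section \<open>Symmetric functions of the fibres\<close>

text \<open>The growth condition bounds whole fibres polynomially in w, with no deterioration near
  \<open>D = 0\<close>. This is what lets symmetric functions of the fibre extend across it.\<close>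

locale proper_cover = fiber_cover P D
  for P :: "'n::finite \<Rightarrow> 'n cpoly" and D :: "complex ^ 'n \<Rightarrow> complex" +
  assumes growth: "\<exists>C k. \<forall>z. norm z \<le> C * (1 + norm (pmap P z)) ^ k"
begin

lemma D_nonzero: "\<exists>w. D w \<noteq> 0"
  using dominant by blast

lemma polyfun_fib_growth:
  assumes "polyfun f"
  obtains A K where "1 \<le> A" "\<And>w z. z \<in> fib P w \<Longrightarrow> norm (f z) \<le> A * (1 + norm w) ^ K"
proof -
  obtain C d where C: "0 \<le> C" "\<And>z. norm (f z) \<le> C * (1 + norm z) ^ d"
    using polyfun_growth[OF assms] by blast
  obtain B k where B: "\<And>z. norm z \<le> B * (1 + norm (pmap P z)) ^ k" using growth by blast
  define B' where "B' = 1 + max B 0"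
  have "norm (f z) \<le> (1 + C * B' ^ d) * (1 + norm w) ^ (k * d)" if "z \<in> fib P w" for z w
  proof -
    have "pmap P z = w" using that by (simp add: fib_def)
    then have "norm z \<le> max B 0 * (1 + norm w) ^ k"
      using B[of z] mult_right_mono[of B "max B 0" "(1 + norm w) ^ k"] by simp
    moreover have "1 \<le> (1 + norm w) ^ k" by (intro one_le_power) simp
    ultimately have "1 + norm z \<le> B' * (1 + norm w) ^ k"
      unfolding B'_def distrib_right mult_1 by linarith
    then have "(1 + norm z) ^ d \<le> (B' * (1 + norm w) ^ k) ^ d" by (intro power_mono) auto
    then have "norm (f z) \<le> C * (B' * (1 + norm w) ^ k) ^ d"
      using C(2)[of z] mult_left_mono[OF _ C(1)] order_trans by blast
    also have "\<dots> = C * B' ^ d * (1 + norm w) ^ (k * d)" by (simp add: power_mult_distrib power_mult)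
    also have "\<dots> \<le> (1 + C * B' ^ d) * (1 + norm w) ^ (k * d)" by (intro mult_right_mono) auto
    finally show ?thesis .
  qed
  moreover have "1 \<le> 1 + C * B' ^ d" using C(1) by (simp add: B'_def)
  ultimately show thesis using that by blast
qed

definition sheets :: nat where
  "sheets = card (fib P (SOME w. D w \<noteq> 0))"

lemma card_fib: "D w \<noteq> 0 \<Longrightarrow> card (fib P w) = sheets"
  unfolding sheets_def using someI_ex[OF D_nonzero] card_fib_eq by blast

text \<open>Up to sign these are the elementary symmetric functions of the values of
  \<open>f\<close> on the fibre: independent of any labelling of the sheets, hence holomorphic on
  lines. The number of sheets is constant, so the growth exponent is uniform.\<close>

lemma char_poly_coeff:
  assumes f: "polyfun f"
  shows "\<exists>p. polyfun p \<and> (\<forall>w. D w \<noteq> 0 \<longrightarrow> coeff (\<Prod>z\<in>fib P w. [:- f z, 1:]) k = p w)"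
proof -
  obtain w0 where w0: "D w0 \<noteq> 0" using D_nonzero by blast
  obtain A K where A: "1 \<le> A" "\<And>w z. z \<in> fib P w \<Longrightarrow> norm (f z) \<le> A * (1 + norm w) ^ K"
    using polyfun_fib_growth[OF f] by blast
  show ?thesis
  proof (rule generic_polynomial[OF polyfun_D w0])
    fix a b :: "complex ^ 'n"
    show "(\<lambda>t. coeff (\<Prod>z\<in>fib P (a + t *s b). [:- f z, 1:]) k) holomorphic_on {t. D (a + t *s b) \<noteq> 0}"
    proof (rule holomorphic_on_lineI)
      fix t0 assume t0: "D (a + t0 *s b) \<noteq> 0"
      then obtain r \<psi> where chart: "line_chart a b t0 r \<psi>" by (rule ex_line_chart)
      then have r: "r > 0" by (simp add: line_chart_def)
      have bij: "bij_betw (\<lambda>z. \<psi> z t) (fib P (a + t0 *s b)) (fib P (a + t *s b))"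
        if "t \<in> ball t0 r" for t
        using chart that unfolding line_chart_def by blast
      let ?F = "\<lambda>t. coeff (\<Prod>z\<in>fib P (a + t0 *s b). [:- f (\<psi> z t), 1:]) k"
      have "?F holomorphic_on ball t0 r"
        by (intro holomorphic_coeff_prod finite_fib t0 line_chart_holomorphic[OF chart] f)
      moreover have "coeff (\<Prod>z\<in>fib P (a + t *s b). [:- f z, 1:]) k = ?F t" if "t \<in> ball t0 r" for t
        using prod.reindex_bij_betw[OF bij[OF that], of "\<lambda>z. [:- f z, 1:]"] by simp
      ultimately show "\<exists>r>0. \<exists>F. F holomorphic_on ball t0 r \<and>
          (\<forall>t\<in>ball t0 r. coeff (\<Prod>z\<in>fib P (a + t *s b). [:- f z, 1:]) k = F t)"
        using r by blast
    qed
  next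
    fix w assume w: "D w \<noteq> 0"
    have "norm (coeff (\<Prod>z\<in>fib P w. [:- f z, 1:]) k) \<le> (1 + A * (1 + norm w) ^ K) ^ card (fib P w)"
      using A by (intro norm_coeff_prod_le finite_fib w) auto
    also have "\<dots> \<le> ((1 + A) * (1 + norm w) ^ K) ^ card (fib P w)"
    proof (rule power_mono)
      have "1 \<le> (1 + norm w) ^ K" by (intro one_le_power) simp
      then show "1 + A * (1 + norm w) ^ K \<le> (1 + A) * (1 + norm w) ^ K" by (simp add: distrib_right)
    qed (use A in auto)
    also have "\<dots> = (1 + A) ^ sheets * (1 + norm w) ^ (K * sheets)"
      by (simp add: card_fib[OF w] power_mult_distrib power_mult)
    finally show "norm (coeff (\<Prod>z\<in>fib P w. [:- f z, 1:]) k) \<le> (1 + A) ^ sheets * (1 + norm w) ^ (K * sheets)" .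
  qed
qed

text \<open>Up to sign, the discriminant of the characteristic polynomial of \<open>f\<close>. As a
  polynomial it shows that a function separating one fibre separates the generic fibre.\<close>

lemma fib_discriminant:
  assumes f: "polyfun f"
  shows "\<exists>p. polyfun p \<and> (\<forall>w. D w \<noteq> 0 \<longrightarrow> (\<Prod>z\<in>fib P w. \<Prod>z'\<in>fib P w - {z}. f z - f z') = p w)"
proof -
  obtain w0 where w0: "D w0 \<noteq> 0" using D_nonzero by blast
  obtain A K where A: "1 \<le> A" "\<And>w z. z \<in> fib P w \<Longrightarrow> norm (f z) \<le> A * (1 + norm w) ^ K"
    using polyfun_fib_growth[OF f] by blast
  show ?thesis
  proof (rule generic_polynomial[OF polyfun_D w0])
    fix a b :: "complex ^ 'n"
    show "(\<lambda>t. \<Prod>z\<in>fib P (a + t *s b). \<Prod>z'\<in>fib P (a + t *s b) - {z}. f z - f z') holomorphic_on {t. D (a + t *s b) \<noteq> 0}"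
    proof (rule holomorphic_on_lineI)
      fix t0 assume t0: "D (a + t0 *s b) \<noteq> 0"
      then obtain r \<psi> where chart: "line_chart a b t0 r \<psi>" by (rule ex_line_chart)
      then have r: "r > 0" by (simp add: line_chart_def)
      have bij: "bij_betw (\<lambda>z. \<psi> z t) (fib P (a + t0 *s b)) (fib P (a + t *s b))"
        if "t \<in> ball t0 r" for t
        using chart that unfolding line_chart_def by blast
      let ?S = "fib P (a + t0 *s b)"
      let ?F = "\<lambda>t. \<Prod>z\<in>?S. \<Prod>z'\<in>?S - {z}. f (\<psi> z t) - f (\<psi> z' t)"
      have "?F holomorphic_on ball t0 r"
        by (intro holomorphic_intros line_chart_holomorphic[OF chart] f) auto
      moreover have "(\<Prod>z\<in>fib P (a + t *s b). \<Prod>z'\<in>fib P (a + t *s b) - {z}. f z - f z') = ?F t"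
        if t: "t \<in> ball t0 r" for t
      proof -
        note bij = bij[OF t]
        have "(\<Prod>z'\<in>fib P (a + t *s b) - {\<psi> z t}. f (\<psi> z t) - f z') = (\<Prod>z'\<in>?S - {z}. f (\<psi> z t) - f (\<psi> z' t))"
          if "z \<in> ?S" for z
          by (rule prod.reindex_bij_betw[symmetric], rule bij_betw_DiffI[OF bij])
             (use that bij in \<open>auto simp: bij_betw_def\<close>)
        then show ?thesis
          using prod.reindex_bij_betw[OF bij, of "\<lambda>z. \<Prod>z'\<in>fib P (a + t *s b) - {z}. f z - f z'", symmetric]
          by simp
      qed
      ultimately show "\<exists>r>0. \<exists>F. F holomorphic_on ball t0 r \<and>
          (\<forall>t\<in>ball t0 r. (\<Prod>z\<in>fib P (a + t *s b). \<Prod>z'\<in>fib P (a + t *s b) - {z}. f z - f z') = F t)"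
        using r by blast
    qed
  next
    fix w assume w: "D w \<noteq> 0"
    let ?M = "2 * A * (1 + norm w) ^ K"
    have M1: "1 \<le> ?M"
    proof -
      have "1 * 1 \<le> A * (1 + norm w) ^ K" using A(1) by (intro mult_mono one_le_power) auto
      then show ?thesis by simp
    qed
    have inner: "norm (\<Prod>z'\<in>fib P w - {z}. f z - f z') \<le> ?M ^ sheets" if "z \<in> fib P w" for z
    proof -
      have "norm (\<Prod>z'\<in>fib P w - {z}. f z - f z') = (\<Prod>z'\<in>fib P w - {z}. norm (f z - f z'))"
        by (simp add: prod_norm)
      also have "\<dots> \<le> (\<Prod>z'\<in>fib P w - {z}. ?M)"
      proof (intro prod_mono conjI norm_ge_zero)
        fix z' assume "z' \<in> fib P w - {z}"
        then show "norm (f z - f z') \<le> ?M"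
          using norm_triangle_ineq4[of "f z" "f z'"] A(2)[OF that] A(2)[of z' w] by auto
      qed
      also have "\<dots> = ?M ^ card (fib P w - {z})" by simp
      also have "\<dots> \<le> ?M ^ sheets"
        using card_fib[OF w] by (intro power_increasing M1) (metis card_Diff1_le)
      finally show ?thesis .
    qed
    have "norm (\<Prod>z\<in>fib P w. \<Prod>z'\<in>fib P w - {z}. f z - f z') = (\<Prod>z\<in>fib P w. norm (\<Prod>z'\<in>fib P w - {z}. f z - f z'))"
      by (simp add: prod_norm)
    also have "\<dots> \<le> (\<Prod>z\<in>fib P w. ?M ^ sheets)"
      by (intro prod_mono conjI norm_ge_zero inner)
    also have "\<dots> = ((2 * A) ^ sheets) ^ sheets * (1 + norm w) ^ (K * sheets * sheets)"
      by (simp only: prod_constant card_fib[OF w] power_mult_distrib power_mult)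
    finally show "norm (\<Prod>z\<in>fib P w. \<Prod>z'\<in>fib P w - {z}. f z - f z') \<le>
        ((2 * A) ^ sheets) ^ sheets * (1 + norm w) ^ (K * sheets * sheets)" .
  qed
qed

end

section \<open>The global residue is a polynomial\<close>

lemma separating_matrix:
  fixes F :: "(complex ^ 'n::finite) set"
  assumes "finite F"
  obtains L :: "complex ^ 'n ^ 'n" where "det L \<noteq> 0" "\<And>i. inj_on (\<lambda>z. (L *v z) $ i) F"
proof -
  \<comment> \<open>The identity plus the same row \<open>u\<close> in every row: at u = 0 it is
    invertible, and every coordinate functional becomes z_i + \<Sum> u_j z_j. Two points with equal
    i-th coordinate are separated by u = e_k for a coordinate k in which they differ, so a generic
    \<open>u\<close> serves all demands at once.\<close>
  define L where "L u = (\<chi> i j. (if i = j then 1 else 0) + u $ j)" for u :: "complex ^ 'n"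
  have entry: "(L u *v z) $ i = z $ i + (\<Sum>j\<in>UNIV. u $ j * z $ j)" for u z i
  proof -
    have "(L u *v z) $ i = (\<Sum>j\<in>UNIV. (if j = i then z $ i else 0) + u $ j * z $ j)"
      unfolding L_def matrix_vector_mult_def by (auto simp: algebra_simps intro!: sum.cong)
    then show ?thesis by (simp add: sum.distrib)
  qed
  have "generic (\<lambda>u. det (L u) \<noteq> 0)"
  proof (rule genericI)
    show "polyfun (\<lambda>u. det (L u))" by (rule polyfun_det) (auto simp: L_def intro!: polyfun_intros)
    have "L 0 = mat 1" by (simp add: L_def mat_def vec_eq_iff)
    then show "det (L 0) \<noteq> 0" by simp
  qed
  moreover have "generic (\<lambda>u. \<forall>(i, a, b) \<in> UNIV \<times> {(a, b). a \<in> F \<and> b \<in> F \<and> a \<noteq> b}. (L u *v a) $ i \<noteq> (L u *v b) $ i)"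
  proof (intro generic_Ball finite_cartesian_product)
    show "finite {(a, b). a \<in> F \<and> b \<in> F \<and> a \<noteq> b}"
      by (rule finite_subset[of _ "F \<times> F"]) (use assms in auto)
    fix x assume x: "x \<in> (UNIV :: 'n set) \<times> {(a, b). a \<in> F \<and> b \<in> F \<and> a \<noteq> b}"
    obtain i a b where [simp]: "x = (i, a, b)" by (cases x) auto
    have "a \<noteq> b" using x by simp
    then obtain k where k: "a $ k \<noteq> b $ k" by (auto simp: vec_eq_iff)
    have pf: "polyfun (\<lambda>u. (L u *v a) $ i - (L u *v b) $ i)"
      unfolding entry by (intro polyfun_intros)
    have "\<exists>u. (L u *v a) $ i - (L u *v b) $ i \<noteq> 0"
    proof (cases "a $ i = b $ i")
      case True
      then have "(L (axis k 1) *v a) $ i - (L (axis k 1) *v b) $ i = a $ k - b $ k"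
        unfolding entry by (simp add: axis_def if_distrib[of "\<lambda>x. x * _"] cong: if_cong)
      then show ?thesis using k by (intro exI[of _ "axis k 1"]) simp
    next
      case False
      then show ?thesis by (intro exI[of _ 0]) (simp add: entry)
    qed
    then obtain u where "(L u *v a) $ i - (L u *v b) $ i \<noteq> 0" ..
    from genericI[OF pf this] have "generic (\<lambda>u. (L u *v a) $ i \<noteq> (L u *v b) $ i)" by simp
    then show "generic (\<lambda>u. case x of (i, a, b) \<Rightarrow> (L u *v a) $ i \<noteq> (L u *v b) $ i)" by simp
  qed simp
  ultimately obtain u where u: "det (L u) \<noteq> 0"
    "\<forall>(i, a, b) \<in> UNIV \<times> {(a, b). a \<in> F \<and> b \<in> F \<and> a \<noteq> b}. (L u *v a) $ i \<noteq> (L u *v b) $ i"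
    using generic_ex[OF generic_conj] by blast
  show thesis
  proof (rule that[OF u(1)], rule inj_onI, rule ccontr)
    fix i a b assume "a \<in> F" "b \<in> F" "(L u *v a) $ i = (L u *v b) $ i" "a \<noteq> b"
    then show False using u(2) by auto
  qed
qed

lemma monic_prod_linear:
  fixes \<phi> :: "'a \<Rightarrow> complex"
  assumes "finite A"
  shows "degree (\<Prod>z\<in>A. [:- \<phi> z, 1:]) = card A" "coeff (\<Prod>z\<in>A. [:- \<phi> z, 1:]) (card A) = 1"
proof -
  show deg: "degree (\<Prod>z\<in>A. [:- \<phi> z, 1:]) = card A"
    by (subst degree_prod_sum_eq) auto
  have "lead_coeff (\<Prod>z\<in>A. [:- \<phi> z, 1:]) = 1" by (simp add: lead_coeff_prod)
  then show "coeff (\<Prod>z\<in>A. [:- \<phi> z, 1:]) (card A) = 1" by (simp add: deg)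
qed

text \<open>Euler's identity: compare the coefficients of degree \<open>card R - 1\<close> in the
  Lagrange interpolation of T^n at the nodes \<open>R\<close>.\<close>

lemma sum_power_over_differences:
  fixes R :: "complex set"
  assumes "finite R" "n < card R"
  shows "(\<Sum>r\<in>R. r ^ n / (\<Prod>s\<in>R - {r}. r - s)) = coeff (Polynomial.monom 1 n) (card R - 1)"
proof -
  have "Polynomial.monom 1 n = (\<Sum>r\<in>R. smult (r ^ n) (lagrange R r))"
    using lagrange_interpolation[OF assms(1), of "Polynomial.monom 1 n"] assms(2)
    by (simp add: degree_monom_eq poly_monom)
  then have "coeff (Polynomial.monom 1 n) (card R - 1) = (\<Sum>r\<in>R. r ^ n * coeff (lagrange R r) (card R - 1))"
    by (simp add: coeff_sum)
  also have "\<dots> = (\<Sum>r\<in>R. r ^ n / (\<Prod>s\<in>R - {r}. r - s))"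
  proof (rule sum.cong)
    fix r assume "r \<in> R"
    then have "card (R - {r}) = card R - 1" using assms(1) by simp
    then show "r ^ n * coeff (lagrange R r) (card R - 1) = r ^ n / (\<Prod>s\<in>R - {r}. r - s)"
      using monic_prod_linear(2)[of "R - {r}" "\<lambda>s. s"] assms(1) by (simp add: lagrange_def)
  qed simp
  finally show ?thesis by simp
qed

text \<open>The sums are one-variable residues of T^n over a monic polynomial with simple roots. For
  n < m they are constants; for larger n the equation of the roots gives a recurrence with
  coefficients \<open>c k w\<close>, so the denominators never appear in the result.\<close>

lemma power_sums_polynomial:
  fixes c :: "nat \<Rightarrow> complex ^ 'n::finite \<Rightarrow> complex"
  assumes c: "\<And>k. polyfun (c k)"
  shows "\<exists>p. polyfun p \<and> (\<forall>w R. finite R \<longrightarrow> card R = m \<longrightarrow> (\<forall>r\<in>R. r ^ m + (\<Sum>k<m. c k w * r ^ k) = 0) \<longrightarrow>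
     (\<Sum>r\<in>R. r ^ n / (\<Prod>s\<in>R - {r}. r - s)) = p w)"
proof (induction n rule: less_induct)
  case (less n)
  show ?case
  proof (cases "n < m")
    case True
    then show ?thesis
      by (intro exI[of _ "\<lambda>_. coeff (Polynomial.monom 1 n) (m - 1)"])
         (use sum_power_over_differences in \<open>simp only: polyfun_const simp_thms\<close>, blast)
  next
    case False
    define S where "S R n = (\<Sum>r\<in>R. r ^ n / (\<Prod>s\<in>R - {r}. r - s))" for R :: "complex set" and n
    have "\<forall>k\<in>{..<m}. \<exists>p. polyfun p \<and> (\<forall>w R. finite R \<longrightarrow> card R = m \<longrightarrow>
        (\<forall>r\<in>R. r ^ m + (\<Sum>k<m. c k w * r ^ k) = 0) \<longrightarrow> S R (n - m + k) = p w)"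
      unfolding S_def using False by (intro ballI less) auto
    from bchoice[OF this] obtain p where "\<forall>k\<in>{..<m}. polyfun (p k) \<and> (\<forall>w R. finite R \<longrightarrow> card R = m \<longrightarrow>
        (\<forall>r\<in>R. r ^ m + (\<Sum>k<m. c k w * r ^ k) = 0) \<longrightarrow> S R (n - m + k) = p k w)"
      by blast
    then have p: "\<And>k. k < m \<Longrightarrow> polyfun (p k)"
      "\<And>k w R. k < m \<Longrightarrow> finite R \<Longrightarrow> card R = m \<Longrightarrow> \<forall>r\<in>R. r ^ m + (\<Sum>k<m. c k w * r ^ k) = 0 \<Longrightarrow> S R (n - m + k) = p k w"
      by auto
    have "S R n = - (\<Sum>k<m. c k w * p k w)"
      if R: "finite R" "card R = m" "\<forall>r\<in>R. r ^ m + (\<Sum>k<m. c k w * r ^ k) = 0" for w R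
    proof -
      have "S R n = (\<Sum>r\<in>R. - (\<Sum>k<m. c k w * (r ^ (n - m + k) / (\<Prod>s\<in>R - {r}. r - s))))"
        unfolding S_def
      proof (rule sum.cong)
        fix r assume "r \<in> R"
        then have "r ^ m = - (\<Sum>k<m. c k w * r ^ k)" using R(3) by (simp add: eq_neg_iff_add_eq_0)
        moreover have "r ^ n = r ^ (n - m) * r ^ m" using False by (simp flip: power_add)
        ultimately have "r ^ n = - (\<Sum>k<m. c k w * r ^ (n - m + k))"
          by (simp add: sum_distrib_left power_add mult_ac)
        then show "r ^ n / (\<Prod>s\<in>R - {r}. r - s) = - (\<Sum>k<m. c k w * (r ^ (n - m + k) / (\<Prod>s\<in>R - {r}. r - s)))"
          by (simp add: sum_divide_distrib)
      qed simp
      also have "\<dots> = - (\<Sum>k<m. c k w * S R (n - m + k))"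
        unfolding S_def sum_negf sum_distrib_left by (subst sum.swap) simp
      also have "\<dots> = - (\<Sum>k<m. c k w * p k w)" using p(2)[OF _ R] by simp
      finally show ?thesis .
    qed
    moreover have "polyfun (\<lambda>w. - (\<Sum>k<m. c k w * p k w))"
      by (intro polyfun_uminus polyfun_sum polyfun_mult c p) auto
    ultimately show ?thesis unfolding S_def by blast
  qed
qed

lemma DERIV_prod_linear:
  fixes \<phi> :: "'a \<Rightarrow> complex"
  assumes "finite A" "a \<in> A"
  shows "((\<lambda>t. \<Prod>z\<in>A. t - \<phi> z) has_field_derivative (\<Prod>z\<in>A - {a}. \<phi> a - \<phi> z)) (at (\<phi> a))"
proof -
  define q where "q = (\<Prod>z\<in>A - {a}. [:- \<phi> z, 1:])"
  have q: "poly q t = (\<Prod>z\<in>A - {a}. t - \<phi> z)" for t by (simp add: q_def poly_prod)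
  have "((\<lambda>t. (t - \<phi> a) * poly q t) has_field_derivative poly q (\<phi> a)) (at (\<phi> a))"
    by (auto intro!: derivative_eq_intros poly_DERIV)
  moreover have "(\<lambda>t. \<Prod>z\<in>A. t - \<phi> z) = (\<lambda>t. (t - \<phi> a) * poly q t)"
    by (rule ext) (simp add: q prod.remove[OF assms])
  ultimately show ?thesis by (simp add: q)
qed

lemma has_derivative_mult_vanishing:
  fixes f g :: "complex ^ 'n::finite \<Rightarrow> complex"
  assumes "polyfun f" "(g has_derivative g') (at x)" "g x = 0"
  shows "((\<lambda>y. f y * g y) has_derivative (\<lambda>h. f x * g' h)) (at x)"
proof -
  obtain f' where "(f has_derivative f') (at x)"
    using polyfun_differentiable[OF assms(1)] by (auto simp: differentiable_def)
  from has_derivative_mult[OF this assms(2)] assms(3) show ?thesis by simp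
qed

context proper_cover
begin

definition res :: "(complex ^ 'n \<Rightarrow> complex) \<Rightarrow> complex ^ 'n \<Rightarrow> complex" where
  "res f w = (\<Sum>z\<in>fib P w. f z / jac P z)"

text \<open>Transformation law: with coordinates \<open>y = L z\<close> that separate a fibre, the polynomials
  \<open>G\<^sub>i(t, w) = \<Prod>\<^bsub>z \<in> P\<^sup>-\<^sup>1(w)\<^esub> (t - y\<^sub>i(z))\<close> satisfy \<open>G\<^sub>i(y\<^sub>i(x), w) = \<Sum>\<^sub>j H\<^sub>i\<^sub>j(x, w) (P\<^sub>j(x) - w\<^sub>j)\<close>.
  Summing \<open>f det H / \<Prod>\<^sub>i G\<^sub>i'\<close> over the product of the root sets of the \<open>G\<^sub>i\<close>, the points outside the
  fibre do not contribute because \<open>det H\<close> vanishes there, and the points of the fibre contribute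
  \<open>det L f / jac P\<close>. The sum factors into one-variable power sums.\<close>

lemma res_polynomial:
  assumes f: "polyfun f"
  shows "\<exists>p. polyfun p \<and> generic (\<lambda>w. res f w = p w)"
proof -
  let ?m = sheets
  obtain w0 where w0: "D w0 \<noteq> 0" using D_nonzero by blast
  obtain L :: "complex ^ 'n ^ 'n" where L: "det L \<noteq> 0" "\<And>i. inj_on (\<lambda>z. (L *v z) $ i) (fib P w0)"
    using separating_matrix[OF finite_fib[OF w0]] by blast
  define y where "y i z = (L *v z) $ i" for i z
  have y: "polyfun (y i)" for i
    unfolding y_def[abs_def] matrix_vector_mult_def by (simp, intro polyfun_intros)
  have "\<forall>i. \<forall>k. \<exists>q. \<forall>w. D w \<noteq> 0 \<longrightarrow> coeff (\<Prod>z\<in>fib P w. [:- y i z, 1:]) k = cpoly_eval q w"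
    using char_poly_coeff[OF y] unfolding polyfun_def by blast
  then obtain c where c: "\<And>i k w. D w \<noteq> 0 \<Longrightarrow> coeff (\<Prod>z\<in>fib P w. [:- y i z, 1:]) k = cpoly_eval (c i k) w"
    by metis
  have "\<forall>i. \<exists>p. polyfun p \<and> (\<forall>w. D w \<noteq> 0 \<longrightarrow> (\<Prod>z\<in>fib P w. \<Prod>z'\<in>fib P w - {z}. y i z - y i z') = p w)"
    by (intro allI fib_discriminant y)
  from choice[OF this] obtain d where d: "\<And>i. polyfun (d i)"
    "\<And>i w. D w \<noteq> 0 \<Longrightarrow> (\<Prod>z\<in>fib P w. \<Prod>z'\<in>fib P w - {z}. y i z - y i z') = d i w"
    by blast
  have d_nz: "d i w \<noteq> 0 \<longleftrightarrow> inj_on (y i) (fib P w)" if "D w \<noteq> 0" for i w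
  proof -
    have "d i w \<noteq> 0 \<longleftrightarrow> (\<forall>z\<in>fib P w. \<forall>z'\<in>fib P w - {z}. y i z \<noteq> y i z')"
      unfolding d(2)[OF that, symmetric] using finite_fib[OF that] by simp
    also have "\<dots> \<longleftrightarrow> inj_on (y i) (fib P w)" unfolding inj_on_def by blast
    finally show ?thesis .
  qed
  \<comment> \<open>For such \<open>w\<close> every coordinate y_i separates the fibre. The choice
    of \<open>L\<close> for the single fibre over \<open>w0\<close> makes this a generic
    condition.\<close>
  define good where "good w \<longleftrightarrow> D w \<noteq> 0 \<and> (\<forall>i\<in>UNIV. d i w \<noteq> 0)" for w
  have good: "generic good"
    unfolding good_def[abs_def]
  proof (intro generic_conj generic_Ball)
    show "generic (\<lambda>w. D w \<noteq> 0)" using w0 by (intro genericI[OF polyfun_D]) auto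
    show "generic (\<lambda>w. d i w \<noteq> 0)" for i
      using d_nz[OF w0] L(2) by (intro genericI[OF d(1), of i w0]) (auto simp: y_def[abs_def])
  qed simp
  \<comment> \<open>Written with the extended coefficients, \<open>G\<close> is polynomial in w and
    t without restriction on w; it is a product over the fibre only off
    \<open>D = 0\<close>.\<close>
  define G where "G i w t = t ^ ?m + (\<Sum>k<?m. cpoly_eval (c i k) w * t ^ k)" for i w t
  have G_eq: "G i w t = (\<Prod>z\<in>fib P w. t - y i z)" if w: "D w \<noteq> 0" for i w t
  proof -
    let ?q = "\<Prod>z\<in>fib P w. [:- y i z, 1:]"
    have q: "degree ?q = ?m" "coeff ?q ?m = 1"
      using monic_prod_linear[OF finite_fib[OF w], of "y i"] by (simp_all add: card_fib[OF w])
    have "(\<Prod>z\<in>fib P w. t - y i z) = poly ?q t" by (simp add: poly_prod)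
    also have "\<dots> = (\<Sum>k\<le>?m. coeff ?q k * t ^ k)" by (simp only: poly_altdef q)
    also have "\<dots> = G i w t"
      using q(2) by (simp add: G_def c[OF w] flip: lessThan_Suc_atMost)
    finally show ?thesis by simp
  qed
  have G_root: "G i (pmap P x) (y i x) = 0" for i x
  proof -
    obtain a where "D (pmap P a) \<noteq> 0" using dominant by blast
    then have a: "jac P a \<noteq> 0" by (rule jac_nz)
    have "generic (\<lambda>x. G i (pmap P x) (y i x) = 0)"
    proof (rule generic_mono[OF generic_pmap[OF a]])
      show "generic (\<lambda>w. D w \<noteq> 0)" using w0 by (intro genericI[OF polyfun_D]) auto
      fix x assume x: "D (pmap P x) \<noteq> 0"
      then show "G i (pmap P x) (y i x) = 0"
        using finite_fib[OF x] by (auto simp: G_eq fib_def)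
    qed
    moreover have "polyfun (\<lambda>x. G i (pmap P x) (y i x))"
      unfolding G_def by (intro polyfun_add polyfun_sum polyfun_mult polyfun_power polyfun_pmap y) simp
    ultimately have "(\<lambda>x. G i (pmap P x) (y i x)) = (\<lambda>_. 0)"
      by (intro generic_eq_imp_eq) auto
    then show ?thesis by metis
  qed
  \<comment> \<open>Because G_i(y_i(x), P(x)) = 0, the value of G_i at (y_i(x), w) is minus the
    increment of its coefficients from w to P(x), which divided differences factor through P(x) -
    w.\<close>
  define H where "H x w = (\<chi> i j. - (\<Sum>k<?m. y i x ^ k * divided_difference (c i k) j (pmap P x) w))" for x w
  have H: "G i w (y i x) = (\<Sum>j\<in>UNIV. H x w $ i $ j * (pmap P x - w) $ j)" for i w x
  proof -
    have "G i w (y i x) = G i w (y i x) - G i (pmap P x) (y i x)" by (simp add: G_root)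
    also have "\<dots> = - (\<Sum>k<?m. y i x ^ k * (cpoly_eval (c i k) (pmap P x) - cpoly_eval (c i k) w))"
      by (simp add: G_def sum_subtractf algebra_simps)
    also have "\<dots> = - (\<Sum>k<?m. \<Sum>j\<in>UNIV. y i x ^ k * divided_difference (c i k) j (pmap P x) w * (pmap P x - w) $ j)"
      by (simp add: divided_difference sum_distrib_left mult.assoc)
    also have "\<dots> = (\<Sum>j\<in>UNIV. H x w $ i $ j * (pmap P x - w) $ j)"
      by (subst sum.swap) (simp add: H_def sum_distrib_right sum_negf)
    finally show ?thesis .
  qed
  have H_polyfun: "polyfun (\<lambda>x. H x w $ i $ j)" for w i j
    unfolding H_def
    by (simp, intro polyfun_uminus polyfun_sum polyfun_mult polyfun_power y
          polyfun_bipoly_compose[OF bipoly_divided_difference]) auto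
  \<comment> \<open>Differentiate G_i(y_i(x), w) = \<Sum> H_ij (P_j(x) - w_j) at a point of the
    fibre: the factors P_j - w_j vanish there, so the right side contributes \<open>H\<close> times
    the Jacobian matrix, the left side the rows of \<open>L\<close> scaled by G_i'. Then take
    determinants.\<close>
  have H_jac: "det (H z w) * jac P z = (\<Prod>i\<in>UNIV. \<Prod>z'\<in>fib P w - {z}. y i z - y i z') * det L"
    if w: "D w \<noteq> 0" and z: "z \<in> fib P w" for z w
  proof -
    define g where "g i = (\<Prod>z'\<in>fib P w - {z}. y i z - y i z')" for i
    have "g i * (L *v h) $ i = ((H z w ** bez P z z) *v h) $ i" for i h
    proof -
      have "(G i w has_field_derivative g i) (at (y i z))"
        using DERIV_prod_linear[OF finite_fib[OF w] z, of "y i"] unfolding g_def G_eq[OF w, abs_def] .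
      then have 1: "(G i w has_derivative (\<lambda>t. g i * t)) (at (y i z))"
        by (simp add: has_field_derivative_def)
      have bl: "bounded_linear (y i)"
        unfolding y_def[abs_def] matrix_vector_mult_def
        by (simp, intro bounded_linear_sum bounded_linear_const_mult bounded_linear_vec_nth)
      have "((\<lambda>x. G i w (y i x)) has_derivative (\<lambda>h. g i * y i h)) (at z)"
        by (rule has_derivative_compose[OF bounded_linear_imp_has_derivative[OF bl] 1])
      moreover have "((\<lambda>x. G i w (y i x)) has_derivative (\<lambda>h. \<Sum>j\<in>UNIV. H z w $ i $ j * (bez P z z *v h) $ j)) (at z)"
        unfolding H
      proof (intro has_derivative_sum has_derivative_mult_vanishing H_polyfun)
        fix j
        show "((\<lambda>x. (pmap P x - w) $ j) has_derivative (\<lambda>h. (bez P z z *v h) $ j)) (at z)"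
          using bounded_linear.has_derivative[OF bounded_linear_vec_nth pmap_has_derivative[of P z], of j]
          by (auto intro!: derivative_eq_intros)
        show "(pmap P z - w) $ j = 0" using z by (simp add: fib_def)
      qed
      ultimately have "(\<lambda>h. g i * y i h) = (\<lambda>h. \<Sum>j\<in>UNIV. H z w $ i $ j * (bez P z z *v h) $ j)"
        by (rule has_derivative_unique)
      then have "g i * y i h = (\<Sum>j\<in>UNIV. H z w $ i $ j * (bez P z z *v h) $ j)" by metis
      also have "\<dots> = (H z w *v (bez P z z *v h)) $ i" by (simp add: matrix_vector_mult_def)
      finally show ?thesis by (simp add: y_def matrix_vector_mul_assoc)
    qed
    then have "(\<chi> i. g i *s L $ i) = H z w ** bez P z z"
      by (subst matrix_eq) (simp add: vec_eq_iff matrix_vector_mult_def sum_distrib_left mult_ac)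
    then have "det (\<chi> i. g i *s L $ i) = det (H z w) * jac P z" by (simp add: det_mul jac_def)
    moreover have "det (\<chi> i. g i *s L $ i) = (\<Prod>i\<in>UNIV. g i) * det (\<chi> i. L $ i)" by (rule det_rows_mul)
    ultimately show ?thesis by (simp add: g_def)
  qed
  define L' where "L' = matrix_inv L"
  have LL': "L ** L' = mat 1" "L' ** L = mat 1" using matrix_inv_mult[OF L(1)] by (simp_all add: L'_def)
  define X where "X u = L' *v u" for u
  have yX: "y i (X u) = u $ i" for i u by (simp add: y_def X_def matrix_vector_mul_assoc LL')
  have Xy: "X (\<chi> i. y i z) = z" for z
  proof -
    have "(\<chi> i. y i z) = L *v z" by (simp add: vec_eq_iff y_def)
    then show ?thesis by (simp add: X_def matrix_vector_mul_assoc LL')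
  qed
  define B where "B u w = f (X u) * det (H (X u) w)" for u w
  have X_bi: "bipolyfun (\<lambda>u w. X u $ i)" for i
    unfolding X_def matrix_vector_mult_def
    by (simp, intro bipolyfun_sum bipolyfun_mult bipolyfun_const bipolyfun_fst)
  have "bipolyfun B"
    unfolding B_def[abs_def]
  proof (intro bipolyfun_mult bipolyfun_compose[OF f] bipolyfun_det X_bi)
    have "bipolyfun (\<lambda>u w. - 1 * (\<Sum>k<?m. u $ i ^ k * divided_difference (c i k) j (pmap P (X u)) w))" for i j
    proof (intro bipolyfun_mult bipolyfun_const bipolyfun_sum bipolyfun_power bipolyfun_fst
        bipolyfun_compose2[OF bipoly_divided_difference])
      show "bipolyfun (\<lambda>u w. pmap P (X u) $ l)" for l
        by (simp, intro bipolyfun_compose[OF polyfun_cpoly_eval] X_bi)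
    qed (rule bipolyfun_snd)
    then show "bipolyfun (\<lambda>u w. H (X u) w $ i $ j)" for i j by (simp add: H_def yX)
  qed
  then obtain e where "bipoly e B" unfolding bipolyfun_def by blast
  from bipoly_eq_sum_mon[OF this]
  obtain q where B_sum: "\<And>u w. B u w = (\<Sum>\<nu> | mi_length \<nu> \<le> e. cpoly_eval (q \<nu>) u * mon \<nu> w)"
    by metis
  define pow_sum where "pow_sum i n p \<longleftrightarrow> polyfun p \<and> (\<forall>w R. finite R \<longrightarrow> card R = ?m \<longrightarrow>
     (\<forall>r\<in>R. r ^ ?m + (\<Sum>k<?m. cpoly_eval (c i k) w * r ^ k) = 0) \<longrightarrow>
     (\<Sum>r\<in>R. r ^ n / (\<Prod>s\<in>R - {r}. r - s)) = p w)" for i n p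
  have "\<exists>p. pow_sum i n p" for i n
    unfolding pow_sum_def by (intro power_sums_polynomial polyfun_cpoly_eval)
  then obtain s where s: "\<And>i n. pow_sum i n (s i n)" by metis
  define p where "p w = (\<Sum>\<nu> | mi_length \<nu> \<le> e. \<Sum>\<alpha>\<in>keys (q \<nu>).
      lookup (q \<nu>) \<alpha> * mon \<nu> w * (\<Prod>i\<in>UNIV. s i (lookup \<alpha> i) w)) / det L" for w
  have "polyfun p"
    unfolding p_def[abs_def] divide_inverse
    using s unfolding pow_sum_def by (intro polyfun_mult polyfun_const polyfun_sum polyfun_prod polyfun_mon) blast
  moreover have "res f w = p w" if gw: "good w" for w
  proof -
    have w: "D w \<noteq> 0" and inj: "\<And>i. inj_on (y i) (fib P w)"
      using gw d_nz unfolding good_def by blast+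
    have fin: "finite (fib P w)" by (rule finite_fib[OF w])
    define R where "R i = y i ` fib P w" for i
    have R: "finite (R i)" "card (R i) = ?m" for i
      using fin card_image[OF inj] card_fib[OF w] by (simp_all add: R_def)
    have R_root: "G i w r = 0" if "r \<in> R i" for i r
      using that fin by (auto simp: G_eq[OF w] R_def)
    define \<omega> where "\<omega> i r = (\<Prod>s\<in>R i - {r}. r - s)" for i r
    have \<omega>: "\<omega> i (y i z) = (\<Prod>z'\<in>fib P w - {z}. y i z - y i z')" if "z \<in> fib P w" for i z
    proof -
      have "R i - {y i z} = y i ` (fib P w - {z})"
        using inj[of i] that by (auto simp: R_def inj_on_def)
      moreover have "inj_on (y i) (fib P w - {z})" using inj[of i] by (rule inj_on_subset) auto
      ultimately show ?thesis unfolding \<omega>_def by (simp add: prod.reindex)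
    qed
    \<comment> \<open>The summand over a tuple of roots, one for each coordinate. Such a tuple is
      the y-coordinate vector of the point \<open>X\<close> of it, which need not lie in the
      fibre.\<close>
    define \<Psi> where "\<Psi> U = B (\<chi> i. U i) w / (\<Prod>i\<in>UNIV. \<omega> i (U i))" for U
    have "(\<Sum>U\<in>PiE UNIV R. \<Psi> U) = (\<Sum>U\<in>(\<lambda>z i. y i z) ` fib P w. \<Psi> U)"
    proof (rule sum.mono_neutral_right)
      show "finite (PiE UNIV R)" using R(1) by (intro finite_PiE) auto
      show "(\<lambda>z i. y i z) ` fib P w \<subseteq> PiE UNIV R" by (auto simp: R_def)
      show "\<forall>U\<in>PiE UNIV R - (\<lambda>z i. y i z) ` fib P w. \<Psi> U = 0"
      proof
        fix U assume U: "U \<in> PiE UNIV R - (\<lambda>z i. y i z) ` fib P w"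
        define x where "x = X (\<chi> i. U i)"
        have yx: "y i x = U i" for i by (simp add: x_def yX)
        have "pmap P x \<noteq> w"
        proof
          assume "pmap P x = w"
          then have "x \<in> fib P w" by (simp add: fib_def)
          moreover have "U = (\<lambda>i. y i x)" by (simp add: yx)
          ultimately show False using U by blast
        qed
        moreover have "H x w *v (pmap P x - w) = 0"
        proof -
          have "G i w (y i x) = 0" for i using U by (auto simp: yx PiE_iff intro!: R_root)
          then show ?thesis by (simp only: H vec_eq_iff matrix_vector_mult_def) simp
        qed
        \<comment> \<open>Off the fibre P(x) - w is a nonzero vector, and \<open>H\<close>
          annihilates it because every G_i vanishes on its own roots.\<close>
        ultimately have "det (H x w) = 0"
          using matrix_inv_mult(2)[of "H x w"]
          by (metis eq_iff_diff_eq_0 matrix_vector_mul_assoc matrix_vector_mul_lid matrix_vector_mult_0_right)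
        then show "\<Psi> U = 0" by (simp add: \<Psi>_def B_def x_def)
      qed
    qed
    also have "\<dots> = (\<Sum>z\<in>fib P w. \<Psi> (\<lambda>i. y i z))"
    proof (rule sum.reindex_cong[OF _ refl])
      show "inj_on (\<lambda>z i. y i z) (fib P w)"
        using Xy by (intro inj_onI) metis
    qed simp
    also have "\<dots> = (\<Sum>z\<in>fib P w. det L * (f z / jac P z))"
    proof (rule sum.cong)
      fix z assume z: "z \<in> fib P w"
      have jz: "jac P z \<noteq> 0" using jac_nz z w by (auto simp: fib_def)
      have nz: "(\<Prod>i\<in>UNIV. \<omega> i (y i z)) \<noteq> 0"
        using R(1) by (simp add: \<omega>_def)
      have "det (H z w) * jac P z = (\<Prod>i\<in>UNIV. \<omega> i (y i z)) * det L"
        using H_jac[OF w z] by (simp add: \<omega>[OF z])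
      then have "det (H z w) / (\<Prod>i\<in>UNIV. \<omega> i (y i z)) = det L / jac P z"
        using jz nz by (simp add: field_simps)
      then show "\<Psi> (\<lambda>i. y i z) = det L * (f z / jac P z)"
        by (simp add: \<Psi>_def B_def Xy flip: times_divide_eq_right) simp
    qed simp
    also have "\<dots> = det L * res f w" by (simp add: res_def sum_distrib_left)
    finally have "det L * res f w = (\<Sum>U\<in>PiE UNIV R. \<Psi> U)" by simp
    also have "\<dots> = (\<Sum>U\<in>PiE UNIV R. \<Sum>\<nu> | mi_length \<nu> \<le> e. \<Sum>\<alpha>\<in>keys (q \<nu>).
        lookup (q \<nu>) \<alpha> * mon \<nu> w * (\<Prod>i\<in>UNIV. U i ^ lookup \<alpha> i / \<omega> i (U i)))"
      unfolding \<Psi>_def B_sum cpoly_eval_mon mon_def[of _ "\<chi> i. _ i"] sum_divide_distrib sum_distrib_right prod_dividef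
      by (simp add: mult_ac)
    also have "\<dots> = (\<Sum>\<nu> | mi_length \<nu> \<le> e. \<Sum>\<alpha>\<in>keys (q \<nu>). lookup (q \<nu>) \<alpha> * mon \<nu> w *
        (\<Sum>U\<in>PiE UNIV R. \<Prod>i\<in>UNIV. U i ^ lookup \<alpha> i / \<omega> i (U i)))"
      by (subst sum.swap, intro sum.cong refl, subst sum.swap) (simp add: sum_distrib_left)
    also have "\<dots> = (\<Sum>\<nu> | mi_length \<nu> \<le> e. \<Sum>\<alpha>\<in>keys (q \<nu>).
        lookup (q \<nu>) \<alpha> * mon \<nu> w * (\<Prod>i\<in>UNIV. s i (lookup \<alpha> i) w))"
    proof (intro sum.cong refl arg_cong2[of _ _ _ _ "(*)"])
      fix \<alpha> :: "'n multi_index"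
      \<comment> \<open>After expanding the kernel into monomials, the summand is a product of
        functions of single roots, so the sum over tuples is a product of one-variable power
        sums.\<close>
      have "(\<Sum>U\<in>PiE UNIV R. \<Prod>i\<in>UNIV. U i ^ lookup \<alpha> i / \<omega> i (U i)) =
          (\<Prod>i\<in>UNIV. \<Sum>r\<in>R i. r ^ lookup \<alpha> i / \<omega> i r)"
        by (rule prod_sum_PiE[symmetric]) (auto simp: R)
      also have "\<dots> = (\<Prod>i\<in>UNIV. s i (lookup \<alpha> i) w)"
      proof (rule prod.cong)
        fix i
        show "(\<Sum>r\<in>R i. r ^ lookup \<alpha> i / \<omega> i r) = s i (lookup \<alpha> i) w"
          using s[of i] R[of i] R_root[of _ i] unfolding \<omega>_def G_def pow_sum_def by blast
      qed simp
      finally show "(\<Sum>U\<in>PiE UNIV R. \<Prod>i\<in>UNIV. U i ^ lookup \<alpha> i / \<omega> i (U i)) =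
          (\<Prod>i\<in>UNIV. s i (lookup \<alpha> i) w)" .
    qed
    also have "\<dots> = det L * p w" using L(1) by (simp add: p_def)
    finally show ?thesis using L(1) by simp
  qed
  ultimately show ?thesis using generic_mono[OF good, of "\<lambda>w. res f w = p w"] by blast
qed

end

section \<open>Weighted degree of the residue\<close>

definition wt :: "('n::finite \<Rightarrow> real) \<Rightarrow> 'n multi_index \<Rightarrow> real" where
  "wt d \<mu> = (\<Sum>j\<in>UNIV. real (lookup \<mu> j) * d j)"

definition wscale :: "('n::finite \<Rightarrow> real) \<Rightarrow> real \<Rightarrow> complex ^ 'n \<Rightarrow> complex ^ 'n" where
  "wscale d s v = (\<chi> j. of_real (s powr d j) * v $ j)"

lemma mon_wscale:
  assumes "s > 0"
  shows "mon \<mu> (wscale d s v) = of_real (s powr wt d \<mu>) * mon \<mu> v"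
proof -
  have "(\<Prod>j\<in>UNIV. (s powr d j) ^ lookup \<mu> j) = s powr wt d \<mu>"
    unfolding wt_def using assms by (simp add: powr_sum powr_power mult.commute)
  then show ?thesis
    by (simp add: mon_def wscale_def power_mult_distrib prod.distrib flip: of_real_power of_real_prod)
qed

definition max_wt :: "('n::finite \<Rightarrow> real) \<Rightarrow> 'n cpoly \<Rightarrow> real" where
  "max_wt d p = Max (wt d ` keys p)"

definition lead_form :: "('n::finite \<Rightarrow> real) \<Rightarrow> 'n cpoly \<Rightarrow> 'n cpoly" where
  "lead_form d p = (\<Sum>\<mu> | \<mu> \<in> keys p \<and> wt d \<mu> = max_wt d p. single \<mu> (lookup p \<mu>))"

lemma lead_form_nonzero:
  assumes "p \<noteq> 0"
  shows "lead_form d p \<noteq> 0"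
proof -
  have "keys p \<noteq> {}" using assms by simp
  then have "max_wt d p \<in> wt d ` keys p" unfolding max_wt_def by (intro Max_in) auto
  then obtain \<mu> where \<mu>: "\<mu> \<in> keys p" "wt d \<mu> = max_wt d p" by force
  have "lookup (lead_form d p) \<mu> =
      (\<Sum>\<nu> | \<nu> \<in> keys p \<and> wt d \<nu> = max_wt d p. if \<nu> = \<mu> then lookup p \<mu> else 0)"
    unfolding lead_form_def lookup_sum by (rule sum.cong) (auto simp: lookup_single when_def)
  also have "\<dots> = lookup p \<mu>" using \<mu> by simp
  finally show ?thesis using \<mu>(1) by (auto simp: in_keys_iff)
qed

text \<open>Under the weighted dilation the part of top weight dominates. The limit is taken jointly
  in \<open>s\<close> and \<open>v\<close>, since nonvanishing is needed on a whole neighbourhood of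
  the ray and not only along it.\<close>

lemma cpoly_eval_wscale_tendsto:
  fixes p :: "'n::finite cpoly"
  shows "((\<lambda>(s, v). of_real (s powr (- max_wt d p)) * cpoly_eval p (wscale d s v)) \<longlongrightarrow>
     cpoly_eval (lead_form d p) v0) (at_top \<times>\<^sub>F nhds v0)"
proof -
  let ?K = "keys p"
  let ?e = "max_wt d p"
  have mon: "((\<lambda>x. mon \<mu> (snd x)) \<longlongrightarrow> mon \<mu> v0) (at_top \<times>\<^sub>F nhds v0)" for \<mu>
  proof -
    have "isCont (mon \<mu>) v0"
      using polyfun_continuous_on[OF polyfun_mon, of UNIV \<mu>] by (simp add: continuous_on_eq_continuous_at)
    then have "(mon \<mu> \<longlongrightarrow> mon \<mu> v0) (nhds v0)" by (simp add: tendsto_nhds_iff continuous_at)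
    then show ?thesis by (rule filterlim_compose) (rule filterlim_snd)
  qed
  have pow: "((\<lambda>x. of_real (fst x powr (wt d \<mu> - ?e))) \<longlongrightarrow> (if wt d \<mu> = ?e then 1 else 0 :: complex)) (at_top \<times>\<^sub>F nhds v0)"
    if "\<mu> \<in> ?K" for \<mu>
  proof -
    have "wt d \<mu> \<le> ?e" unfolding max_wt_def using that by (intro Max_ge) auto
    have "((\<lambda>s. s powr (wt d \<mu> - ?e)) \<longlongrightarrow> (if wt d \<mu> = ?e then 1 else 0)) at_top"
    proof (cases "wt d \<mu> = ?e")
      case True
      have "\<forall>\<^sub>F s in at_top. (1::real) = s powr (wt d \<mu> - ?e)"
        using eventually_gt_at_top[of 0] by eventually_elim (simp add: True)
      then show ?thesis using True by (auto intro: Lim_transform_eventually)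
    next
      case False
      then show ?thesis using \<open>wt d \<mu> \<le> ?e\<close> by (auto intro!: tendsto_neg_powr filterlim_ident)
    qed
    then have "((\<lambda>s. of_real (s powr (wt d \<mu> - ?e)) :: complex) \<longlongrightarrow> of_real (if wt d \<mu> = ?e then 1 else 0)) at_top"
      by (rule tendsto_of_real)
    then have "((\<lambda>s. of_real (s powr (wt d \<mu> - ?e)) :: complex) \<longlongrightarrow> (if wt d \<mu> = ?e then 1 else 0)) at_top"
      by (simp split: if_splits)
    then show ?thesis by (rule filterlim_compose) (rule filterlim_fst)
  qed
  have "((\<lambda>x. \<Sum>\<mu>\<in>?K. lookup p \<mu> * (of_real (fst x powr (wt d \<mu> - ?e)) * mon \<mu> (snd x)))
      \<longlongrightarrow> (\<Sum>\<mu>\<in>?K. lookup p \<mu> * ((if wt d \<mu> = ?e then 1 else 0) * mon \<mu> v0))) (at_top \<times>\<^sub>F nhds v0)"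
    by (intro tendsto_intros pow mon)
  moreover have "(\<Sum>\<mu>\<in>?K. lookup p \<mu> * ((if wt d \<mu> = ?e then 1 else 0) * mon \<mu> v0)) = cpoly_eval (lead_form d p) v0"
    unfolding lead_form_def cpoly_eval_sum cpoly_eval_single
    by (simp add: sum.inter_filter if_distrib[of "\<lambda>x. x * _"] if_distrib[of "(*) _"] cong: if_cong)
  moreover have "\<forall>\<^sub>F x in at_top \<times>\<^sub>F nhds v0.
      (\<Sum>\<mu>\<in>?K. lookup p \<mu> * (of_real (fst x powr (wt d \<mu> - ?e)) * mon \<mu> (snd x))) =
      (case x of (s, v) \<Rightarrow> of_real (s powr (- ?e)) * cpoly_eval p (wscale d s v))"
  proof -
    have "\<forall>\<^sub>F x in at_top \<times>\<^sub>F nhds v0. fst x > (0 :: real)"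
      using eventually_compose_filterlim[OF eventually_gt_at_top[of 0] filterlim_fst] .
    then show ?thesis
    proof eventually_elim
      case (elim x)
      then show ?case
        by (cases x) (auto simp: cpoly_eval_mon mon_wscale sum_distrib_left powr_diff powr_minus field_simps intro!: sum.cong)
    qed
  qed
  ultimately show ?thesis by (auto elim: Lim_transform_eventually)
qed

text \<open>Rescaling a fixed neighbourhood of \<open>v0\<close> by the dilation turns it into a
  polydisc with radii proportional to \<open>s powr d j\<close>. So a polydisc of the size that
  Cauchy's estimate needs avoids the zeros of \<open>p\<close>.\<close>

lemma weighted_polydisc_nonzero:
  fixes p :: "'n::finite cpoly"
  assumes "cpoly_eval (lead_form d p) v0 \<noteq> 0"
  obtains \<rho> s0 where "\<rho> > 0"
    "\<And>s w. s \<ge> s0 \<Longrightarrow> s > 0 \<Longrightarrow> (\<And>j. norm (w $ j - wscale d s v0 $ j) < \<rho> * s powr d j) \<Longrightarrow> cpoly_eval p w \<noteq> 0"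
proof -
  have "\<forall>\<^sub>F x in at_top \<times>\<^sub>F nhds v0. (case x of (s, v) \<Rightarrow> of_real (s powr (- max_wt d p)) * cpoly_eval p (wscale d s v)) \<noteq> 0"
    using cpoly_eval_wscale_tendsto assms by (rule tendsto_imp_eventually_ne)
  then obtain Q R where QR: "eventually Q at_top" "eventually R (nhds v0)"
    "\<And>s v. Q s \<Longrightarrow> R v \<Longrightarrow> cpoly_eval p (wscale d s v) \<noteq> 0"
    unfolding eventually_prod_filter by force
  obtain s0 where s0: "\<And>s. s \<ge> s0 \<Longrightarrow> Q s" using QR(1) by (auto simp: eventually_at_top_linorder)
  obtain \<epsilon> where \<epsilon>: "\<epsilon> > 0" "\<And>v. dist v v0 < \<epsilon> \<Longrightarrow> R v" using QR(2) by (auto simp: eventually_nhds_metric)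
  \<comment> \<open>The Euclidean norm is bounded by the sum of the n coordinate norms, so each of
    them gets an n-th part of the radius.\<close>
  define \<rho> where "\<rho> = \<epsilon> / real CARD('n)"
  show thesis
  proof (rule that[of \<rho> s0])
    show "\<rho> > 0" using \<epsilon>(1) by (simp add: \<rho>_def)
    fix s :: real and w :: "complex ^ 'n"
    assume s: "s \<ge> s0" "s > 0" and w: "\<And>j. norm (w $ j - wscale d s v0 $ j) < \<rho> * s powr d j"
    define v where "v = (\<chi> j. w $ j / of_real (s powr d j))"
    have wv: "w = wscale d s v" using s(2) by (simp add: v_def wscale_def vec_eq_iff)
    have "norm (v $ j - v0 $ j) < \<rho>" for j
    proof -
      have "w $ j - wscale d s v0 $ j = of_real (s powr d j) * (v $ j - v0 $ j)"
        by (simp add: wv wscale_def algebra_simps)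
      then have "s powr d j * norm (v $ j - v0 $ j) < s powr d j * \<rho>" using w[of j] by (simp add: norm_mult mult.commute)
      moreover have "0 < s powr d j" using s(2) by simp
      ultimately show ?thesis by (simp only: mult_less_cancel_left_pos)
    qed
    then have "(\<Sum>j\<in>UNIV. norm ((v - v0) $ j)) < (\<Sum>j\<in>(UNIV :: 'n set). \<rho>)"
      by (intro sum_strict_mono) auto
    moreover have "norm (v - v0) \<le> (\<Sum>j\<in>UNIV. norm ((v - v0) $ j))"
      unfolding norm_vec_def by (rule L2_set_le_sum) simp
    ultimately have "dist v v0 < \<epsilon>" by (simp add: dist_norm \<rho>_def)
    then show "cpoly_eval p w \<noteq> 0" unfolding wv using QR(3) s0[OF s(1)] \<epsilon>(2) by blast
  qed
qed

section \<open>Cauchy estimates for the inverse branches\<close>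

lemma norm_det_le:
  fixes A :: "complex ^ 'n ^ 'n"
  assumes "\<And>i j. norm (A $ i $ j) \<le> b j"
  shows "norm (det A) \<le> fact CARD('n) * (\<Prod>j\<in>UNIV. b j)"
proof -
  have "norm (det A) \<le> (\<Sum>p | p permutes (UNIV :: 'n set). (\<Prod>j\<in>UNIV. b j))"
    unfolding det_def
  proof (rule sum_norm_le)
    fix p :: "'n \<Rightarrow> 'n" assume "p \<in> {p. p permutes UNIV}"
    then have p: "p permutes UNIV" by simp
    have "norm (of_int (sign p) * (\<Prod>i\<in>UNIV. A $ i $ p i)) = (\<Prod>i\<in>UNIV. norm (A $ i $ p i))"
      by (simp add: norm_mult sign_def prod_norm)
    also have "\<dots> \<le> (\<Prod>i\<in>UNIV. b (p i))" by (intro prod_mono conjI norm_ge_zero assms)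
    also have "\<dots> = (\<Prod>j\<in>UNIV. b j)" by (rule prod.permute[OF p, symmetric, unfolded comp_def])
    finally show "norm (of_int (sign p) * (\<Prod>i\<in>UNIV. A $ i $ p i)) \<le> (\<Prod>j\<in>UNIV. b j)" .
  qed
  then show ?thesis by (simp add: card_permutations[OF refl finite_class.finite_UNIV])
qed

lemma divided_difference_var: "divided_difference (cpoly_var i) l z z = (if i = l then 1 else 0)"
  using arg_cong[OF bez_var[of z], of "\<lambda>A. A $ i $ l"] by (simp add: bez_def mat_def)

text \<open>Properness in scaled form: if P_j(z) = O(s^d_j) for all j, then z = O(s), with a
  constant depending only on the implied one. The scale \<open>s\<close> replaces the factor (1 +
  |z|^2)^(1/2).\<close>

definition weighted_proper :: "('n::finite \<Rightarrow> real) \<Rightarrow> ('n \<Rightarrow> 'n cpoly) \<Rightarrow> bool" where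
  "weighted_proper d P \<longleftrightarrow> (\<forall>B. \<exists>C. \<forall>s\<ge>1. \<forall>z.
     (\<forall>j. norm (cpoly_eval (P j) z) \<le> B * s powr d j) \<longrightarrow> norm z \<le> C * s)"

context fiber_cover
begin

text \<open>Cauchy's estimate for the local inverse of \<open>P\<close> on a weighted polydisc that avoids the
  branch locus: the entries of the inverse Jacobian matrix are \<open>O(s powr (1 - d j))\<close>.\<close>

lemma inverse_jac_bound:
  assumes d: "weighted_proper d P" and \<rho>: "\<rho> > 0"
    and avoid: "\<forall>s w. s \<ge> s0 \<longrightarrow> s > 0 \<longrightarrow> (\<forall>j. norm (w $ j - wscale d s v0 $ j) < \<rho> * s powr d j) \<longrightarrow> D w \<noteq> 0"
  obtains C where "0 \<le> C" "\<forall>s a. s \<ge> s0 \<longrightarrow> s \<ge> 1 \<longrightarrow> a \<in> fib P (wscale d s v0) \<longrightarrow>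
     norm a \<le> C * s \<and> norm (1 / jac P a) \<le> C * s powr (real CARD('n) - sum d UNIV)"
proof -
  \<comment> \<open>On the polydisc of radii \<open>\<rho> * s powr d j\<close> about
    \<open>wscale d s v0\<close>, every point w satisfies |w_j| \<le>
    \<open>B * s powr d j\<close>.\<close>
  define B where "B = norm v0 + \<rho>"
  obtain C where C: "\<And>s z. s \<ge> 1 \<Longrightarrow> (\<And>j. norm (cpoly_eval (P j) z) \<le> B * s powr d j) \<Longrightarrow> norm z \<le> C * s"
    using d unfolding weighted_proper_def by meson
  \<comment> \<open>The factorial counts the terms of the determinant; each of the n entry bounds
    contributes \<open>2 * C / \<rho>\<close>.\<close>
  define C1 where "C1 = fact CARD('n) * (2 * C / \<rho>) ^ CARD('n)"
  have main: "norm a \<le> C * s \<and> norm (1 / jac P a) \<le> C1 * s powr (real CARD('n) - sum d UNIV)"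
    if s: "s \<ge> s0" "s \<ge> 1" and a: "a \<in> fib P (wscale d s v0)" for s a
  proof -
    let ?w = "wscale d s v0"
    define U where "U = {w. \<forall>j. norm (w $ j - ?w $ j) < \<rho> * s powr d j}"
    have s0: "s > 0" using s by simp
    have spos: "0 < s powr d j" for j using s0 by simp
    have "U = (\<Inter>j. (\<lambda>w. w $ j) -` ball (?w $ j) (\<rho> * s powr d j))"
      by (auto simp: U_def dist_norm norm_minus_commute)
    moreover have "open ((\<lambda>w. w $ j) -` ball (?w $ j) (\<rho> * s powr d j))" for j
      by (intro open_vimage) (auto intro!: continuous_intros)
    moreover have "convex ((\<lambda>w. w $ j) -` ball (?w $ j) (\<rho> * s powr d j))" for j
      by (intro convex_linear_vimage convex_ball bounded_linear.linear bounded_linear_vec_nth)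
    ultimately have U: "open U" "convex U" by (auto intro: convex_INT)
    have wU: "?w \<in> U" using \<rho> spos by (simp add: U_def)
    have DU: "D v \<noteq> 0" if "v \<in> U" for v using avoid s(1) s0 that by (simp add: U_def)
    have pa: "pmap P a = ?w" using a by (simp add: fib_def)
    obtain g where g: "continuous_on U g" "g ?w = a" "\<And>v. v \<in> U \<Longrightarrow> pmap P (g v) = v"
      using lift_convex[OF U(2,1) DU wU pa] by blast
    have bound: "norm (g v) \<le> C * s" if v: "v \<in> U" for v
    proof (rule C[OF s(2)])
      fix j
      have "cpoly_eval (P j) (g v) = v $ j" using g(3)[OF v] by (metis pmap_nth)
      moreover have "norm (v $ j) \<le> norm (v $ j - ?w $ j) + norm (?w $ j)"
        using norm_triangle_sub[of "v $ j" "?w $ j"] by linarith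
      moreover have "norm (?w $ j) \<le> norm v0 * s powr d j"
        using Finite_Cartesian_Product.norm_nth_le[of v0 j] spos[of j] by (simp add: wscale_def norm_mult mult.commute)
      moreover have "norm (v $ j - ?w $ j) < \<rho> * s powr d j" using v by (simp add: U_def)
      ultimately show "norm (cpoly_eval (P j) (g v)) \<le> B * s powr d j" by (simp add: B_def distrib_right)
    qed
    have C0: "0 \<le> C * s" using bound[OF wU] norm_ge_zero order_trans by blast
    have ja: "jac P a \<noteq> 0" using jac_nz[of a] DU[OF wU] pa by simp
    define A where "A = matrix_inv (bez P a a)"
    have entry: "norm (A $ i $ j) \<le> (2 * C / \<rho>) * s powr (1 - d j)" for i j
    proof -
      \<comment> \<open>Half the polydisc radius: the closed disc of Cauchy's inequality then lies
        inside the polydisc, where the inverse branch is bounded by \<open>C * s\<close>.\<close>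
      define r where "r = \<rho> * s powr d j / 2"
      have r: "r > 0" using \<rho> spos by (simp add: r_def)
      define \<phi> where "\<phi> t = g (?w + t *s axis j 1) $ i" for t
      have inU: "?w + t *s axis j 1 \<in> U" if "norm t < 2 * r" for t
      proof -
        have "norm ((?w + t *s axis j 1) $ l - ?w $ l) < \<rho> * s powr d l" for l
          using that \<rho> spos[of l] by (cases "l = j") (simp_all add: axis_def r_def)
        then show ?thesis by (simp add: U_def)
      qed
      have der: "(\<phi> has_field_derivative (matrix_inv (bez P (g (?w + t *s axis j 1)) (g (?w + t *s axis j 1))) *v axis j 1) $ i) (at t)"
        if "norm t < 2 * r" for t
      proof -
        have "jac P (g (?w + t *s axis j 1)) \<noteq> 0"
          using jac_nz[of "g (?w + t *s axis j 1)"] g(3)[OF inU[OF that]] DU[OF inU[OF that]] by simp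
        from section_line_derivative[OF U(1) g(1,3) inU[OF that] this, of "cpoly_var i"]
        show ?thesis by (simp add: \<phi>_def[abs_def] pullback_deriv_def divided_difference_var if_distrib[of "\<lambda>x. x * _"] cong: if_cong)
      qed
      have hol: "\<phi> holomorphic_on ball 0 (2 * r)"
        unfolding holomorphic_on_def field_differentiable_def
        using has_field_derivative_at_within[OF der] by (metis dist_0_norm mem_ball)
      have "norm ((deriv ^^ 1) \<phi> 0) \<le> fact 1 * (C * s) / r ^ 1"
      proof (rule Cauchy_inequality)
        show "\<phi> holomorphic_on ball 0 r" using hol by (rule holomorphic_on_subset) (use r in auto)
        show "continuous_on (cball 0 r) \<phi>"
          by (rule continuous_on_subset[OF holomorphic_on_imp_continuous_on[OF hol]]) (use r in auto)
        show "0 < r" by (rule r)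
        fix t :: complex assume "norm (0 - t) = r"
        then have "norm t < 2 * r" using r by simp
        then show "norm (\<phi> t) \<le> C * s"
          unfolding \<phi>_def using order_trans[OF Finite_Cartesian_Product.norm_nth_le bound[OF inU]] by blast
      qed
      moreover have "deriv \<phi> 0 = A $ i $ j"
      proof -
        have "deriv \<phi> 0 = (A *v axis j 1) $ i"
          using DERIV_imp_deriv[OF der[of 0]] r by (simp add: A_def g(2))
        also have "\<dots> = A $ i $ j"
          by (simp add: matrix_vector_mult_def axis_def if_distrib[of "(*) _"] cong: if_cong)
        finally show ?thesis .
      qed
      ultimately have "norm (A $ i $ j) \<le> C * s / r" by simp
      also have "\<dots> = (2 * C / \<rho>) * s powr (1 - d j)"
        using s0 \<rho> by (simp add: r_def powr_diff field_simps)
      finally show ?thesis .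
    qed
    have "det A * jac P a = 1"
    proof -
      have "A ** bez P a a = mat 1" unfolding A_def by (rule matrix_inv_mult) (use ja in \<open>simp add: jac_def\<close>)
      then have "det (A ** bez P a a) = 1" by simp
      then show ?thesis by (simp add: det_mul jac_def)
    qed
    then have "1 / jac P a = det A" using ja by (simp add: field_simps)
    then have "norm (1 / jac P a) \<le> fact CARD('n) * (\<Prod>j\<in>UNIV. (2 * C / \<rho>) * s powr (1 - d j))"
      using norm_det_le[OF entry] by simp
    also have "(\<Prod>j\<in>UNIV. (2 * C / \<rho>) * s powr (1 - d j)) = (2 * C / \<rho>) ^ CARD('n) * s powr (\<Sum>j\<in>UNIV. 1 - d j)"
      using s0 by (subst prod.distrib) (simp add: powr_sum)
    also have "(\<Sum>j\<in>UNIV. 1 - d j) = real CARD('n) - sum d UNIV" by (simp add: sum_subtractf)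
    finally show ?thesis using bound[OF wU] g(2) by (simp add: C1_def)
  qed
  show thesis
  proof (rule that[of "max (max C C1) 0"]; (intro allI impI)?)
    fix s a assume s: "s \<ge> s0" "s \<ge> 1" and a: "a \<in> fib P (wscale d s v0)"
    have "C * s \<le> max (max C C1) 0 * s" using s by (intro mult_right_mono) auto
    moreover have "C1 * s powr (real CARD('n) - sum d UNIV) \<le> max (max C C1) 0 * s powr (real CARD('n) - sum d UNIV)"
      by (intro mult_right_mono) auto
    ultimately show "norm a \<le> max (max C C1) 0 * s \<and>
        norm (1 / jac P a) \<le> max (max C C1) 0 * s powr (real CARD('n) - sum d UNIV)"
      using main[OF s a] by linarith
  qed simp
qed

end

context proper_cover
begin

text \<open>Compare two growth rates along the weighted ray s \<mapsto>
  \<open>wscale d s v0\<close>. Where its leading form does not vanish, \<open>t\<close> grows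
  exactly like s to its maximal weight, while the sum over the fibre is at most of order s^(deg q +
  n - \<Sum> d_j).\<close>

lemma res_weighted_degree:
  assumes d: "weighted_proper d P" and t: "generic (\<lambda>w. res (cpoly_eval q) w = cpoly_eval t w)"
    and \<mu>: "\<mu> \<in> keys t"
  shows "wt d \<mu> + sum d UNIV \<le> real (cpoly_deg q) + real CARD('n)"
proof -
  have "t \<noteq> 0" using \<mu> by auto
  have "generic (\<lambda>w. D w \<noteq> 0)" using D_nonzero by (auto intro: genericI[OF polyfun_D])
  from generic_conj[OF this t] obtain E where E: "E \<noteq> 0"
    "\<And>w. cpoly_eval E w \<noteq> 0 \<Longrightarrow> D w \<noteq> 0 \<and> res (cpoly_eval q) w = cpoly_eval t w"
    unfolding generic_def polyfun_def by (metis cpoly_eval_zero)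
  obtain v1 where v1: "cpoly_eval (lead_form d t) v1 \<noteq> 0"
    using cpoly_nonzeroE[OF lead_form_nonzero[OF \<open>t \<noteq> 0\<close>]] by blast
  obtain v2 where v2: "cpoly_eval (lead_form d E) v2 \<noteq> 0"
    using cpoly_nonzeroE[OF lead_form_nonzero[OF E(1)]] by blast
  \<comment> \<open>The ray must see the leading part of \<open>t\<close> and at the same time run,
    with a surrounding polydisc, outside the zeros of \<open>E\<close>, where fibres and
    \<open>res\<close> are controlled.\<close>
  obtain v0 where v0: "cpoly_eval (lead_form d t) v0 \<noteq> 0" "cpoly_eval (lead_form d E) v0 \<noteq> 0"
    using polyfun_nonzero_both[OF polyfun_cpoly_eval polyfun_cpoly_eval v1 v2] by blast
  obtain \<rho> s0 where \<rho>: "\<rho> > 0" and avoid: "\<And>s w. s \<ge> s0 \<Longrightarrow> s > 0 \<Longrightarrow>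
      (\<And>j. norm (w $ j - wscale d s v0 $ j) < \<rho> * s powr d j) \<Longrightarrow> cpoly_eval E w \<noteq> 0"
    using weighted_polydisc_nonzero[OF v0(2)] by metis
  have avoid': "D w \<noteq> 0" if "s \<ge> s0" "s > 0" "\<And>j. norm (w $ j - wscale d s v0 $ j) < \<rho> * s powr d j" for s w
    using avoid[OF that] E(2) by blast
  obtain C where C: "0 \<le> C" "\<And>s a. s \<ge> s0 \<Longrightarrow> s \<ge> 1 \<Longrightarrow> a \<in> fib P (wscale d s v0) \<Longrightarrow>
     norm a \<le> C * s \<and> norm (1 / jac P a) \<le> C * s powr (real CARD('n) - sum d UNIV)"
    using inverse_jac_bound[OF d \<rho>, of s0 v0] avoid' by blast
  obtain M where M: "0 \<le> M" "\<And>z. norm (cpoly_eval q z) \<le> M * (1 + norm z) ^ cpoly_deg q"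
    using cpoly_eval_growth by blast
  define e where "e = max_wt d t"
  define \<kappa> where "\<kappa> = real (cpoly_deg q) + real CARD('n) - sum d UNIV"
  define K where "K = real sheets * (M * (1 + C) ^ cpoly_deg q * C)"
  have bound: "norm (cpoly_eval t (wscale d s v0)) \<le> K * s powr \<kappa>" if s: "s \<ge> s0" "s \<ge> 1" for s
  proof -
    let ?w = "wscale d s v0"
    have Ew: "cpoly_eval E ?w \<noteq> 0" by (rule avoid[of s]) (use s \<rho> in auto)
    then have Dw: "D ?w \<noteq> 0" and eq: "cpoly_eval t ?w = res (cpoly_eval q) ?w" using E(2) by auto
    have fiber_bound: "norm (cpoly_eval q a / jac P a) \<le> M * (1 + C) ^ cpoly_deg q * C * s powr \<kappa>" if a: "a \<in> fib P ?w" for a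
    proof -
      have "norm (cpoly_eval q a) \<le> M * (1 + norm a) ^ cpoly_deg q" by (rule M)
      also have "\<dots> \<le> M * ((1 + C) * s) ^ cpoly_deg q"
      proof (intro mult_left_mono power_mono M)
        show "1 + norm a \<le> (1 + C) * s" using C(2)[OF s a] s by (simp add: distrib_right)
      qed simp
      also have "\<dots> = M * (1 + C) ^ cpoly_deg q * s powr real (cpoly_deg q)"
        using s by (simp add: power_mult_distrib powr_realpow)
      finally have 1: "norm (cpoly_eval q a) \<le> M * (1 + C) ^ cpoly_deg q * s powr real (cpoly_deg q)" .
      have "norm (cpoly_eval q a / jac P a) = norm (cpoly_eval q a) * norm (1 / jac P a)"
        by (simp add: norm_divide)
      also have "\<dots> \<le> (M * (1 + C) ^ cpoly_deg q * s powr real (cpoly_deg q)) * (C * s powr (real CARD('n) - sum d UNIV))"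
        by (intro mult_mono 1) (use C(2)[OF s a] C(1) M(1) in auto)
      also have "\<dots> = M * (1 + C) ^ cpoly_deg q * C * s powr \<kappa>"
        using s by (simp add: \<kappa>_def powr_add[symmetric] algebra_simps flip: powr_add)
      finally show ?thesis .
    qed
    have "norm (cpoly_eval t ?w) \<le> (\<Sum>a\<in>fib P ?w. M * (1 + C) ^ cpoly_deg q * C * s powr \<kappa>)"
      unfolding eq res_def by (intro sum_norm_le fiber_bound)
    then show ?thesis by (simp add: K_def card_fib[OF Dw] mult.assoc)
  qed
  have lim: "((\<lambda>s. of_real (s powr (- e)) * cpoly_eval t (wscale d s v0)) \<longlongrightarrow> cpoly_eval (lead_form d t) v0) at_top"
  proof -
    have "filterlim (\<lambda>s. (s, v0)) (at_top \<times>\<^sub>F nhds v0) (at_top :: real filter)"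
      by (intro filterlim_Pair filterlim_ident tendsto_const)
    from filterlim_compose[OF cpoly_eval_wscale_tendsto this, of d t] show ?thesis by (simp add: e_def)
  qed
  have "e \<le> \<kappa>"
  proof (rule ccontr)
    assume "\<not> e \<le> \<kappa>"
    then have "((\<lambda>s. s powr (\<kappa> - e)) \<longlongrightarrow> 0) at_top"
      by (intro tendsto_neg_powr filterlim_ident) auto
    then have "((\<lambda>s. K * s powr (\<kappa> - e)) \<longlongrightarrow> 0) at_top" by (rule tendsto_mult_right_zero)
    moreover have "\<forall>\<^sub>F s in at_top. norm (of_real (s powr (- e)) * cpoly_eval t (wscale d s v0)) \<le> K * s powr (\<kappa> - e)"
      using eventually_ge_at_top[of s0] eventually_ge_at_top[of 1]
    proof eventually_elim
      case (elim s)
      have "norm (of_real (s powr (- e)) * cpoly_eval t (wscale d s v0)) = s powr (- e) * norm (cpoly_eval t (wscale d s v0))"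
        by (simp add: norm_mult)
      also have "\<dots> \<le> s powr (- e) * (K * s powr \<kappa>)" by (intro mult_left_mono bound elim) simp
      also have "\<dots> = K * s powr (\<kappa> - e)" using elim by (simp add: powr_diff powr_minus field_simps)
      finally show ?case .
    qed
    ultimately have "((\<lambda>s. of_real (s powr (- e)) * cpoly_eval t (wscale d s v0)) \<longlongrightarrow> 0) at_top"
      by (rule Lim_null_comparison[rotated])
    then have "cpoly_eval (lead_form d t) v0 = 0"
      using tendsto_unique[OF _ lim] by simp
    then show False using v0(1) by simp
  qed
  moreover have "wt d \<mu> \<le> e" unfolding e_def max_wt_def using \<mu> by (intro Max_ge) auto
  ultimately show ?thesis by (simp add: \<kappa>_def)
qed

end

text \<open>Apply weighted properness with s = (1 + |P(z)|)^k, where k is so large that k d_j \<ge>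
  1 for every j.\<close>

lemma weighted_proper_growth:
  fixes P :: "'n::finite \<Rightarrow> 'n cpoly"
  assumes d: "\<And>j. 0 < d j" and P: "weighted_proper d P"
  shows "\<exists>C k. \<forall>z. norm z \<le> C * (1 + norm (pmap P z)) ^ k"
proof -
  obtain C where C: "\<And>s z. s \<ge> 1 \<Longrightarrow> (\<And>j. norm (cpoly_eval (P j) z) \<le> 1 * s powr d j) \<Longrightarrow> norm z \<le> C * s"
    using P unfolding weighted_proper_def by meson
  define k where "k = nat \<lceil>\<Sum>j\<in>UNIV. 1 / d j\<rceil>"
  have kd: "1 \<le> real k * d j" for j
  proof -
    have "1 / d j \<le> (\<Sum>j\<in>UNIV. 1 / d j)" using d by (intro member_le_sum) (auto simp: less_imp_le)
    also have "\<dots> \<le> real k" unfolding k_def by linarith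
    finally show ?thesis using d[of j] by (simp add: field_simps)
  qed
  have "norm z \<le> C * (1 + norm (pmap P z)) ^ k" for z
  proof (rule C)
    let ?s = "1 + norm (pmap P z)"
    show "1 \<le> ?s ^ k" by (intro one_le_power) simp
    fix j
    have "norm (cpoly_eval (P j) z) \<le> ?s powr 1"
      using Finite_Cartesian_Product.norm_nth_le[of "pmap P z" j] by simp
    also have "\<dots> \<le> ?s powr (real k * d j)" by (intro powr_mono kd) simp
    also have "\<dots> = 1 * (?s ^ k) powr d j"
    proof -
      have "0 < ?s" by (rule add_pos_nonneg) simp_all
      then show ?thesis by (simp add: powr_powr flip: powr_realpow)
    qed
    finally show "norm (cpoly_eval (P j) z) \<le> 1 * (?s ^ k) powr d j" .
  qed
  then show ?thesis by blast
qed

text \<open>For |z| \<ge> R one of the n summands is at least c/n. Replacing 1 + |z|^2 by |z|^2 only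
  enlarges it, and the bound on P_j then gives (|z|/s)^d_j \<le> B n / c.\<close>

lemma delta_proper_weighted_proper:
  fixes P :: "'n::finite \<Rightarrow> 'n cpoly"
  assumes "delta_proper \<delta> P"
  shows "weighted_proper (\<lambda>j. real_of_rat (\<delta> j)) P"
  unfolding weighted_proper_def
proof
  fix B :: real
  define d where "d j = real_of_rat (\<delta> j)" for j
  have d: "0 < d j" for j using assms by (simp add: delta_proper_def d_def)
  obtain c R where c: "c > 0" "R > 0"
    "\<And>z. norm z \<ge> R \<Longrightarrow> (\<Sum>j\<in>UNIV. norm (cpoly_eval (P j) z) * (1 + (norm z)\<^sup>2) powr (- d j / 2)) \<ge> c"
    using assms unfolding delta_proper_def d_def by auto
  let ?n = "real CARD('n)"
  \<comment> \<open>\<open>R\<close> covers the points with |z| < R; the sum over j stands in for a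
    maximum, since it is not known which summand is large.\<close>
  define C where "C = R + (\<Sum>j\<in>UNIV. (B * ?n / c) powr (1 / d j))"
  have sum_nonneg: "0 \<le> (\<Sum>j\<in>UNIV. (B * ?n / c) powr (1 / d j))" by (intro sum_nonneg) simp
  have "norm z \<le> C * s" if s: "s \<ge> 1" and z: "\<And>j. norm (cpoly_eval (P j) z) \<le> B * s powr d j" for s z
  proof (cases "norm z < R")
    case True
    have "norm z \<le> C * 1" using True sum_nonneg by (simp add: C_def)
    also have "\<dots> \<le> C * s" using s c(2) sum_nonneg by (intro mult_left_mono) (auto simp: C_def)
    finally show ?thesis .
  next
    case False
    then have zR: "norm z \<ge> R" by simp
    then have zpos: "norm z > 0" using c(2) by linarith
    have "\<exists>j. c / ?n \<le> norm (cpoly_eval (P j) z) * (1 + (norm z)\<^sup>2) powr (- d j / 2)"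
    proof (rule ccontr)
      assume "\<not> ?thesis"
      then have "(\<Sum>j\<in>UNIV. norm (cpoly_eval (P j) z) * (1 + (norm z)\<^sup>2) powr (- d j / 2)) < (\<Sum>j\<in>(UNIV :: 'n set). c / ?n)"
        by (intro sum_strict_mono) (auto simp: not_le)
      then show False using c(3)[OF zR] by simp
    qed
    then obtain j where j: "c / ?n \<le> norm (cpoly_eval (P j) z) * (1 + (norm z)\<^sup>2) powr (- d j / 2)" by blast
    have "(1 + (norm z)\<^sup>2) powr (- d j / 2) \<le> ((norm z)\<^sup>2) powr (- d j / 2)"
      using zpos d[of j] by (intro powr_mono2') auto
    also have "\<dots> = norm z powr (- d j)"
      using zpos by (simp add: powr_powr flip: powr_numeral)
    finally have "norm (cpoly_eval (P j) z) * (1 + (norm z)\<^sup>2) powr (- d j / 2) \<le> (B * s powr d j) * norm z powr (- d j)"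
      using z[of j] by (intro mult_mono) (auto intro: order_trans[OF norm_ge_zero])
    with j have "c / ?n \<le> (B * s powr d j) * norm z powr (- d j)" by linarith
    then have "(norm z / s) powr d j \<le> B * ?n / c"
      using zpos s c(1) by (simp add: powr_divide powr_minus field_simps)
    then have "((norm z / s) powr d j) powr (1 / d j) \<le> (B * ?n / c) powr (1 / d j)"
      using d[of j] by (intro powr_mono2) auto
    moreover have "((norm z / s) powr d j) powr (1 / d j) = norm z / s"
      using zpos s d[of j] by (simp add: powr_powr)
    moreover have "(B * ?n / c) powr (1 / d j) \<le> (\<Sum>j\<in>UNIV. (B * ?n / c) powr (1 / d j))"
      by (rule member_le_sum) auto
    ultimately have "norm z / s \<le> C" using c(2) by (simp add: C_def)
    then show ?thesis using s by (simp add: field_simps)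
  qed
  then show "\<exists>C. \<forall>s\<ge>1. \<forall>z. (\<forall>j. norm (cpoly_eval (P j) z) \<le> B * s powr real_of_rat (\<delta> j)) \<longrightarrow> norm z \<le> C * s"
    unfolding d_def by blast
qed

lemma cpoly_deg_le_iff: "cpoly_deg p \<le> k \<longleftrightarrow> (\<forall>\<nu>\<in>keys p. mi_length \<nu> \<le> k)"
  unfolding cpoly_deg_def by auto

lemma cpoly_deg_mult_le: "cpoly_deg (p * q) \<le> cpoly_deg p + cpoly_deg q"
  unfolding cpoly_deg_le_iff
proof
  fix \<nu> assume "\<nu> \<in> keys (p * q)"
  from subsetD[OF keys_mult this] obtain \<alpha> \<beta>
    where "\<nu> = \<alpha> + \<beta>" "\<alpha> \<in> keys p" "\<beta> \<in> keys q" by blast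
  then show "mi_length \<nu> \<le> cpoly_deg p + cpoly_deg q"
    by (auto simp: mi_length_add intro!: add_mono mi_length_le_cpoly_deg)
qed

lemma ex_proper_cover:
  fixes P :: "'n::finite \<Rightarrow> 'n cpoly"
  assumes d: "\<And>j. 0 < d j" and P: "weighted_proper d P"
  obtains D where "proper_cover P D"
proof -
  note growth = weighted_proper_growth[OF d P]
  then obtain C k where C: "\<And>z. norm z \<le> C * (1 + norm (pmap P z)) ^ k" by blast
  have "proper_map P"
    unfolding proper_map_def
  proof (intro allI exI impI)
    fix B z assume B: "norm (pmap P z) \<le> B"
    have "norm z \<le> max C 0 * (1 + norm (pmap P z)) ^ k"
      using C[of z] mult_right_mono[of C "max C 0" "(1 + norm (pmap P z)) ^ k"] by simp
    also have "\<dots> \<le> max C 0 * (1 + B) ^ k" using B by (intro mult_left_mono power_mono) auto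
    finally show "norm z \<le> max C 0 * (1 + B) ^ k" .
  qed
  from proper_map_jac[OF this] obtain a where "jac P a \<noteq> 0" by blast
  then obtain D where "fiber_cover P D" using ex_fiber_cover by blast
  then have "proper_cover P D" using growth by (simp add: proper_cover_def proper_cover_axioms_def)
  then show thesis by (rule that)
qed

section \<open>The representation of polynomials in the ideal\<close>

theorem corollary4p1:
  fixes P :: "'n::finite \<Rightarrow> 'n cpoly" and \<delta> :: "'n \<Rightarrow> rat" and Q :: "'n cpoly"
  assumes "delta_proper \<delta> P"
    and "\<And>j. 0 < \<delta> j"
    and "Q \<in> ideal_gen (range P)"
  shows "\<exists>\<gamma> :: 'n multi_index \<Rightarrow> 'n multi_index \<Rightarrow> complex.
    Q = (\<Sum>(\<mu>, \<nu>) \<in> admissible_pairs \<delta> P Q.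
           cpoly_const (\<gamma> \<mu> \<nu>) * multi_power cpoly_var \<nu> * multi_power P \<mu>)"
proof -
  define d where "d j = real_of_rat (\<delta> j)" for j
  have d: "0 < d j" for j using assms(2) by (simp add: d_def)
  have wp: "weighted_proper d P" using delta_proper_weighted_proper[OF assms(1)] by (simp add: d_def[abs_def])
  obtain D where "proper_cover P D" using ex_proper_cover[OF d wp] by blast
  then interpret proper_cover P D .
  obtain a where "D (pmap P a) \<noteq> 0" using dominant by blast
  then have a: "jac P a \<noteq> 0" by (rule jac_nz)
  have gD: "generic (\<lambda>w. D w \<noteq> 0)" using D_nonzero by (auto intro: genericI[OF polyfun_D])
  have deg: "1 \<le> cpoly_deg (P j)" for j
  proof -
    have "0 < (of_nat (cpoly_deg (P j)) :: rat)"
      using assms(1,2) unfolding delta_proper_def by (meson less_le_trans)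
    then show ?thesis by simp
  qed
  \<comment> \<open>All degrees are at least 1, because each \<delta>_j is positive and at most deg
    P_j; so the natural subtraction does not truncate.\<close>
  define e where "e = (\<Sum>i\<in>UNIV. cpoly_deg (P i) - 1)"
  have e: "int e = (\<Sum>j\<in>UNIV. int (cpoly_deg (P j))) - int CARD('n)"
    using deg by (simp add: e_def of_nat_diff sum_subtractf)
  have "bipoly e (\<lambda>x y. det (bez P x y))"
    unfolding e_def by (rule bipoly_det) (use bipoly_divided_difference in \<open>simp add: bez_def\<close>)
  then obtain q where q: "\<And>\<nu> \<alpha>. \<alpha> \<in> keys (q \<nu>) \<Longrightarrow> mi_length \<alpha> + mi_length \<nu> \<le> e"
    "\<And>x y. det (bez P x y) = (\<Sum>\<nu> | mi_length \<nu> \<le> e. cpoly_eval (q \<nu>) x * mon \<nu> y)"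
    by (rule bipoly_eq_sum_mon) blast
  have "\<exists>t. generic (\<lambda>w. res (cpoly_eval (Q * q \<nu>)) w = cpoly_eval t w)" for \<nu>
    using res_polynomial[OF polyfun_cpoly_eval[of "Q * q \<nu>"]] unfolding polyfun_def by blast
  then obtain t where t: "\<And>\<nu>. generic (\<lambda>w. res (cpoly_eval (Q * q \<nu>)) w = cpoly_eval (t \<nu>) w)" by metis
  have const0: "lookup (t \<nu>) 0 = 0" for \<nu>
  proof -
    obtain A where A: "Q = (\<Sum>j\<in>UNIV. A j * P j)" using assms(3) mem_ideal_gen_range_iff by blast
    have "\<exists>u. generic (\<lambda>w. res (cpoly_eval (A j * q \<nu>)) w = cpoly_eval u w)" for j
      using res_polynomial[OF polyfun_cpoly_eval[of "A j * q \<nu>"]] unfolding polyfun_def by blast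
    then obtain u where u: "\<And>j. generic (\<lambda>w. res (cpoly_eval (A j * q \<nu>)) w = cpoly_eval (u j) w)" by metis
    have "generic (\<lambda>w. \<forall>j\<in>UNIV. res (cpoly_eval (A j * q \<nu>)) w = cpoly_eval (u j) w)"
      by (intro generic_Ball u) simp
    from generic_conj[OF t[of \<nu>] this]
    have "generic (\<lambda>w. cpoly_eval (t \<nu>) w = (\<Sum>j\<in>UNIV. w $ j * cpoly_eval (u j) w))"
    proof (rule generic_mono, elim conjE)
      fix w assume w: "res (cpoly_eval (Q * q \<nu>)) w = cpoly_eval (t \<nu>) w"
        "\<forall>j\<in>UNIV. res (cpoly_eval (A j * q \<nu>)) w = cpoly_eval (u j) w"
      \<comment> \<open>On the fibre over w the generator P_j is the constant w_j and can be taken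
        out of the residue; the resulting sum of multiples of the w_j has no constant term.\<close>
      have "res (cpoly_eval (Q * q \<nu>)) w = (\<Sum>z\<in>fib P w. \<Sum>j\<in>UNIV. w $ j * (cpoly_eval (A j * q \<nu>) z / jac P z))"
        unfolding res_def
      proof (rule sum.cong)
        fix z assume "z \<in> fib P w"
        then have "cpoly_eval (P j) z = w $ j" for j by (auto simp: fib_def)
        then show "cpoly_eval (Q * q \<nu>) z / jac P z = (\<Sum>j\<in>UNIV. w $ j * (cpoly_eval (A j * q \<nu>) z / jac P z))"
          by (simp add: A cpoly_eval_mult cpoly_eval_sum sum_distrib_left sum_divide_distrib mult_ac)
      qed simp
      also have "\<dots> = (\<Sum>j\<in>UNIV. w $ j * res (cpoly_eval (A j * q \<nu>)) w)"
        unfolding res_def sum_distrib_left by (rule sum.swap)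
      finally show "cpoly_eval (t \<nu>) w = (\<Sum>j\<in>UNIV. w $ j * cpoly_eval (u j) w)" using w by simp
    qed
    then have "cpoly_eval (t \<nu>) = (\<lambda>w. \<Sum>j\<in>UNIV. w $ j * cpoly_eval (u j) w)"
      by (intro generic_eq_imp_eq polyfun_sum polyfun_mult polyfun_nth polyfun_cpoly_eval)
    then have "cpoly_eval (t \<nu>) 0 = 0" by simp
    moreover have "cpoly_eval (t \<nu>) 0 = lookup (t \<nu>) 0"
    proof -
      have "mon \<mu> (0 :: complex ^ 'n) = (if \<mu> = 0 then 1 else 0)" for \<mu>
      proof (cases "\<mu> = 0")
        case False
        then obtain i where "lookup \<mu> i \<noteq> 0" by (metis lookup_zero poly_mapping_eqI)
        then have "mon \<mu> (0 :: complex ^ 'n) = 0" unfolding mon_def by (intro prod_zero) auto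
        then show ?thesis using False by simp
      qed simp
      then have "cpoly_eval (t \<nu>) 0 = (\<Sum>\<mu>\<in>keys (t \<nu>). if \<mu> = 0 then lookup (t \<nu>) 0 else 0)"
        unfolding cpoly_eval_mon by (intro sum.cong) auto
      then show ?thesis by (simp add: in_keys_iff)
    qed
    ultimately show ?thesis by simp
  qed
  have rep: "cpoly_eval Q y = (\<Sum>\<nu> | mi_length \<nu> \<le> e. mon \<nu> y * cpoly_eval (t \<nu>) (pmap P y))" for y
  proof -
    have "generic (\<lambda>w. \<forall>\<nu>\<in>{\<nu>. mi_length \<nu> \<le> e}. res (cpoly_eval (Q * q \<nu>)) w = cpoly_eval (t \<nu>) w)"
      by (intro generic_Ball t finite_mi_length_le)
    from generic_pmap[OF a generic_conj[OF gD this]]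
    have "generic (\<lambda>y. cpoly_eval Q y = (\<Sum>\<nu> | mi_length \<nu> \<le> e. mon \<nu> y * cpoly_eval (t \<nu>) (pmap P y)))"
    proof (rule generic_mono, elim conjE)
      fix y assume Dy: "D (pmap P y) \<noteq> 0"
        and ty: "\<forall>\<nu>\<in>{\<nu>. mi_length \<nu> \<le> e}. res (cpoly_eval (Q * q \<nu>)) (pmap P y) = cpoly_eval (t \<nu>) (pmap P y)"
      have "(\<Sum>\<nu> | mi_length \<nu> \<le> e. mon \<nu> y * cpoly_eval (t \<nu>) (pmap P y))
          = (\<Sum>\<nu> | mi_length \<nu> \<le> e. \<Sum>z\<in>fib P (pmap P y). mon \<nu> y * (cpoly_eval (Q * q \<nu>) z / jac P z))"
      proof (rule sum.cong)
        fix \<nu> :: "'n multi_index" assume "\<nu> \<in> {\<nu>. mi_length \<nu> \<le> e}"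
        then have "cpoly_eval (t \<nu>) (pmap P y) = res (cpoly_eval (Q * q \<nu>)) (pmap P y)" using ty by simp
        then show "mon \<nu> y * cpoly_eval (t \<nu>) (pmap P y) =
            (\<Sum>z\<in>fib P (pmap P y). mon \<nu> y * (cpoly_eval (Q * q \<nu>) z / jac P z))"
          by (simp only: res_def sum_distrib_left)
      qed simp
      also have "\<dots> = (\<Sum>z\<in>fib P (pmap P y). cpoly_eval Q z * det (bez P z y) / jac P z)"
        by (subst sum.swap) (simp add: q(2) cpoly_eval_mult sum_distrib_left sum_divide_distrib mult_ac)
      \<comment> \<open>Reassembling the q_\<nu> gives the Bezoutian, which kills every point of the
        fibre through \<open>y\<close> other than \<open>y\<close> itself; at \<open>y\<close> it
        cancels against \<open>jac P y\<close>.\<close>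
      also have "\<dots> = (\<Sum>z\<in>{y}. cpoly_eval Q z * det (bez P z y) / jac P z)"
      proof (rule sum.mono_neutral_right)
        show "finite (fib P (pmap P y))" by (rule finite_fib[OF Dy])
        show "{y} \<subseteq> fib P (pmap P y)" by (simp add: fib_def)
        show "\<forall>z\<in>fib P (pmap P y) - {y}. cpoly_eval Q z * det (bez P z y) / jac P z = 0"
        proof
          fix z assume z: "z \<in> fib P (pmap P y) - {y}"
          then have "bez P z y *v (z - y) = 0" using pmap_diff[of P z y] by (simp add: fib_def)
          moreover have "z - y \<noteq> 0" using z by simp
          ultimately have "det (bez P z y) = 0"
            using matrix_inv_mult(2)[of "bez P z y"]
            by (metis matrix_vector_mul_assoc matrix_vector_mul_lid matrix_vector_mult_0_right)
          then show "cpoly_eval Q z * det (bez P z y) / jac P z = 0" by simp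
        qed
      qed
      also have "\<dots> = cpoly_eval Q y" using jac_nz[OF Dy] by (simp add: jac_def)
      finally show "cpoly_eval Q y = (\<Sum>\<nu> | mi_length \<nu> \<le> e. mon \<nu> y * cpoly_eval (t \<nu>) (pmap P y))" by simp
    qed
    then have "cpoly_eval Q = (\<lambda>y. \<Sum>\<nu> | mi_length \<nu> \<le> e. mon \<nu> y * cpoly_eval (t \<nu>) (pmap P y))"
      by (intro generic_eq_imp_eq polyfun_sum polyfun_mult polyfun_mon polyfun_pmap polyfun_cpoly_eval)
    then show ?thesis by metis
  qed
  have adm: "(\<mu>, \<nu>) \<in> admissible_pairs \<delta> P Q" if \<nu>: "mi_length \<nu> \<le> e" and \<mu>: "\<mu> \<in> keys (t \<nu>)" for \<mu> \<nu>
  proof -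
    have "\<mu> \<noteq> 0" using \<mu> const0[of \<nu>] by (auto simp: in_keys_iff)
    moreover have "int (mi_length \<nu>) \<le> (\<Sum>j\<in>UNIV. int (cpoly_deg (P j))) - int CARD('n)"
      using \<nu> unfolding e[symmetric] by simp
    moreover have "(\<Sum>j\<in>UNIV. (of_nat (lookup \<mu> j) + 1) * \<delta> j) + of_nat (mi_length \<nu>)
       \<le> (\<Sum>j\<in>UNIV. of_nat (cpoly_deg (P j))) + of_nat (cpoly_deg Q)"
    proof -
      have "cpoly_deg (q \<nu>) + mi_length \<nu> \<le> e"
      proof -
        have "cpoly_deg (q \<nu>) \<le> e - mi_length \<nu>" unfolding cpoly_deg_le_iff using q(1)[of _ \<nu>] by force
        then show ?thesis using \<nu> by simp
      qed
      then have "cpoly_deg (Q * q \<nu>) + mi_length \<nu> \<le> cpoly_deg Q + e"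
        using cpoly_deg_mult_le[of Q "q \<nu>"] by linarith
      then have "real (cpoly_deg (Q * q \<nu>)) + real (mi_length \<nu>) \<le> real (cpoly_deg Q) + real e" by linarith
      moreover have "wt d \<mu> + sum d UNIV \<le> real (cpoly_deg (Q * q \<nu>)) + real CARD('n)"
        by (rule res_weighted_degree[OF wp t \<mu>])
      moreover have "real e = (\<Sum>j\<in>UNIV. real (cpoly_deg (P j))) - real CARD('n)"
        using arg_cong[OF e, of real_of_int] by simp
      ultimately have "wt d \<mu> + sum d UNIV + real (mi_length \<nu>) \<le> (\<Sum>j\<in>UNIV. real (cpoly_deg (P j))) + real (cpoly_deg Q)"
        by linarith
      then have "(\<Sum>j\<in>UNIV. (real (lookup \<mu> j) + 1) * d j) + real (mi_length \<nu>)
          \<le> (\<Sum>j\<in>UNIV. real (cpoly_deg (P j))) + real (cpoly_deg Q)"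
        by (simp add: wt_def distrib_right sum.distrib)
      \<comment> \<open>The analysis uses real exponents; the inequality is carried back to the
        rational weights through the order embedding.\<close>
      then have "real_of_rat ((\<Sum>j\<in>UNIV. (of_nat (lookup \<mu> j) + 1) * \<delta> j) + of_nat (mi_length \<nu>))
          \<le> real_of_rat ((\<Sum>j\<in>UNIV. of_nat (cpoly_deg (P j))) + of_nat (cpoly_deg Q))"
        by (simp add: of_rat_add of_rat_sum of_rat_mult d_def)
      then show ?thesis by (simp only: of_rat_less_eq)
    qed
    ultimately show ?thesis by (simp add: admissible_pairs_def)
  qed
  \<comment> \<open>Admissibility is only a bound on the exponents, so the index set may contain
    pairs that do not occur in the expansion; these get coefficient zero.\<close>
  define \<gamma> where "\<gamma> \<mu> \<nu> = (if mi_length \<nu> \<le> e then lookup (t \<nu>) \<mu> else 0)" for \<mu> \<nu>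
  have "Q = (\<Sum>(\<mu>, \<nu>) \<in> admissible_pairs \<delta> P Q.
           cpoly_const (\<gamma> \<mu> \<nu>) * multi_power cpoly_var \<nu> * multi_power P \<mu>)"
  proof (rule cpoly_eqI)
    fix y
    let ?T = "(SIGMA \<nu> : {\<nu>. mi_length \<nu> \<le> e}. keys (t \<nu>))"
    let ?f = "\<lambda>\<mu> \<nu>. \<gamma> \<mu> \<nu> * mon \<nu> y * mon \<mu> (pmap P y)"
    have "cpoly_eval Q y = (\<Sum>\<nu> | mi_length \<nu> \<le> e. \<Sum>\<mu>\<in>keys (t \<nu>). ?f \<mu> \<nu>)"
      unfolding rep by (intro sum.cong) (auto simp: cpoly_eval_mon sum_distrib_left \<gamma>_def mult_ac)
    also have "\<dots> = (\<Sum>(\<nu>, \<mu>)\<in>?T. ?f \<mu> \<nu>)"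
      by (intro sum.Sigma) (auto simp: finite_mi_length_le)
    also have "\<dots> = (\<Sum>(\<mu>, \<nu>)\<in>prod.swap ` ?T. ?f \<mu> \<nu>)"
      by (subst sum.reindex) (auto simp: case_prod_beta)
    also have "\<dots> = (\<Sum>(\<mu>, \<nu>)\<in>admissible_pairs \<delta> P Q. ?f \<mu> \<nu>)"
    proof (rule sum.mono_neutral_left)
      show "finite (admissible_pairs \<delta> P Q)" by (rule finite_admissible_pairs[OF assms(2)])
      show "prod.swap ` ?T \<subseteq> admissible_pairs \<delta> P Q" using adm by auto
      show "\<forall>x\<in>admissible_pairs \<delta> P Q - prod.swap ` ?T. (case x of (\<mu>, \<nu>) \<Rightarrow> ?f \<mu> \<nu>) = 0"
      proof (clarify)
        fix \<mu> \<nu> assume "(\<mu>, \<nu>) \<notin> prod.swap ` ?T"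
        then have "(\<nu>, \<mu>) \<notin> ?T" by force
        then show "?f \<mu> \<nu> = 0" by (auto simp: \<gamma>_def in_keys_iff)
      qed
    qed
    finally show "cpoly_eval Q y = cpoly_eval (\<Sum>(\<mu>, \<nu>) \<in> admissible_pairs \<delta> P Q.
           cpoly_const (\<gamma> \<mu> \<nu>) * multi_power cpoly_var \<nu> * multi_power P \<mu>) y"
      by (simp add: cpoly_eval_sum case_prod_beta cpoly_eval_mult cpoly_eval_multi_power)
  qed
  then show ?thesis by blast
qed

end
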